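(* Let $\{z_n\}$ be a sequence in $\mathbb{D}$ with $\lim_{n\to\infty}|z_n|=1$. Then there is a Blaschke subsequence $\{z_{n_k}\}$ of $\{z_n\}$ such that, with $B$ denoting the Blaschke product with zero sequence $\{z_{n_k}\}$, the operator $M_B$ on the Bergman space $L^2_a(\mathbb{D})$ has no nontrivial reducing subspace.
   Context: $L^2_a(\mathbb{D})$ is the Bergman space of holomorphic functions on the open unit disk $\mathbb{D}$ that are square integrable with respect to normalized area measure. For a bounded holomorphic $\phi$ on $\mathbb{D}$, $M_\phi$ is the operator of multiplication by $\phi$ on $L^2_a(\mathbb{D})$. A closed subspace $M$ is reducing for $M_\phi$ if $M_\phi M\subseteq M$ and $M_\phi^*M\subseteq M$; it is nontrivial if $M\ne\{0\}$ and $M\neq L^2_a(\mathbb{D})$. A Blaschke (sub)sequence is an infinite sequence $\{w_k\}$ in $\mathbb{D}$ with $\sum_k(1-|w_k|)<\infty$. *)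

theory Defs
  imports "HOL-Analysis.Analysis"
begin

abbreviation unit_disk :: "complex set" where
  "unit_disk \<equiv> ball 0 1"

definition area_measure :: "complex measure" where
  "area_measure = uniform_measure lborel unit_disk"

text \<open>A function on the disk is represented by its extension by zero to the whole plane, so that
  equality of functions on the disk is equality in HOL.\<close>

definition bergman_space :: "(complex \<Rightarrow> complex) set" where
  "bergman_space = {f. f holomorphic_on unit_disk \<and> (\<forall>z. z \<notin> unit_disk \<longrightarrow> f z = 0) \<and>
     integrable area_measure (\<lambda>z. (cmod (f z))\<^sup>2)}"

definition bergman_inner :: "(complex \<Rightarrow> complex) \<Rightarrow> (complex \<Rightarrow> complex) \<Rightarrow> complex" where
  "bergman_inner f g = (LINT z|area_measure. f z * cnj (g z))"

definition bergman_dist :: "(complex \<Rightarrow> complex) \<Rightarrow> (complex \<Rightarrow> complex) \<Rightarrow> real" where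
  "bergman_dist f g = sqrt (LINT z|area_measure. (cmod (f z - g z))\<^sup>2)"

lemma emeasure_unit_disk: "emeasure lborel unit_disk \<noteq> 0" "emeasure lborel unit_disk \<noteq> \<infinity>"
proof -
  have "unit_disk \<notin> null_sets lborel"
    using open_not_negligible[of unit_disk] by (auto simp: negligible_iff_null_sets null_sets_completionI)
  then show "emeasure lborel unit_disk \<noteq> 0" by (auto simp: null_sets_def)
  show "emeasure lborel unit_disk \<noteq> \<infinity>"
    using emeasure_lborel_ball_finite[of "0::complex" 1] by auto
qed

lemma AE_area_measure: "(AE z in area_measure. P z) \<longleftrightarrow> (AE z in lborel. z \<in> unit_disk \<longrightarrow> P z)"
  using emeasure_unit_disk unfolding area_measure_def uniform_measure_def
  by (subst AE_density) (auto simp: indicator_def ennreal_zero_less_divide zero_less_iff_neq_zero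
      intro!: AE_cong)

lemma bergman_measurable:
  assumes "f \<in> bergman_space"
  shows "f \<in> borel_measurable area_measure"
proof -
  have "(\<lambda>z. if z \<in> unit_disk then f z else 0) \<in> borel_measurable borel"
    using assms by (intro borel_measurable_continuous_on_if)
      (auto simp: bergman_space_def intro: holomorphic_on_imp_continuous_on)
  also have "(\<lambda>z. if z \<in> unit_disk then f z else 0) = f"
    using assms by (auto simp: bergman_space_def)
  finally show ?thesis by (simp add: area_measure_def cong: measurable_cong_sets)
qed

lemma cmod_sum_sq_le:
  assumes "s > 0"
  shows "(cmod (a - b))\<^sup>2 \<le> (1 + s) * (cmod a)\<^sup>2 + (1 + 1 / s) * (cmod b)\<^sup>2"
proof -
  have "(cmod (a - b))\<^sup>2 \<le> (cmod a + cmod b)\<^sup>2"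
    by (intro power_mono norm_triangle_ineq4) auto
  also have "\<dots> = (1 + s) * (cmod a)\<^sup>2 + (1 + 1 / s) * (cmod b)\<^sup>2 - (s * cmod a - cmod b)\<^sup>2 / s"
    using assms by (simp add: field_simps power2_eq_square)
  finally show ?thesis using assms by (smt (verit) divide_nonneg_pos zero_le_power2)
qed

lemma bergman_diff:
  assumes "f \<in> bergman_space" "g \<in> bergman_space"
  shows "(\<lambda>z. f z - g z) \<in> bergman_space"
proof -
  have [measurable]: "f \<in> borel_measurable area_measure" "g \<in> borel_measurable area_measure"
    using assms by (auto intro: bergman_measurable)
  have "integrable area_measure (\<lambda>z. (cmod (f z - g z))\<^sup>2)"
  proof (rule Bochner_Integration.integrable_bound)
    show "integrable area_measure (\<lambda>z. (1 + 1) * (cmod (f z))\<^sup>2 + (1 + 1 / 1) * (cmod (g z))\<^sup>2)"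
      using assms by (intro Bochner_Integration.integrable_add integrable_mult_right)
        (auto simp: bergman_space_def)
    show "AE z in area_measure. norm ((cmod (f z - g z))\<^sup>2)
        \<le> norm ((1 + 1) * (cmod (f z))\<^sup>2 + (1 + 1 / 1) * (cmod (g z))\<^sup>2)"
      by (rule AE_I2) (use cmod_sum_sq_le[of 1] in \<open>force\<close>)
  qed measurable
  then show ?thesis using assms by (auto simp: bergman_space_def intro!: holomorphic_intros)
qed

lemma bergman_triangle:
  assumes "f \<in> bergman_space" "g \<in> bergman_space"
  shows "bergman_dist f g \<le> bergman_dist f (\<lambda>_. 0) + bergman_dist g (\<lambda>_. 0)"
proof -
  define I where "I h = (LINT z|area_measure. (cmod (h z))\<^sup>2)" for h :: "complex \<Rightarrow> complex"
  define a b where "a = sqrt (I f)" and "b = sqrt (I g)"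
  have I0: "I h \<ge> 0" for h by (simp add: I_def)
  have ab: "a \<ge> 0" "b \<ge> 0" "I f = a\<^sup>2" "I g = b\<^sup>2" by (auto simp: a_def b_def I0)
  have int: "integrable area_measure (\<lambda>z. (cmod (f z))\<^sup>2)" "integrable area_measure (\<lambda>z. (cmod (g z))\<^sup>2)"
    using assms by (auto simp: bergman_space_def)
  have le: "I (\<lambda>z. f z - g z) \<le> (1 + s) * a\<^sup>2 + (1 + 1 / s) * b\<^sup>2" if "s > 0" for s
  proof -
    have "I (\<lambda>z. f z - g z)
        \<le> (LINT z|area_measure. (1 + s) * (cmod (f z))\<^sup>2 + (1 + 1 / s) * (cmod (g z))\<^sup>2)"
      unfolding I_def using bergman_diff[OF assms] int that
      by (intro integral_mono cmod_sum_sq_le Bochner_Integration.integrable_add integrable_mult_right)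
        (auto simp: bergman_space_def)
    also have "\<dots> = (1 + s) * I f + (1 + 1 / s) * I g"
      unfolding I_def using int by (subst Bochner_Integration.integral_add) auto
    finally show ?thesis by (simp add: ab)
  qed
  have "I (\<lambda>z. f z - g z) \<le> (a + b)\<^sup>2 + e * (a + b)" if e: "e > 0" for e
  proof -
    have "a\<^sup>2 * ((b + e) / (a + e)) \<le> a * (b + e)"
      using ab e by (simp add: field_simps power2_eq_square)
    moreover have "b\<^sup>2 * ((a + e) / (b + e)) \<le> b * (a + e)"
      using ab e by (simp add: field_simps power2_eq_square)
    moreover have "I (\<lambda>z. f z - g z) \<le> (1 + (b + e) / (a + e)) * a\<^sup>2 + (1 + 1 / ((b + e) / (a + e))) * b\<^sup>2"
      using ab e by (intro le) auto
    ultimately show ?thesis by (simp add: algebra_simps power2_eq_square)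
  qed
  moreover have "((\<lambda>e. (a + b)\<^sup>2 + e * (a + b)) \<longlongrightarrow> (a + b)\<^sup>2 + 0 * (a + b)) (at_right 0)"
    by (intro tendsto_intros)
  ultimately have "I (\<lambda>z. f z - g z) \<le> (a + b)\<^sup>2 + 0 * (a + b)"
    by (intro tendsto_lowerbound[where F = "at_right 0"]) (auto simp: eventually_at_filter)
  then have "sqrt (I (\<lambda>z. f z - g z)) \<le> a + b" using ab by (intro real_le_lsqrt) auto
  then show ?thesis by (simp add: a_def b_def I_def bergman_dist_def)
qed

interpretation Bergman: Metric_space bergman_space bergman_dist
proof
  show "bergman_dist f g \<ge> 0" for f g by (simp add: bergman_dist_def)
  show "bergman_dist f g = bergman_dist g f" for f g
    by (simp add: bergman_dist_def norm_minus_commute)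
next
  fix f g assume fg: "f \<in> bergman_space" "g \<in> bergman_space"
  show "bergman_dist f g = 0 \<longleftrightarrow> f = g"
  proof
    assume *: "bergman_dist f g = 0"
    define h where "h z = f z - g z" for z
    have h: "h \<in> bergman_space" using bergman_diff[OF fg] by (simp add: h_def[abs_def])
    then have "AE z in area_measure. (cmod (h z))\<^sup>2 = 0"
      using * by (subst integral_nonneg_eq_0_iff_AE[symmetric])
        (auto simp: bergman_dist_def h_def bergman_space_def)
    then have AE: "AE z in lborel. z \<in> unit_disk \<longrightarrow> h z = 0"
      by (simp add: AE_area_measure)
    have op: "open {z \<in> unit_disk. h z \<in> - {0}}"
      using h by (intro continuous_open_preimage[unfolded vimage_def Int_def, simplified])
        (auto simp: bergman_space_def intro: holomorphic_on_imp_continuous_on)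
    moreover have "negligible {z \<in> unit_disk. h z \<in> - {0}}"
    proof -
      from AE have "AE z in lebesgue. z \<in> unit_disk \<longrightarrow> h z = 0" by (rule AE_completion)
      then have "AE z in lebesgue. z \<notin> {z \<in> unit_disk. h z \<in> - {0}}" by eventually_elim auto
      moreover have "{z \<in> unit_disk. h z \<in> - {0}} \<in> sets lebesgue"
        using borel_open[OF op] by (intro sets_completionI_sets) simp
      ultimately show ?thesis using AE_iff_null_sets unfolding negligible_iff_null_sets by blast
    qed
    ultimately have "{z \<in> unit_disk. h z \<in> - {0}} = {}" using open_not_negligible by blast
    then have "h z = 0" for z using h by (cases "z \<in> unit_disk") (auto simp: bergman_space_def)
    then show "f = g" by (auto simp: h_def)
  qed (simp add: bergman_dist_def)
next
  fix f g h assume fgh: "f \<in> bergman_space" "g \<in> bergman_space" "h \<in> bergman_space"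
  have "bergman_dist f h = bergman_dist (\<lambda>z. f z - g z) (\<lambda>z. h z - g z)"
    by (simp add: bergman_dist_def)
  also have "\<dots> \<le> bergman_dist (\<lambda>z. f z - g z) (\<lambda>_. 0) + bergman_dist (\<lambda>z. h z - g z) (\<lambda>_. 0)"
    using fgh by (intro bergman_triangle bergman_diff)
  also have "\<dots> = bergman_dist f g + bergman_dist g h"
    by (simp add: bergman_dist_def norm_minus_commute)
  finally show "bergman_dist f h \<le> bergman_dist f g + bergman_dist g h" .
qed

definition closed_subspace :: "(complex \<Rightarrow> complex) set \<Rightarrow> bool" where
  "closed_subspace M \<longleftrightarrow> (\<lambda>_. 0) \<in> M \<and>
     (\<forall>f\<in>M. \<forall>g\<in>M. (\<lambda>z. f z + g z) \<in> M) \<and>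
     (\<forall>c. \<forall>f\<in>M. (\<lambda>z. c * f z) \<in> M) \<and>
     closedin Bergman.mtopology M"

definition mult_op :: "(complex \<Rightarrow> complex) \<Rightarrow> (complex \<Rightarrow> complex) \<Rightarrow> (complex \<Rightarrow> complex)" where
  "mult_op \<phi> f = (\<lambda>z. \<phi> z * f z)"

text \<open>The Hilbert space adjoint of a bounded operator on the Bergman space.\<close>

definition bergman_adjoint ::
  "((complex \<Rightarrow> complex) \<Rightarrow> (complex \<Rightarrow> complex)) \<Rightarrow> (complex \<Rightarrow> complex) \<Rightarrow> (complex \<Rightarrow> complex)" where
  "bergman_adjoint T g =
     (THE h. h \<in> bergman_space \<and> (\<forall>f\<in>bergman_space. bergman_inner (T f) g = bergman_inner f h))"

definition reducing_subspace ::
  "((complex \<Rightarrow> complex) \<Rightarrow> (complex \<Rightarrow> complex)) \<Rightarrow> (complex \<Rightarrow> complex) set \<Rightarrow> bool" where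
  "reducing_subspace T M \<longleftrightarrow> closed_subspace M \<and> T ` M \<subseteq> M \<and> bergman_adjoint T ` M \<subseteq> M"

definition nontrivial_subspace :: "(complex \<Rightarrow> complex) set \<Rightarrow> bool" where
  "nontrivial_subspace M \<longleftrightarrow> M \<noteq> {\<lambda>_. 0} \<and> M \<noteq> bergman_space"

definition blaschke_sequence :: "(nat \<Rightarrow> complex) \<Rightarrow> bool" where
  "blaschke_sequence w \<longleftrightarrow> range w \<subseteq> unit_disk \<and> summable (\<lambda>k. 1 - cmod (w k))"

text \<open>Factors are normalized to be positive at the origin; a zero at the origin contributes
  the factor \<open>z\<close>.\<close>

definition blaschke_factor :: "complex \<Rightarrow> complex \<Rightarrow> complex" where
  "blaschke_factor a z =
     (if a = 0 then z else of_real (cmod a) / a * ((a - z) / (1 - cnj a * z)))"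

text \<open>Zeros are counted with their multiplicity in the sequence. Only the values on the disk
  are meaningful.\<close>

definition blaschke_product :: "(nat \<Rightarrow> complex) \<Rightarrow> complex \<Rightarrow> complex" where
  "blaschke_product w z = (\<Prod>k. blaschke_factor (w k) z)"

end

theory Submission
  imports Defs "HOL-Complex_Analysis.Complex_Analysis"
begin

text \<open>Let \<open>P\<close> be the orthogonal projection onto a reducing subspace of multiplication by \<open>B\<close>. Since \<open>P\<close>
  is self-adjoint and commutes with this operator, \<open>P f * cnj g - f * cnj (P g)\<close> is orthogonal to all
  polynomials in \<open>B\<close> and \<open>cnj B\<close>, so its integral over every set \<open>{|B - c| < e}\<close> vanishes. Letting
  \<open>e\<close> tend to 0, one sees that \<open>P\<close> acts on the fibres of \<open>B\<close> through a Hermitian matrix \<open>p(z,w)\<close> with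
  square summable columns. Its entries are holomorphic and antiholomorphic along local inverses of
  \<open>B\<close>, hence locally constant.

  If the zeros \<open>a 0, a 1, ...\<close> are sparse enough, then for every \<open>N\<close> there is a circle that
  separates \<open>a 0, ..., a N\<close> from the other zeros and on which \<open>|B|\<close> exceeds its values on a smaller disk
  containing \<open>a 0, ..., a N\<close>. The sum of \<open>p(z,w)\<close>, or of \<open>|p(z,w)|^2\<close>, over the points \<open>w\<close> of the
  fibre of \<open>z\<close> inside the circle is then the same for almost all \<open>z\<close> in the smaller disk, although
  the points \<open>w\<close> are permuted. Comparing these sums at the zeros, for \<open>N\<close> and \<open>N + 1\<close>, shows that
  all off-diagonal entries \<open>p(a k, a l)\<close> have the same modulus; by square summability they vanish.

  Consequently \<open>P h (a j) = \<alpha> * h (a j)\<close> for all \<open>h\<close>: first for multiples of a tail of the Blaschke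
  product, which differ from a multiple of \<open>B\<close> by a combination of the functions \<open>B / (x - a k)\<close>, and
  in the limit for all \<open>h\<close>. As \<open>P\<close> is idempotent, \<open>\<alpha>\<close> is 0 or 1, and after passing to
  \<open>1 - P\<close> one may assume that it is 0. Then all functions in the range of \<open>P\<close> vanish at the zeros of \<open>B\<close>,
  and dividing out zeros of \<open>B\<close> shows that they vanish at \<open>a 0\<close> to infinite order.\<close>

section \<open>Point evaluations on the Bergman space\<close>

text \<open>The fibres of \<open>B\<close> are infinite, so nothing may depend on the convergence of
  a sum over a whole fibre. Each entry is therefore isolated separately, by pairing with a
  difference quotient of \<open>B\<close> at one point: it vanishes on the rest of the fibre and is
  small on the far part of every level set. Only finite sums over parts of fibres occur, and the one
  bound on a whole column comes from the fact that \<open>P\<close> does not increase the mass over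
  any level set.

  The circle condition replaces control of the monodromy of \<open>B\<close>: along paths in the
  smaller disk no point of the fibre can cross the circle. How the points inside are permuted stays
  unknown, which is why only symmetric functions of a row are compared. Such circles exist because a
  finite Blaschke product has modulus 1 on the unit circle and less inside, and further zeros close
  enough to the unit circle change it little.

  The functions \<open>W N\<close> cancel the nonvanishing parts of the first \<open>N\<close>
  Blaschke factors, so that multiplication by \<open>C N * W N\<close> is a contraction that tends
  to the identity.\<close>

lemma distr_lborel_complex_vec2:
  "distr lborel borel (\<lambda>v::real^2. Complex (v $ 1) (v $ 2)) = lborel"
proof (rule sym, rule lborel_eqI)
  have [measurable]: "(\<lambda>v::real^2. Complex (v $ 1) (v $ 2)) \<in> borel_measurable borel"
    by (intro borel_measurable_continuous_onI) (auto simp: Complex_eq intro!: continuous_intros)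
  fix l u :: complex
  assume le: "\<And>b. b \<in> Basis \<Longrightarrow> l \<bullet> b \<le> u \<bullet> b"
  have le': "Re l \<le> Re u" "Im l \<le> Im u"
    using le[of 1] le[of \<i>] by (auto simp: Basis_complex_def)
  define l' u' :: "real^2" where "l' = vector [Re l, Im l]" and "u' = vector [Re u, Im u]"
  have "emeasure (distr lborel borel (\<lambda>v::real^2. Complex (v $ 1) (v $ 2))) (box l u)
      = emeasure lborel ((\<lambda>v::real^2. Complex (v $ 1) (v $ 2)) -` box l u)"
    by (subst emeasure_distr) auto
  also have "(\<lambda>v::real^2. Complex (v $ 1) (v $ 2)) -` box l u = box l' u'"
    by (auto simp: mem_box_cart in_box_complex_iff forall_2 l'_def u'_def)
  also have "emeasure lborel (box l' u') = (\<Prod>b\<in>Basis. (u' - l') \<bullet> b)"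
    by (rule emeasure_lborel_box)
      (use le' in \<open>auto simp: Basis_vec_def inner_axis l'_def u'_def UNIV_2\<close>)
  also have "(\<Prod>b\<in>Basis. (u' - l') \<bullet> b) = (\<Prod>b\<in>Basis. (u - l) \<bullet> b)"
  proof -
    have "(\<Prod>b\<in>Basis. (u' - l') \<bullet> b) = (\<Prod>i\<in>UNIV. (u' - l') $ i)"
      unfolding Basis_vec_def
      by (simp add: image_comp[symmetric] UNION_singleton_eq_range prod.reindex inj_on_def axis_eq_axis
        inner_axis)
    then show ?thesis by (simp add: Basis_complex_def UNIV_2 l'_def u'_def)
  qed
  finally show "emeasure (distr lborel borel (\<lambda>v::real^2. Complex (v $ 1) (v $ 2))) (box l u)
      = (\<Prod>b\<in>Basis. (u - l) \<bullet> b)" .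
qed simp

text \<open>Equality with \<open>lborel\<close> has to be tested on boxes only. The preimage of a
  box under \<open>R\<close> is its image under the inverse of \<open>R\<close>, which is again
  orthogonal and so preserves the volume.\<close>

lemma distr_lborel_orthogonal:
  fixes R :: "real^'n::{finite,wellorder} \<Rightarrow> real^'n::_"
  assumes "orthogonal_transformation R"
  shows "distr lborel borel R = lborel"
proof (rule sym, rule lborel_eqI)
  have lin: "linear R" using assms by (rule orthogonal_transformation_linear)
  have [measurable]: "R \<in> borel_measurable borel"
    by (intro borel_measurable_continuous_onI linear_continuous_on lin linear_conv_bounded_linear[THEN iffD1])
  have inv: "orthogonal_transformation (inv R)"
    using assms by (rule orthogonal_transformation_inv)
  fix l u :: "real^'n::_"
  assume le: "\<And>b. b \<in> Basis \<Longrightarrow> l \<bullet> b \<le> u \<bullet> b"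
  have "R -` box l u = inv R ` box l u"
    using orthogonal_transformation_bij[OF assms] by (simp add: bij_vimage_eq_inv_image)
  moreover have "R -` box l u \<in> sets borel" using measurable_sets_borel[of R borel "box l u"] by simp
  ultimately have m: "inv R ` box l u \<in> sets borel" by simp
  have L: "inv R ` box l u \<in> lmeasurable"
    by (intro measurable_orthogonal_image inv) auto
  have "emeasure (distr lborel borel R) (box l u) = emeasure lborel (R -` box l u)"
    by (subst emeasure_distr) auto
  also have "\<dots> = emeasure lebesgue (inv R ` box l u)"
    using m \<open>R -` box l u = _\<close> by (simp add: emeasure_completion)
  also have "\<dots> = ennreal (measure lebesgue (inv R ` box l u))"
    using L by (simp add: emeasure_eq_measure2)
  also have "measure lebesgue (inv R ` box l u) = measure lebesgue (box l u)"
    by (intro measure_orthogonal_image inv) auto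
  also have "ennreal \<dots> = emeasure lborel (box l u)"
    by (simp add: emeasure_lborel_box_eq measure_completion measure_def)
  also have "\<dots> = (\<Prod>b\<in>Basis. (u - l) \<bullet> b)"
    using le by (rule emeasure_lborel_box)
  finally show "emeasure (distr lborel borel R) (box l u) = (\<Prod>b\<in>Basis. (u - l) \<bullet> b)" .
qed simp

text \<open>In the coordinates \<open>\<phi>\<close> on \<open>real^2\<close>, which carry Lebesgue
  measure to Lebesgue measure, multiplication by a number of modulus 1 is an orthogonal map.\<close>

lemma distr_lborel_rotation:
  assumes "cmod w = 1"
  shows "distr lborel borel (\<lambda>x. w * x) = lborel"
proof -
  define \<phi> where "\<phi> = (\<lambda>v::real^2. Complex (v $ 1) (v $ 2))"
  define R where "R = (\<lambda>v::real^2. vector [Re (w * \<phi> v), Im (w * \<phi> v)] :: real^2)"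
  have R: "\<phi> (R v) = w * \<phi> v" for v by (simp add: \<phi>_def R_def complex_eq_iff)
  have [measurable]: "\<phi> \<in> borel_measurable borel"
    unfolding \<phi>_def
    by (intro borel_measurable_continuous_onI) (auto simp: Complex_eq intro!: continuous_intros)
  have "orthogonal_transformation R"
    unfolding orthogonal_transformation
  proof (intro conjI allI)
    show "linear R"
      by (rule linearI) (auto simp: R_def \<phi>_def vec_eq_iff forall_2 algebra_simps)
    show "norm (R v) = norm v" for v
    proof -
      have n: "norm v = cmod (\<phi> v)" for v :: "real^2"
        by (simp add: \<phi>_def norm_vec_def L2_set_def UNIV_2 cmod_def)
      show ?thesis using assms by (simp add: n R norm_mult)
    qed
  qed
  then have "distr lborel borel R = lborel" by (rule distr_lborel_orthogonal)
  moreover have [measurable]: "R \<in> borel_measurable borel"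
    using \<open>orthogonal_transformation R\<close>
    by (intro borel_measurable_continuous_onI linear_continuous_on linear_conv_bounded_linear[THEN iffD1]
        orthogonal_transformation_linear)
  moreover have "lborel = distr lborel borel \<phi>"
    unfolding \<phi>_def by (rule distr_lborel_complex_vec2[symmetric])
  ultimately have "distr (lborel :: complex measure) borel (\<lambda>x. w * x) = distr (distr lborel borel \<phi>) borel (\<lambda>x. w * x)"
    by metis
  also have "\<dots> = distr lborel borel (\<lambda>v. w * \<phi> v)" by (subst distr_distr) (auto simp: comp_def)
  also have "\<dots> = distr lborel borel (\<lambda>v. \<phi> (R v))" by (simp add: R)
  also have "\<dots> = distr (distr lborel borel R) borel \<phi>" by (subst distr_distr) (auto simp: comp_def)
  also have "\<dots> = lborel" using \<open>distr lborel borel R = lborel\<close> \<open>lborel = distr lborel borel \<phi>\<close> by simp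
  finally show ?thesis .
qed

section \<open>Mean values over roots of unity and the mean value inequality over disks\<close>

text \<open>Averaging over the \<open>n\<close>-th roots of unity removes every Taylor coefficient
  of index \<open>0 < j < n\<close>. What survives besides \<open>f 0\<close> is bounded by the tail
  of an absolutely convergent series.\<close>

lemma tendsto_roots_of_unity_average:
  fixes f :: "complex \<Rightarrow> complex"
  assumes f: "f holomorphic_on ball 0 R" and x: "cmod x < R"
  shows "(\<lambda>n. (\<Sum>k<n. f (cis (2 * pi / n) ^ k * x)) / n) \<longlonglongrightarrow> f 0"
proof -
  define c where "c j = (deriv ^^ j) f 0 / fact j" for j
  have sums: "(\<lambda>j. c j * y ^ j) sums f y" if "cmod y < R" for y
    using holomorphic_power_series[OF f, of y] that by (simp add: c_def)
  have abs: "summable (\<lambda>j. norm (c j * x ^ j))"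
  proof -
    define s where "s = (cmod x + R) / 2"
    have s: "cmod x < s" "s < R" using x by (auto simp: s_def)
    then have "summable (\<lambda>j. c j * of_real s ^ j)"
      using sums[of "of_real s"] norm_ge_zero[of x] by (auto simp: sums_iff simp del: norm_ge_zero)
    then show ?thesis using s norm_ge_zero[of x] by (intro powser_insidea[of c "of_real s"]) (auto simp del: norm_ge_zero)
  qed
  have f0: "f 0 = c 0" by (simp add: c_def)
  define a where "a j = norm (c j * x ^ j)" for j
  have "norm ((\<Sum>k<n. f (cis (2 * pi / n) ^ k * x)) / n - f 0) \<le> (\<Sum>j. a (j + n))" if n: "n > 0" for n
  proof -
    define w where "w = cis (2 * pi / n)"
    have w: "cmod (w ^ k) = 1" for k by (simp add: w_def norm_power)
    have wn: "w ^ n = 1" using n by (simp add: w_def Complex.DeMoivre)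
    have w1: "w ^ j \<noteq> 1" if "0 < j" "j < n" for j
    proof
      assume "w ^ j = 1"
      then have "cis (2 * pi * j / n) = 1" by (simp add: w_def Complex.DeMoivre mult_ac)
      then have "cos (2 * pi * j / n) = 1" by (simp add: complex_eq_iff)
      then obtain m :: int where m: "2 * pi * j / n = m * 2 * pi" by (auto simp: cos_one_2pi_int)
      then have "real j = m * n" using n by (simp add: field_simps)
      then have "int j = m * int n" by (metis of_int_eq_iff of_int_mult of_int_of_nat_eq)
      then have "int n dvd int j" by simp
      then have "n dvd j" using int_dvd_int_iff by blast
      then show False using that by (auto dest: dvd_imp_le)
    qed
    \<comment> \<open>The average of the \<open>j\<close>-th powers of the roots. From index
      \<open>n\<close> on the bound 1 is enough, since those terms are compared with the
      tail.\<close>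
    define g where "g j = (\<Sum>k<n. (w ^ k) ^ j) / n" for j
    have g: "g j = (if j = 0 then 1 else 0)" if "j < n" for j
    proof (cases "j = 0")
      case False
      have "(\<Sum>k<n. (w ^ k) ^ j) = (\<Sum>k<n. (w ^ j) ^ k)"
        by (simp add: power_mult[symmetric] mult.commute)
      also have "\<dots> = (1 - (w ^ j) ^ n) / (1 - w ^ j)"
        using w1[of j] False that by (subst sum_gp_strict) auto
      also have "(w ^ j) ^ n = (w ^ n) ^ j"
        by (simp add: power_mult[symmetric] mult.commute)
      finally show ?thesis using False by (simp add: g_def wn)
    qed (use n in \<open>simp add: g_def\<close>)
    have gn: "norm (g j) \<le> 1" for j
    proof -
      have "norm (\<Sum>k<n. (w ^ k) ^ j) \<le> (\<Sum>k<n. 1)"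
        by (intro sum_norm_le) (simp add: norm_power[of "w ^ _"] w)
      then show ?thesis using n by (simp add: g_def norm_divide)
    qed
    have s1: "(\<lambda>j. g j * (c j * x ^ j)) sums ((\<Sum>k<n. f (w ^ k * x)) / n)"
    proof -
      have "(\<lambda>j. (\<Sum>k<n. c j * (w ^ k * x) ^ j) / n) sums ((\<Sum>k<n. f (w ^ k * x)) / n)"
        by (intro sums_divide sums_sum sums) (use x w in \<open>simp add: norm_mult\<close>)
      also have "(\<lambda>j. (\<Sum>k<n. c j * (w ^ k * x) ^ j) / n) = (\<lambda>j. g j * (c j * x ^ j))"
        by (rule ext) (simp add: g_def sum_distrib_right sum_distrib_left power_mult_distrib mult_ac sum_divide_distrib)
      finally show ?thesis .
    qed
    have "(\<lambda>j. g (j + n) * (c (j + n) * x ^ (j + n))) sums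
       ((\<Sum>k<n. f (w ^ k * x)) / n - (\<Sum>j<n. g j * (c j * x ^ j)))"
      by (intro sums_split_initial_segment s1)
    moreover have "(\<Sum>j<n. g j * (c j * x ^ j)) = f 0"
      using n by (simp add: g f0 if_distrib[of "\<lambda>a. a * _"] sum.delta cong: if_cong)
    ultimately have "(\<Sum>k<n. f (w ^ k * x)) / n - f 0 = (\<Sum>j. g (j + n) * (c (j + n) * x ^ (j + n)))"
      by (simp add: sums_iff)
    also have "norm \<dots> \<le> (\<Sum>j. a (j + n))"
    proof (rule norm_suminf_le)
      show "norm (g (j + n) * (c (j + n) * x ^ (j + n))) \<le> a (j + n)" for j
        using mult_right_mono[OF gn[of "j + n"], of "a (j + n)"] by (simp add: norm_mult a_def)
      show "summable (\<lambda>j. a (j + n))"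
        using summable_ignore_initial_segment[of a n] abs by (simp add: a_def[abs_def])
    qed
    finally show ?thesis by (simp add: w_def)
  qed
  moreover have "(\<lambda>n. \<Sum>j. a (j + n)) \<longlonglongrightarrow> 0"
    using abs suminf_exist_split2[of a] by (simp add: a_def[abs_def])
  ultimately have "(\<lambda>n. (\<Sum>k<n. f (cis (2 * pi / n) ^ k * x)) / n - f 0) \<longlonglongrightarrow> 0"
    by (rule Lim_null_comparison[OF eventually_mono[OF eventually_gt_at_top[of 0]]])
  then show ?thesis by (simp add: LIM_zero_iff)
qed

lemma bergman_holomorphic: "f \<in> bergman_space \<Longrightarrow> f holomorphic_on unit_disk"
  by (simp add: bergman_space_def)

text \<open>The averages \<open>A n\<close> tend to \<open>f 0\<close> pointwise, and by convexity
  of the square and rotation invariance their square integrals over the disk do not exceed that of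
  \<open>f\<close>. Fatou's lemma then gives the inequality without polar coordinates.\<close>

lemma nn_integral_sq_ge_center:
  fixes f :: "complex \<Rightarrow> complex"
  assumes f: "f holomorphic_on ball 0 \<rho>" and [measurable]: "f \<in> borel_measurable borel"
  shows "ennreal ((cmod (f 0))\<^sup>2) * emeasure lborel (ball (0::complex) \<rho>)
    \<le> (\<integral>\<^sup>+x. ennreal ((cmod (f x))\<^sup>2) * indicator (ball 0 \<rho>) x \<partial>lborel)" (is "_ \<le> ?I")
proof -
  define A where "A n x = (\<Sum>k<n. f (cis (2 * pi / n) ^ k * x)) / n" for n x
  have [measurable]: "ball (0::complex) \<rho> \<in> sets borel" by simp
  have [measurable]: "A n \<in> borel_measurable borel" for n
    unfolding A_def by measurable
  have le: "(\<integral>\<^sup>+x. ennreal ((cmod (A n x))\<^sup>2) * indicator (ball 0 \<rho>) x \<partial>lborel) \<le> ?I" if n: "n > 0" for n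
  proof -
    define w where "w = cis (2 * pi / n)"
    have w: "cmod (w ^ k) = 1" for k by (simp add: w_def norm_power)
    have rot: "(\<integral>\<^sup>+x. ennreal ((cmod (f (w ^ k * x)))\<^sup>2) * indicator (ball 0 \<rho>) x \<partial>lborel) = ?I" for k
    proof -
      have "?I = (\<integral>\<^sup>+x. ennreal ((cmod (f x))\<^sup>2) * indicator (ball 0 \<rho>) x \<partial>distr lborel borel (\<lambda>x. w ^ k * x))"
        by (subst distr_lborel_rotation[OF w]) simp
      also have "\<dots> = (\<integral>\<^sup>+x. ennreal ((cmod (f (w ^ k * x)))\<^sup>2) * indicator (ball 0 \<rho>) (w ^ k * x) \<partial>lborel)"
        by (rule nn_integral_distr) measurable
      also have "\<dots> = (\<integral>\<^sup>+x. ennreal ((cmod (f (w ^ k * x)))\<^sup>2) * indicator (ball 0 \<rho>) x \<partial>lborel)"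
        by (intro nn_integral_cong) (simp add: indicator_def norm_mult w)
      finally show ?thesis by simp
    qed
    have pt: "(cmod (A n x))\<^sup>2 \<le> (\<Sum>k<n. (cmod (f (w ^ k * x)))\<^sup>2 / n)" for x
    proof -
      have "cmod (A n x) \<le> (\<Sum>k<n. cmod (f (w ^ k * x))) / n"
        unfolding A_def norm_divide w_def by (simp add: divide_right_mono norm_sum)
      then have "(cmod (A n x))\<^sup>2 \<le> ((\<Sum>k<n. cmod (f (w ^ k * x))) / n)\<^sup>2"
        by (intro power_mono) auto
      also have "(\<Sum>k<n. cmod (f (w ^ k * x)))\<^sup>2 \<le> (\<Sum>k<n. (cmod (f (w ^ k * x)))\<^sup>2) * n"
        using Cauchy_Schwarz_ineq_sum[of "\<lambda>k. cmod (f (w ^ k * x))" "\<lambda>_. 1" "{..<n}"] by simp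
      then have "((\<Sum>k<n. cmod (f (w ^ k * x))) / n)\<^sup>2 \<le> (\<Sum>k<n. (cmod (f (w ^ k * x)))\<^sup>2) / n"
        using n by (simp add: power_divide divide_simps power2_eq_square mult_ac)
      finally show ?thesis by (simp add: sum_divide_distrib)
    qed
    have "(\<integral>\<^sup>+x. ennreal ((cmod (A n x))\<^sup>2) * indicator (ball 0 \<rho>) x \<partial>lborel)
        \<le> (\<integral>\<^sup>+x. (\<Sum>k<n. ennreal (1 / n) * (ennreal ((cmod (f (w ^ k * x)))\<^sup>2) * indicator (ball 0 \<rho>) x)) \<partial>lborel)"
    proof (intro nn_integral_mono)
      fix x
      have "ennreal ((cmod (A n x))\<^sup>2) \<le> ennreal (\<Sum>k<n. (cmod (f (w ^ k * x)))\<^sup>2 / n)"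
        using pt by (intro ennreal_leI)
      also have "\<dots> = (\<Sum>k<n. ennreal (1 / n) * ennreal ((cmod (f (w ^ k * x)))\<^sup>2))"
        by (subst sum_ennreal[symmetric]) (auto simp: ennreal_mult[symmetric])
      finally show "ennreal ((cmod (A n x))\<^sup>2) * indicator (ball 0 \<rho>) x
          \<le> (\<Sum>k<n. ennreal (1 / n) * (ennreal ((cmod (f (w ^ k * x)))\<^sup>2) * indicator (ball 0 \<rho>) x))"
        by (simp add: indicator_def)
    qed
    also have "\<dots> = (\<Sum>k<n. ennreal (1 / n) * ?I)"
    proof (subst nn_integral_sum)
      have [measurable]: "(\<lambda>x. ennreal ((cmod (f (w ^ k * x)))\<^sup>2) * indicator (ball 0 \<rho>) x) \<in> borel_measurable borel" for k
        by measurable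
      show "(\<lambda>x. ennreal (1 / n) * (ennreal ((cmod (f (w ^ k * x)))\<^sup>2) * indicator (ball 0 \<rho>) x)) \<in> borel_measurable lborel" for k
        by measurable
      show "(\<Sum>k<n. \<integral>\<^sup>+x. ennreal (1 / n) * (ennreal ((cmod (f (w ^ k * x)))\<^sup>2) * indicator (ball 0 \<rho>) x) \<partial>lborel)
          = (\<Sum>k<n. ennreal (1 / n) * ?I)"
        by (subst nn_integral_cmult) (auto simp: rot)
    qed
    also have "\<dots> = ?I"
      using n by (simp add: mult.assoc[symmetric] ennreal_of_nat_eq_real_of_nat ennreal_mult[symmetric])
    finally show ?thesis .
  qed
  have "(\<integral>\<^sup>+x. ennreal ((cmod (f 0))\<^sup>2) * indicator (ball (0::complex) \<rho>) x \<partial>lborel)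
      = (\<integral>\<^sup>+x. liminf (\<lambda>n. ennreal ((cmod (A n x))\<^sup>2) * indicator (ball 0 \<rho>) x) \<partial>lborel)"
  proof (intro nn_integral_cong)
    fix x
    show "ennreal ((cmod (f 0))\<^sup>2) * indicator (ball 0 \<rho>) x
        = liminf (\<lambda>n. ennreal ((cmod (A n x))\<^sup>2) * indicator (ball 0 \<rho>) x)"
    proof (cases "x \<in> ball 0 \<rho>")
      case True
      then have "(\<lambda>n. A n x) \<longlonglongrightarrow> f 0"
        unfolding A_def by (intro tendsto_roots_of_unity_average[OF f]) auto
      then have "(\<lambda>n. ennreal ((cmod (A n x))\<^sup>2)) \<longlonglongrightarrow> ennreal ((cmod (f 0))\<^sup>2)"
        by (intro tendsto_intros)
      from lim_imp_Liminf[OF trivial_limit_sequentially this] show ?thesis using True by simp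
    qed (simp add: Liminf_const)
  qed
  also have "\<dots> \<le> liminf (\<lambda>n. \<integral>\<^sup>+x. ennreal ((cmod (A n x))\<^sup>2) * indicator (ball 0 \<rho>) x \<partial>lborel)"
    by (intro nn_integral_liminf) measurable
  also have "\<dots> \<le> ?I"
    by (intro Liminf_le eventually_mono[OF eventually_gt_at_top[of 0]] le) auto
  finally show ?thesis by (simp add: nn_integral_cmult)
qed

section \<open>Normalized area measure and the bound on point evaluations\<close>

lemma sets_area_measure [simp, measurable_cong]: "sets area_measure = sets borel"
  by (simp add: area_measure_def)

lemma space_area_measure [simp]: "space area_measure = UNIV"
  by (simp add: area_measure_def)

interpretation area: finite_measure area_measure
proof
  show "emeasure area_measure (space area_measure) \<noteq> \<infinity>"
    using emeasure_unit_disk unfolding area_measure_def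
    by (subst emeasure_uniform_measure) (auto simp: ennreal_divide_eq_top_iff)
qed

lemma measure_ball_area:
  assumes "ball z \<rho> \<subseteq> unit_disk" "\<rho> \<ge> 0"
  shows "measure area_measure (ball z \<rho>) = \<rho>\<^sup>2"
proof -
  have "measure area_measure (ball z \<rho>) = measure lborel (unit_disk \<inter> ball z \<rho>) / measure lborel unit_disk"
    unfolding area_measure_def by (rule measure_uniform_measure) (use emeasure_unit_disk in auto)
  also have "unit_disk \<inter> ball z \<rho> = ball z \<rho>" using assms by auto
  also have "measure lborel (ball z \<rho>) = pi * \<rho>\<^sup>2"
    using content_ball[of \<rho> z] assms by (simp add: unit_ball_vol_2)
  also have "measure lborel unit_disk = pi"
    using content_ball[of 1 "0::complex"] by (simp add: unit_ball_vol_2)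
  finally show ?thesis by simp
qed

text \<open>Translation moves \<open>z\<close> to the origin, where the mean value inequality
  applies. The factors \<open>pi\<close> from the areas of the two disks cancel because the measure
  is normalized.\<close>

lemma bergman_evaluation_bound:
  assumes f: "f \<in> bergman_space" and z: "ball z \<rho> \<subseteq> unit_disk" and "\<rho> > 0"
  shows "(cmod (f z))\<^sup>2 \<le> (LINT x|area_measure. (cmod (f x))\<^sup>2) / \<rho>\<^sup>2"
proof -
  have fm [measurable]: "f \<in> borel_measurable borel"
    using bergman_measurable[OF f] by simp
  have [measurable]: "unit_disk \<in> sets borel" "ball z \<rho> \<in> sets borel" by auto
  define I where "I = (LINT x|area_measure. (cmod (f x))\<^sup>2)"
  have I0: "I \<ge> 0" by (simp add: I_def)
  have D: "emeasure lborel unit_disk = ennreal pi"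
    using emeasure_ball[of 1 "0::complex"] by (simp add: unit_ball_vol_2)
  have zb: "emeasure lborel (ball z \<rho>) = ennreal (pi * \<rho>\<^sup>2)" for z :: complex
    using emeasure_ball[of \<rho> z] \<open>\<rho> > 0\<close> by (simp add: unit_ball_vol_2 ennreal_mult mult.commute)
  have "ennreal I = (\<integral>\<^sup>+x. ennreal ((cmod (f x))\<^sup>2) \<partial>area_measure)"
    unfolding I_def using f by (intro nn_integral_eq_integral[symmetric]) (auto simp: bergman_space_def)
  also have "\<dots> = (\<integral>\<^sup>+x. ennreal ((cmod (f x))\<^sup>2) * indicator unit_disk x \<partial>lborel) / ennreal pi"
    unfolding area_measure_def by (subst nn_integral_uniform_measure) (auto simp: D)
  finally have "ennreal I * ennreal pi = (\<integral>\<^sup>+x. ennreal ((cmod (f x))\<^sup>2) * indicator unit_disk x \<partial>lborel)"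
    by (simp add: mult.commute[of "_ / _"] ennreal_times_divide mult.commute[of "ennreal pi"] mult_divide_eq_ennreal)
  define g where "g x = f (z + x)" for x
  have [measurable]: "g \<in> borel_measurable borel" unfolding g_def by measurable
  have "g holomorphic_on ball 0 \<rho>"
  proof -
    have "(f \<circ> (\<lambda>x. z + x)) holomorphic_on ball 0 \<rho>"
      by (rule holomorphic_on_compose_gen[OF _ bergman_holomorphic[OF f]])
        (use z in \<open>auto intro!: holomorphic_intros simp: dist_norm subset_iff norm_minus_commute\<close>)
    then show ?thesis by (simp add: g_def[abs_def] comp_def)
  qed
  then have "ennreal ((cmod (g 0))\<^sup>2) * emeasure lborel (ball (0::complex) \<rho>)
      \<le> (\<integral>\<^sup>+x. ennreal ((cmod (g x))\<^sup>2) * indicator (ball 0 \<rho>) x \<partial>lborel)"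
    by (rule nn_integral_sq_ge_center) measurable
  also have "\<dots> = (\<integral>\<^sup>+x. ennreal ((cmod (f x))\<^sup>2) * indicator (ball z \<rho>) x \<partial>lborel)"
  proof -
    have "(\<integral>\<^sup>+x. ennreal ((cmod (f x))\<^sup>2) * indicator (ball z \<rho>) x \<partial>lborel)
       = (\<integral>\<^sup>+x. ennreal ((cmod (f x))\<^sup>2) * indicator (ball z \<rho>) x \<partial>distr lborel borel (\<lambda>x. z + x))"
      by (subst lborel_distr_plus) simp
    also have "\<dots> = (\<integral>\<^sup>+x. ennreal ((cmod (g x))\<^sup>2) * indicator (ball z \<rho>) (z + x) \<partial>lborel)"
      unfolding g_def by (rule nn_integral_distr) measurable
    finally show ?thesis by (simp add: indicator_def dist_norm)
  qed
  also have "\<dots> \<le> (\<integral>\<^sup>+x. ennreal ((cmod (f x))\<^sup>2) * indicator unit_disk x \<partial>lborel)"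
    using z by (intro nn_integral_mono mult_left_mono) (auto simp: indicator_def)
  also have "\<dots> = ennreal (I * pi)"
    using \<open>ennreal I * ennreal pi = _\<close> I0 by (simp add: ennreal_mult)
  finally have "ennreal ((cmod (f z))\<^sup>2 * (pi * \<rho>\<^sup>2)) \<le> ennreal (I * pi)"
    by (simp add: zb g_def ennreal_mult)
  then have "(cmod (f z))\<^sup>2 * (pi * \<rho>\<^sup>2) \<le> I * pi"
    using I0 by (simp add: ennreal_le_iff)
  then show ?thesis using \<open>\<rho> > 0\<close> by (simp add: I_def[symmetric] field_simps)
qed

section \<open>Square integrable functions\<close>

text \<open>Holomorphy is left out on purpose: the adjoint of multiplication by \<open>B\<close> is
  obtained by projecting \<open>cnj (B x) * g x\<close>, which is not holomorphic in
  general.\<close>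

definition sq_integrable :: "(complex \<Rightarrow> complex) \<Rightarrow> bool" where
  "sq_integrable f \<longleftrightarrow> f \<in> borel_measurable area_measure \<and> integrable area_measure (\<lambda>x. (cmod (f x))\<^sup>2)"

definition norm_sq :: "(complex \<Rightarrow> complex) \<Rightarrow> real" where
  "norm_sq f = (LINT x|area_measure. (cmod (f x))\<^sup>2)"

lemma norm_sq_nonneg [simp]: "norm_sq f \<ge> 0"
  by (simp add: norm_sq_def)

lemma bergman_sq_integrable: "f \<in> bergman_space \<Longrightarrow> sq_integrable f"
  by (simp add: sq_integrable_def bergman_measurable) (simp add: bergman_space_def)

lemma bergman_spaceI:
  assumes "f holomorphic_on unit_disk" "\<And>z. z \<notin> unit_disk \<Longrightarrow> f z = 0" "sq_integrable f"
  shows "f \<in> bergman_space"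
  using assms by (simp add: bergman_space_def sq_integrable_def)

lemma bergman_outside: "f \<in> bergman_space \<Longrightarrow> z \<notin> unit_disk \<Longrightarrow> f z = 0"
  by (simp add: bergman_space_def)

lemma AE_unit_disk: "AE x in area_measure. x \<in> unit_disk"
  by (simp add: AE_area_measure)

lemma sq_integrable_bound:
  assumes "f \<in> borel_measurable borel" "sq_integrable g" "C \<ge> 0"
    and "\<And>x. x \<in> unit_disk \<Longrightarrow> cmod (f x) \<le> C * cmod (g x)"
  shows "sq_integrable f"
  unfolding sq_integrable_def
proof
  show "f \<in> borel_measurable area_measure" using assms by simp
  have [measurable]: "f \<in> borel_measurable borel" by fact
  show "integrable area_measure (\<lambda>x. (cmod (f x))\<^sup>2)"
  proof (rule Bochner_Integration.integrable_bound)
    show "integrable area_measure (\<lambda>x. C\<^sup>2 * (cmod (g x))\<^sup>2)"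
      using assms by (auto simp: sq_integrable_def)
    show "AE x in area_measure. norm ((cmod (f x))\<^sup>2) \<le> norm (C\<^sup>2 * (cmod (g x))\<^sup>2)"
      using AE_unit_disk
    proof eventually_elim
      case (elim x)
      have "(cmod (f x))\<^sup>2 \<le> (C * cmod (g x))\<^sup>2"
        using assms(4)[OF elim] by (intro power_mono) auto
      then show ?case by (simp add: power_mult_distrib)
    qed
  qed measurable
qed

lemma sq_integrable_diff:
  assumes "sq_integrable f" "sq_integrable g"
  shows "sq_integrable (\<lambda>x. f x - g x)"
  unfolding sq_integrable_def
proof
  have [measurable]: "f \<in> borel_measurable area_measure" "g \<in> borel_measurable area_measure"
    using assms by (auto simp: sq_integrable_def)
  show "(\<lambda>x. f x - g x) \<in> borel_measurable area_measure" by measurable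
  show "integrable area_measure (\<lambda>x. (cmod (f x - g x))\<^sup>2)"
  proof (rule Bochner_Integration.integrable_bound)
    show "integrable area_measure (\<lambda>x. (1 + 1) * (cmod (f x))\<^sup>2 + (1 + 1 / 1) * (cmod (g x))\<^sup>2)"
      using assms by (intro Bochner_Integration.integrable_add integrable_mult_right)
        (auto simp: sq_integrable_def)
    show "AE x in area_measure. norm ((cmod (f x - g x))\<^sup>2)
        \<le> norm ((1 + 1) * (cmod (f x))\<^sup>2 + (1 + 1 / 1) * (cmod (g x))\<^sup>2)"
      by (rule AE_I2) (use cmod_sum_sq_le[of 1] in \<open>force\<close>)
  qed measurable
qed

lemma sq_integrable_cmult:
  assumes "sq_integrable f"
  shows "sq_integrable (\<lambda>x. c * f x)"
  using assms by (auto simp: sq_integrable_def norm_mult power_mult_distrib)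

lemma sq_integrable_add:
  assumes "sq_integrable f" "sq_integrable g"
  shows "sq_integrable (\<lambda>x. f x + g x)"
  using sq_integrable_diff[OF assms(1) sq_integrable_cmult[OF assms(2), of "-1"]] by simp

lemma sq_integrable_const: "sq_integrable (\<lambda>x. c)"
  by (simp add: sq_integrable_def)

lemma bergman_add:
  assumes "f \<in> bergman_space" "g \<in> bergman_space"
  shows "(\<lambda>x. f x + g x) \<in> bergman_space"
proof (rule bergman_spaceI)
  show "(\<lambda>x. f x + g x) holomorphic_on unit_disk"
    using assms by (intro holomorphic_on_add bergman_holomorphic)
  show "sq_integrable (\<lambda>x. f x + g x)"
    using assms by (intro sq_integrable_add bergman_sq_integrable)
qed (use assms in \<open>simp add: bergman_outside\<close>)

lemma bergman_cmult:
  assumes "f \<in> bergman_space"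
  shows "(\<lambda>x. c * f x) \<in> bergman_space"
proof (rule bergman_spaceI)
  show "(\<lambda>x. c * f x) holomorphic_on unit_disk"
    using assms by (intro holomorphic_on_mult holomorphic_on_const bergman_holomorphic)
  show "sq_integrable (\<lambda>x. c * f x)"
    using assms by (intro sq_integrable_cmult bergman_sq_integrable)
qed (use assms in \<open>simp add: bergman_outside\<close>)

lemma bergman_zero: "(\<lambda>_. 0) \<in> bergman_space"
  by (intro bergman_spaceI sq_integrable_const) auto

lemma bergman_sum:
  assumes "\<And>i. i \<in> I \<Longrightarrow> f i \<in> bergman_space"
  shows "(\<lambda>x. \<Sum>i\<in>I. f i x) \<in> bergman_space"
  using assms by (induction I rule: infinite_finite_induct) (auto intro: bergman_zero bergman_add)

lemma borel_measurable_cnj [measurable (raw)]: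
  "f \<in> borel_measurable M \<Longrightarrow> (\<lambda>x. cnj (f x)) \<in> borel_measurable M"
  using borel_measurable_continuous_on[OF continuous_on_cnj[OF continuous_on_id]] by blast

lemma integrable_mult_cnj:
  assumes "sq_integrable f" "sq_integrable g"
  shows "integrable area_measure (\<lambda>x. f x * cnj (g x))"
proof (rule Bochner_Integration.integrable_bound)
  have [measurable]: "f \<in> borel_measurable area_measure" "g \<in> borel_measurable area_measure"
    using assms by (auto simp: sq_integrable_def)
  show "integrable area_measure (\<lambda>x. (cmod (f x))\<^sup>2 + (cmod (g x))\<^sup>2)"
    using assms by (auto simp: sq_integrable_def)
  have "cmod (f x) * cmod (g x) \<le> (cmod (f x))\<^sup>2 + (cmod (g x))\<^sup>2" for x
    using sum_squares_bound[of "cmod (f x)" "cmod (g x)"] mult_nonneg_nonneg[OF norm_ge_zero norm_ge_zero, of "f x" "g x"]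
    by linarith
  then show "AE x in area_measure. norm (f x * cnj (g x)) \<le> norm ((cmod (f x))\<^sup>2 + (cmod (g x))\<^sup>2)"
    by (intro AE_I2) (simp add: norm_mult)
  show "(\<lambda>x. f x * cnj (g x)) \<in> borel_measurable area_measure"
    by measurable
qed

lemma inner_diff_left:
  "sq_integrable f \<Longrightarrow> sq_integrable g \<Longrightarrow> sq_integrable h \<Longrightarrow>
    bergman_inner (\<lambda>x. f x - g x) h = bergman_inner f h - bergman_inner g h"
  unfolding bergman_inner_def
  by (subst Bochner_Integration.integral_diff[symmetric]) (auto intro!: integrable_mult_cnj simp: algebra_simps)

lemma inner_diff_right:
  "sq_integrable f \<Longrightarrow> sq_integrable g \<Longrightarrow> sq_integrable h \<Longrightarrow>
    bergman_inner h (\<lambda>x. f x - g x) = bergman_inner h f - bergman_inner h g"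
  unfolding bergman_inner_def
  by (subst Bochner_Integration.integral_diff[symmetric]) (auto intro!: integrable_mult_cnj simp: algebra_simps)

lemma inner_cmult_left: "bergman_inner (\<lambda>x. c * f x) h = c * bergman_inner f h"
  unfolding bergman_inner_def by (simp add: mult.assoc)

lemma inner_cmult_right: "bergman_inner f (\<lambda>x. c * h x) = cnj c * bergman_inner f h"
  unfolding bergman_inner_def by (simp add: mult.left_commute)

lemma inner_commute: "bergman_inner f g = cnj (bergman_inner g f)"
proof -
  have "cnj (bergman_inner g f) = (LINT z|area_measure. cnj (g z * cnj (f z)))"
    unfolding bergman_inner_def by (rule Bochner_Integration.integral_cnj[symmetric])
  then show ?thesis by (simp add: bergman_inner_def mult.commute)
qed

lemma inner_self: "bergman_inner f f = of_real (norm_sq f)"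
  unfolding bergman_inner_def norm_sq_def complex_norm_square[symmetric]
  by (rule integral_complex_of_real)

lemma norm_sq_cmult: "norm_sq (\<lambda>x. c * f x) = (cmod c)\<^sup>2 * norm_sq f"
  by (simp add: norm_sq_def norm_mult power_mult_distrib)

lemma norm_sq_diff:
  assumes "sq_integrable f" "sq_integrable g"
  shows "norm_sq (\<lambda>x. f x - g x) = norm_sq f + norm_sq g - 2 * Re (bergman_inner f g)"
proof -
  have "of_real (norm_sq (\<lambda>x. f x - g x)) = of_real (norm_sq f) + of_real (norm_sq g) - bergman_inner f g - cnj (bergman_inner f g)"
    using assms by (simp add: inner_self[symmetric] inner_diff_left inner_diff_right sq_integrable_diff inner_commute[of g f])
  from arg_cong[OF this, of Re] show ?thesis by simp
qed

lemma bergman_dist_eq: "bergman_dist f g = sqrt (norm_sq (\<lambda>x. f x - g x))"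
  by (simp add: bergman_dist_def norm_sq_def)

lemma norm_sq_eq_0:
  assumes "f \<in> bergman_space" "norm_sq f = 0"
  shows "f = (\<lambda>_. 0)"
  using Bergman.zero[OF assms(1) bergman_zero] assms(2) by (simp add: bergman_dist_eq)

lemma bergman_eval_le:
  assumes f: "f \<in> bergman_space" and z: "ball z \<rho> \<subseteq> unit_disk" and "\<rho> > 0"
  shows "cmod (f z) \<le> sqrt (norm_sq f) / \<rho>"
proof -
  have "(cmod (f z))\<^sup>2 \<le> (sqrt (norm_sq f) / \<rho>)\<^sup>2"
    using bergman_evaluation_bound[OF assms] by (simp add: norm_sq_def power_divide)
  then show ?thesis by (rule power2_le_imp_le) (use \<open>\<rho> > 0\<close> in auto)
qed

lemma ball_in_unit_disk:
  assumes "cmod z + \<rho> \<le> 1"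
  shows "ball z \<rho> \<subseteq> unit_disk"
proof
  fix x assume "x \<in> ball z \<rho>"
  then have "cmod (x - z) < \<rho>" by (simp add: dist_norm norm_minus_commute)
  then show "x \<in> unit_disk" using norm_triangle_sub[of x z] assms by simp
qed

text \<open>Every point of \<open>cball 0 r\<close> is the centre of a disk of radius
  \<open>1 - r\<close> inside the unit disk, so the evaluation bound is uniform there.\<close>

lemma bergman_tendsto_eval:
  assumes "\<And>n. f n \<in> bergman_space" "g \<in> bergman_space"
    and lim: "(\<lambda>n. norm_sq (\<lambda>x. f n x - g x)) \<longlonglongrightarrow> 0" and K: "K \<subseteq> cball 0 r" "r < 1"
  shows "uniform_limit K f g sequentially"
proof (rule uniform_limitI)
  fix e :: real assume e: "e > 0"
  have "(\<lambda>n. sqrt (norm_sq (\<lambda>x. f n x - g x)) / (1 - r)) \<longlonglongrightarrow> sqrt 0 / (1 - r)"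
    using K by (intro tendsto_intros lim) auto
  then have "eventually (\<lambda>n. sqrt (norm_sq (\<lambda>x. f n x - g x)) / (1 - r) < e) sequentially"
    using e by (simp add: order_tendsto_iff)
  then show "\<forall>\<^sub>F n in sequentially. \<forall>x\<in>K. dist (f n x) (g x) < e"
  proof eventually_elim
    case (elim n)
    show ?case
    proof
      fix x assume "x \<in> K"
      then have "cmod x + (1 - r) \<le> 1" using K by auto
      then have "cmod (f n x - g x) \<le> sqrt (norm_sq (\<lambda>x. f n x - g x)) / (1 - r)"
        using bergman_eval_le[OF bergman_diff[OF assms(1,2)] ball_in_unit_disk, of x "1 - r" n] K by auto
      then show "dist (f n x) (g x) < e" using elim by (simp add: dist_norm)
    qed
  qed
qed

lemma nn_integral_sq:
  assumes "sq_integrable f"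
  shows "(\<integral>\<^sup>+x. ennreal ((cmod (f x))\<^sup>2) \<partial>area_measure) = ennreal (norm_sq f)"
  unfolding norm_sq_def using assms by (intro nn_integral_eq_integral) (auto simp: sq_integrable_def)

text \<open>The hypothesis on the norms says that their upper limit is at most \<open>C\<close>. In
  this form it serves Cauchy sequences as well as minimizing sequences.\<close>

lemma sq_integrable_Fatou:
  assumes f: "\<And>n. sq_integrable (f n)" and lim: "\<And>x. (\<lambda>n. f n x) \<longlonglongrightarrow> g x"
    and le: "\<And>e. e > C \<Longrightarrow> eventually (\<lambda>n. norm_sq (f n) \<le> e) sequentially" and C: "C \<ge> 0"
  shows "sq_integrable g" "norm_sq g \<le> C"
proof -
  have fm: "f n \<in> borel_measurable area_measure" for n using f by (simp add: sq_integrable_def)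
  have gm [measurable]: "g \<in> borel_measurable area_measure"
    by (rule borel_measurable_LIMSEQ_metric[OF fm]) (use lim in auto)
  note fm [measurable]
  have "(\<integral>\<^sup>+x. ennreal ((cmod (g x))\<^sup>2) \<partial>area_measure) \<le> ennreal e" if e: "e > C" for e
  proof -
    have "(\<integral>\<^sup>+x. ennreal ((cmod (g x))\<^sup>2) \<partial>area_measure)
        = (\<integral>\<^sup>+x. liminf (\<lambda>n. ennreal ((cmod (f n x))\<^sup>2)) \<partial>area_measure)"
    proof (rule nn_integral_cong)
      fix x
      have "(\<lambda>n. ennreal ((cmod (f n x))\<^sup>2)) \<longlonglongrightarrow> ennreal ((cmod (g x))\<^sup>2)"
        by (intro tendsto_intros lim)
      then show "ennreal ((cmod (g x))\<^sup>2) = liminf (\<lambda>n. ennreal ((cmod (f n x))\<^sup>2))"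
        using lim_imp_Liminf[OF trivial_limit_sequentially] by metis
    qed
    also have "\<dots> \<le> liminf (\<lambda>n. \<integral>\<^sup>+x. ennreal ((cmod (f n x))\<^sup>2) \<partial>area_measure)"
      by (intro nn_integral_liminf) measurable
    also have "\<dots> \<le> ennreal e"
    proof (intro Liminf_le)
      show "\<forall>\<^sub>F n in sequentially. (\<integral>\<^sup>+x. ennreal ((cmod (f n x))\<^sup>2) \<partial>area_measure) \<le> ennreal e"
        using le[OF e] by eventually_elim (simp add: nn_integral_sq[OF f] ennreal_leI)
    qed simp
    finally show ?thesis .
  qed note bd = this
  have "(\<integral>\<^sup>+x. ennreal ((cmod (g x))\<^sup>2) \<partial>area_measure) \<le> ennreal (C + 1)" by (rule bd) simp
  then have "integrable area_measure (\<lambda>x. (cmod (g x))\<^sup>2)"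
    by (intro integrableI_bounded) (auto simp: le_less_trans)
  then show s: "sq_integrable g" by (simp add: sq_integrable_def gm)
  have "norm_sq g \<le> e" if "e > C" for e
    using bd[OF that] C that by (simp add: nn_integral_sq[OF s])
  then show "norm_sq g \<le> C" by (rule dense_ge)
qed

section \<open>Completeness and orthogonal projections\<close>

text \<open>By the evaluation bound a Cauchy sequence is uniformly Cauchy on smaller disks, hence
  has a holomorphic limit; Fatou's lemma turns the pointwise limit into a limit in norm.\<close>

lemma bergman_complete:
  assumes f: "\<And>n. f n \<in> bergman_space"
    and cauchy: "\<And>e. e > 0 \<Longrightarrow> \<exists>N. \<forall>m\<ge>N. \<forall>n\<ge>N. norm_sq (\<lambda>x. f m x - f n x) < e"
  obtains g where "g \<in> bergman_space" "\<And>x. (\<lambda>n. f n x) \<longlonglongrightarrow> g x"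
    "(\<lambda>n. norm_sq (\<lambda>x. f n x - g x)) \<longlonglongrightarrow> 0"
proof -
  define g where "g x = lim (\<lambda>n. f n x)" for x
  have unif: "uniform_limit (cball 0 r) f g sequentially" if r: "r < 1" for r
  proof -
    have "uniformly_Cauchy_on (cball 0 r) f"
    proof (rule uniformly_Cauchy_onI)
      fix e :: real assume e: "e > 0"
      then have "(e * (1 - r))\<^sup>2 > 0" using r by auto
      then obtain N where N: "\<And>m n. m \<ge> N \<Longrightarrow> n \<ge> N \<Longrightarrow> norm_sq (\<lambda>x. f m x - f n x) < (e * (1 - r))\<^sup>2"
        using cauchy by blast
      have "dist (f m x) (f n x) < e" if "x \<in> cball 0 r" "m \<ge> N" "n \<ge> N" for x m n
      proof -
        have "cmod x + (1 - r) \<le> 1" using that by auto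
        then have "cmod (f m x - f n x) \<le> sqrt (norm_sq (\<lambda>x. f m x - f n x)) / (1 - r)"
          using bergman_eval_le[OF bergman_diff[OF f f] ball_in_unit_disk, of x "1 - r" m n] r by auto
        also have "sqrt (norm_sq (\<lambda>x. f m x - f n x)) / (1 - r) < e"
          using N[OF that(2,3)] e r by (subst pos_divide_less_eq) (auto intro!: real_less_lsqrt)
        finally show ?thesis by (simp add: dist_norm)
      qed
      then show "\<exists>M. \<forall>x\<in>cball 0 r. \<forall>m\<ge>M. \<forall>n\<ge>M. dist (f m x) (f n x) < e" by blast
    qed
    then show ?thesis
      unfolding g_def by (intro uniformly_convergent_uniform_limit_iff[THEN iffD1] Cauchy_uniformly_convergent)
  qed
  have lim: "(\<lambda>n. f n x) \<longlonglongrightarrow> g x" for x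
  proof (cases "x \<in> unit_disk")
    case True
    then show ?thesis using tendsto_uniform_limitI[OF unif[of "cmod x"], of x] by auto
  next
    case False
    then show ?thesis by (simp add: g_def bergman_outside[OF f] lim_const)
  qed
  have hol: "g holomorphic_on unit_disk"
  proof (rule holomorphic_uniform_sequence[OF open_ball bergman_holomorphic[OF f]])
    fix x :: complex assume x: "x \<in> unit_disk"
    define d where "d = (1 - cmod x) / 2"
    have sub: "cball x d \<subseteq> cball 0 (cmod x + d)"
    proof
      fix y assume "y \<in> cball x d"
      then have "cmod (y - x) \<le> d" by (simp add: dist_norm norm_minus_commute)
      then show "y \<in> cball 0 (cmod x + d)" using norm_triangle_sub[of y x] by simp
    qed
    have d: "d > 0" "cmod x + d < 1" using x by (auto simp: d_def field_simps)
    show "\<exists>d>0. cball x d \<subseteq> unit_disk \<and> uniform_limit (cball x d) f g sequentially"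
      using d sub uniform_limit_on_subset[OF unif sub] by (intro exI[of _ d]) (auto simp: subset_iff)
  qed
  \<comment> \<open>Fatou's lemma with \<open>m\<close> fixed and \<open>n\<close> tending to
    infinity.\<close>
  have *: "sq_integrable (\<lambda>x. f m x - g x) \<and> norm_sq (\<lambda>x. f m x - g x) \<le> e"
    if N: "\<And>m n. m \<ge> N \<Longrightarrow> n \<ge> N \<Longrightarrow> norm_sq (\<lambda>x. f m x - f n x) < e" and m: "m \<ge> N" and e: "e > 0" for N m e
  proof -
    have "\<forall>\<^sub>F n in sequentially. norm_sq (\<lambda>x. f m x - f n x) \<le> e'" if "e' > e" for e'
      using eventually_ge_at_top[of N] by eventually_elim (use N[OF m] that in \<open>fastforce\<close>)
    note F = sq_integrable_Fatou[of "\<lambda>n x. f m x - f n x" "\<lambda>x. f m x - g x" e, OF _ _ this]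
    have "sq_integrable (\<lambda>x. f m x - f n x)" for n
      by (intro sq_integrable_diff bergman_sq_integrable f)
    moreover have "(\<lambda>n. f m x - f n x) \<longlonglongrightarrow> f m x - g x" for x
      by (intro tendsto_intros lim)
    ultimately show ?thesis using F e by auto
  qed
  have "sq_integrable g"
  proof -
    obtain N where "\<And>m n. m \<ge> N \<Longrightarrow> n \<ge> N \<Longrightarrow> norm_sq (\<lambda>x. f m x - f n x) < 1"
      using cauchy[of 1] by auto
    from *[OF this, of N] have "sq_integrable (\<lambda>x. f N x - g x)" by auto
    from sq_integrable_diff[OF bergman_sq_integrable[OF f[of N]] this] show ?thesis by simp
  qed
  then have gb: "g \<in> bergman_space"
    using hol lim by (intro bergman_spaceI) (auto simp: g_def bergman_outside[OF f])
  have "(\<lambda>n. norm_sq (\<lambda>x. f n x - g x)) \<longlonglongrightarrow> 0"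
  proof (rule LIMSEQ_I)
    fix e :: real assume "e > 0"
    then obtain N where "\<And>m n. m \<ge> N \<Longrightarrow> n \<ge> N \<Longrightarrow> norm_sq (\<lambda>x. f m x - f n x) < e / 2"
      using cauchy[of "e / 2"] by auto
    from *[OF this] \<open>e > 0\<close> have "norm_sq (\<lambda>x. f n x - g x) \<le> e / 2" if "n \<ge> N" for n
      using that by auto
    then have "norm (norm_sq (\<lambda>x. f n x - g x) - 0) < e" if "n \<ge> N" for n
      using \<open>e > 0\<close> that by fastforce
    then show "\<exists>N. \<forall>n\<ge>N. norm (norm_sq (\<lambda>x. f n x - g x) - 0) < e" by blast
  qed
  with gb lim show thesis by (rule that)
qed

lemma closed_subspace_bergman: "closed_subspace bergman_space"
proof -
  have "closedin Bergman.mtopology bergman_space"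
    using closedin_topspace[of Bergman.mtopology] by simp
  then show ?thesis by (simp add: closed_subspace_def bergman_zero bergman_add bergman_cmult)
qed

lemma closed_subspace_subset: "closed_subspace M \<Longrightarrow> M \<subseteq> bergman_space"
  unfolding closed_subspace_def using closedin_subset[of Bergman.mtopology M] by auto

lemma closed_subspace_limit:
  assumes M: "closed_subspace M" and f: "\<And>n. f n \<in> M" and g: "g \<in> bergman_space"
    and lim: "(\<lambda>n. norm_sq (\<lambda>x. f n x - g x)) \<longlonglongrightarrow> 0"
  shows "g \<in> M"
proof -
  have fb: "f n \<in> bergman_space" for n using f closed_subspace_subset[OF M] by blast
  have "(\<lambda>n. bergman_dist (f n) g) \<longlonglongrightarrow> 0"
    unfolding bergman_dist_eq using tendsto_real_sqrt[OF lim] by simp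
  then have "limitin Bergman.mtopology f g sequentially"
    unfolding Bergman.limitin_metric using g fb by (auto dest: order_tendstoD(2))
  moreover have "closedin Bergman.mtopology M" using M by (simp add: closed_subspace_def)
  ultimately show ?thesis
    unfolding Bergman.metric_closedin_iff_sequentially_closed using f by blast
qed

lemma closed_subspace_add: "closed_subspace M \<Longrightarrow> f \<in> M \<Longrightarrow> g \<in> M \<Longrightarrow> (\<lambda>x. f x + g x) \<in> M"
  by (simp add: closed_subspace_def)

lemma closed_subspace_cmult: "closed_subspace M \<Longrightarrow> f \<in> M \<Longrightarrow> (\<lambda>x. c * f x) \<in> M"
  by (simp add: closed_subspace_def)

lemma closed_subspace_diff: "closed_subspace M \<Longrightarrow> f \<in> M \<Longrightarrow> g \<in> M \<Longrightarrow> (\<lambda>x. f x - g x) \<in> M"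
  using closed_subspace_add[OF _ _ closed_subspace_cmult[of M g "-1"], of f] by simp

lemma norm_sq_parallelogram:
  assumes "sq_integrable f" "sq_integrable g"
  shows "norm_sq (\<lambda>x. f x + g x) + norm_sq (\<lambda>x. f x - g x) = 2 * norm_sq f + 2 * norm_sq g"
proof -
  have "norm_sq (\<lambda>x. f x - (-1) * g x) = norm_sq f + norm_sq (\<lambda>x. (-1) * g x) - 2 * Re (bergman_inner f (\<lambda>x. (-1) * g x))"
    using assms by (intro norm_sq_diff sq_integrable_cmult)
  then show ?thesis
    using norm_sq_diff[OF assms] unfolding inner_cmult_right norm_sq_cmult by simp
qed

text \<open>A minimizing sequence in \<open>M\<close> is Cauchy by the parallelogram law, and its
  limit realizes the distance to \<open>g\<close>. As \<open>g\<close> need not be holomorphic, the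
  choice \<open>M = bergman_space\<close> gives the projection of all square integrable functions to
  the Bergman space.\<close>

lemma projection_exists:
  assumes M: "closed_subspace M" and g: "sq_integrable g"
  shows "\<exists>h\<in>M. \<forall>f\<in>M. bergman_inner f (\<lambda>x. g x - h x) = 0"
proof -
  have Mb: "f \<in> bergman_space" "sq_integrable f" if "f \<in> M" for f
    using that closed_subspace_subset[OF M] bergman_sq_integrable by blast+
  define d where "d = (INF h\<in>M. norm_sq (\<lambda>x. g x - h x))"
  have ne: "M \<noteq> {}" using M by (auto simp: closed_subspace_def)
  have bdd: "bdd_below ((\<lambda>h. norm_sq (\<lambda>x. g x - h x)) ` M)" by (rule bdd_belowI[of _ 0]) auto
  have d: "d \<le> norm_sq (\<lambda>x. g x - h x)" if "h \<in> M" for h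
    unfolding d_def using bdd that by (rule cINF_lower)
  have d0: "d \<ge> 0" unfolding d_def using ne by (intro cINF_greatest) auto
  have "\<exists>h\<in>M. norm_sq (\<lambda>x. g x - h x) < d + 1 / real (Suc n)" for n
    using cINF_less_iff[OF ne bdd, of "d + 1 / real (Suc n)"] by (simp add: d_def)
  then obtain h where h: "\<And>n. h n \<in> M" "\<And>n. norm_sq (\<lambda>x. g x - h n x) < d + 1 / real (Suc n)"
    by metis
  have sq: "sq_integrable (\<lambda>x. g x - h n x)" for n by (intro sq_integrable_diff g Mb h)
  have par: "norm_sq (\<lambda>x. h m x - h n x) \<le> 2 / real (Suc m) + 2 / real (Suc n)" for m n
  proof -
    have "norm_sq (\<lambda>x. (g x - h n x) + (g x - h m x)) + norm_sq (\<lambda>x. (g x - h n x) - (g x - h m x))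
      = 2 * norm_sq (\<lambda>x. g x - h n x) + 2 * norm_sq (\<lambda>x. g x - h m x)"
      by (intro norm_sq_parallelogram sq)
    moreover have "norm_sq (\<lambda>x. (g x - h n x) + (g x - h m x)) \<ge> 4 * d"
    proof -
      have "(\<lambda>x. (1 / 2) * (h n x + h m x)) \<in> M"
        by (intro closed_subspace_cmult closed_subspace_add M h)
      from d[OF this] have "4 * d \<le> (cmod 2)\<^sup>2 * norm_sq (\<lambda>x. g x - (1 / 2) * (h n x + h m x))"
        by simp
      also have "\<dots> = norm_sq (\<lambda>x. 2 * (g x - (1 / 2) * (h n x + h m x)))" by (rule norm_sq_cmult[symmetric])
      finally show ?thesis by (simp add: algebra_simps)
    qed
    ultimately show ?thesis using h(2)[of n] h(2)[of m] by simp
  qed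
  obtain k where k: "k \<in> bergman_space" "\<And>x. (\<lambda>n. h n x) \<longlonglongrightarrow> k x"
    "(\<lambda>n. norm_sq (\<lambda>x. h n x - k x)) \<longlonglongrightarrow> 0"
  proof (rule bergman_complete[of h])
    fix e :: real assume e: "e > 0"
    then obtain N where N: "4 / real (Suc N) < e"
      using reals_Archimedean[of "e / 4"] by (auto simp: field_simps)
    have "norm_sq (\<lambda>x. h m x - h n x) < e" if "m \<ge> N" "n \<ge> N" for m n
    proof -
      have "2 / real (Suc m) \<le> 2 / real (Suc N)" "2 / real (Suc n) \<le> 2 / real (Suc N)"
        using that by (auto intro!: divide_left_mono)
      then show ?thesis using par[of m n] N by simp
    qed
    then show "\<exists>N. \<forall>m\<ge>N. \<forall>n\<ge>N. norm_sq (\<lambda>x. h m x - h n x) < e" by blast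
  qed (use Mb h in auto)
  have kM: "k \<in> M" by (rule closed_subspace_limit[OF M h(1) k(1,3)])
  have sk: "sq_integrable (\<lambda>x. g x - k x)" by (intro sq_integrable_diff g Mb kM)
  have min: "norm_sq (\<lambda>x. g x - k x) \<le> d"
  proof (rule sq_integrable_Fatou(2)[of "\<lambda>n x. g x - h n x"])
    fix e assume e: "e > d"
    have "(\<lambda>n. d + 1 / real (Suc n)) \<longlonglongrightarrow> d + 0"
      by (intro tendsto_intros LIMSEQ_inverse_real_of_nat[unfolded inverse_eq_divide])
    then have "eventually (\<lambda>n. d + 1 / real (Suc n) < e) sequentially"
      using e by (intro order_tendstoD(2)) auto
    then show "\<forall>\<^sub>F n in sequentially. norm_sq (\<lambda>x. g x - h n x) \<le> e"
      by eventually_elim (use h(2) less_trans less_imp_le in blast)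
  qed (auto intro!: sq tendsto_intros k d0)
  have "bergman_inner f (\<lambda>x. g x - k x) = 0" if f: "f \<in> M" for f
  proof (rule ccontr)
    define b where "b = bergman_inner f (\<lambda>x. g x - k x)"
    \<comment> \<open>The competitor \<open>k + c * f\<close> would be strictly closer to
      \<open>g\<close>. The denominator is \<open>1 + norm_sq f\<close> instead of the optimal
      \<open>norm_sq f\<close>, so that it is positive without a case distinction.\<close>
    define c where "c = cnj b / of_real (1 + norm_sq f)"
    assume "bergman_inner f (\<lambda>x. g x - k x) \<noteq> 0"
    then have b: "cmod b > 0" by (simp add: b_def)
    have n1: "1 + norm_sq f > 0" using norm_sq_nonneg[of f] by linarith
    have "d \<le> norm_sq (\<lambda>x. g x - (k x + c * f x))"
      by (intro d closed_subspace_add closed_subspace_cmult M kM f)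
    also have "\<dots> = norm_sq (\<lambda>x. c * f x - (g x - k x))"
      unfolding norm_sq_def by (intro Bochner_Integration.integral_cong refl arg_cong[where f = "\<lambda>t. t\<^sup>2"])
        (metis (no_types, opaque_lifting) add.commute diff_add_eq_diff_diff_swap diff_diff_eq2 norm_minus_commute)
    also have "\<dots> = (cmod c)\<^sup>2 * norm_sq f + norm_sq (\<lambda>x. g x - k x) - 2 * Re (c * b)"
      using f sk by (subst norm_sq_diff) (auto intro: sq_integrable_cmult Mb simp: norm_sq_cmult inner_cmult_left b_def)
    also have "c * b = of_real ((cmod b)\<^sup>2 / (1 + norm_sq f))"
    proof -
      have "c * b = (b * cnj b) / of_real (1 + norm_sq f)" by (simp add: c_def)
      also have "b * cnj b = of_real ((cmod b)\<^sup>2)" by (rule complex_norm_square[symmetric])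
      finally show ?thesis by (simp only: of_real_divide)
    qed
    also have "(cmod c)\<^sup>2 = (cmod b)\<^sup>2 / (1 + norm_sq f)\<^sup>2"
      using n1 by (simp add: c_def norm_divide power_divide del: of_real_add)
    finally have "0 \<le> (cmod b)\<^sup>2 / (1 + norm_sq f)\<^sup>2 * norm_sq f - 2 * ((cmod b)\<^sup>2 / (1 + norm_sq f))"
      using min by (simp only: Re_complex_of_real)
    also have "\<dots> = - ((cmod b)\<^sup>2 * (2 + norm_sq f) / (1 + norm_sq f)\<^sup>2)"
      using n1 by (simp add: divide_simps power2_eq_square) (simp add: algebra_simps)
    finally have "(cmod b)\<^sup>2 * (2 + norm_sq f) / (1 + norm_sq f)\<^sup>2 \<le> 0" by simp
    moreover have "(cmod b)\<^sup>2 * (2 + norm_sq f) / (1 + norm_sq f)\<^sup>2 > 0"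
      using b n1 by (intro divide_pos_pos mult_pos_pos) auto
    ultimately show False by simp
  qed
  with kM show ?thesis by blast
qed

section \<open>Projections commuting with multiplication by a bounded function\<close>

locale bounded_symbol =
  fixes B :: "complex \<Rightarrow> complex"
  assumes B_bergman: "B \<in> bergman_space"
    and B_le: "cmod (B x) \<le> 1"

text \<open>The subspace does not appear: the axioms are properties that \<open>P\<close> shares
  with the complementary projection, so that all consequences can be applied to both.\<close>

locale commuting_projection = bounded_symbol B for B :: "complex \<Rightarrow> complex" +
  fixes P :: "(complex \<Rightarrow> complex) \<Rightarrow> complex \<Rightarrow> complex"
  assumes P_bergman: "f \<in> bergman_space \<Longrightarrow> P f \<in> bergman_space"
    and P_diff: "f \<in> bergman_space \<Longrightarrow> g \<in> bergman_space \<Longrightarrow> P (\<lambda>x. f x - g x) = (\<lambda>x. P f x - P g x)"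
    and P_cmult: "f \<in> bergman_space \<Longrightarrow> P (\<lambda>x. c * f x) = (\<lambda>x. c * P f x)"
    and P_selfadj: "f \<in> bergman_space \<Longrightarrow> g \<in> bergman_space \<Longrightarrow> bergman_inner (P f) g = bergman_inner f (P g)"
    and P_idem: "f \<in> bergman_space \<Longrightarrow> P (P f) = P f"
    and P_mult: "f \<in> bergman_space \<Longrightarrow> P (\<lambda>x. B x * f x) = (\<lambda>x. B x * P f x)"

lemma bergman_mult_bounded:
  assumes f: "f \<in> bergman_space" and h: "h holomorphic_on unit_disk" "\<And>x. x \<in> unit_disk \<Longrightarrow> cmod (h x) \<le> C" and C: "C \<ge> 0"
  shows "(\<lambda>x. h x * f x) \<in> bergman_space"
proof (rule bergman_spaceI)
  show hol: "(\<lambda>x. h x * f x) holomorphic_on unit_disk"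
    by (intro holomorphic_on_mult h bergman_holomorphic[OF f])
  have "(\<lambda>x. if x \<in> unit_disk then h x * f x else 0) \<in> borel_measurable borel"
    by (intro borel_measurable_continuous_on_if holomorphic_on_imp_continuous_on hol) auto
  also have "(\<lambda>x. if x \<in> unit_disk then h x * f x else 0) = (\<lambda>x. h x * f x)"
    using bergman_outside[OF f] by auto
  finally show "sq_integrable (\<lambda>x. h x * f x)"
  proof (rule sq_integrable_bound[OF _ bergman_sq_integrable[OF f] C])
    show "cmod (h x * f x) \<le> C * cmod (f x)" if "x \<in> unit_disk" for x
      using h(2)[OF that] by (simp add: norm_mult mult_right_mono)
  qed
qed (simp add: bergman_outside[OF f])

lemma bergman_bounded:
  assumes "h holomorphic_on unit_disk" "\<And>x. x \<in> unit_disk \<Longrightarrow> cmod (h x) \<le> C" "\<And>x. x \<notin> unit_disk \<Longrightarrow> h x = 0"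
  shows "h \<in> bergman_space" "norm_sq h \<le> C\<^sup>2 * measure area_measure UNIV"
proof -
  have C: "C \<ge> 0" using norm_ge_zero assms(2)[of 0] by (meson centre_in_ball order_trans zero_less_one)
  have "(\<lambda>x. if x \<in> unit_disk then h x else 0) \<in> borel_measurable borel"
    by (intro borel_measurable_continuous_on_if holomorphic_on_imp_continuous_on assms) auto
  also have "(\<lambda>x. if x \<in> unit_disk then h x else 0) = h" using assms(3) by auto
  finally have "sq_integrable h"
    by (rule sq_integrable_bound[OF _ sq_integrable_const[of 1] C]) (use assms in auto)
  then show "h \<in> bergman_space" using assms by (intro bergman_spaceI)
  have "norm_sq h \<le> (LINT x|area_measure. C\<^sup>2)"
    unfolding norm_sq_def
  proof (rule integral_mono_AE)
    show "AE x in area_measure. (cmod (h x))\<^sup>2 \<le> C\<^sup>2"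
      using AE_unit_disk by eventually_elim (auto intro!: power_mono assms)
  qed (use \<open>sq_integrable h\<close> in \<open>auto simp: sq_integrable_def\<close>)
  then show "norm_sq h \<le> C\<^sup>2 * measure area_measure UNIV" by (simp add: mult.commute)
qed

lemma inner_self_eq_0:
  assumes "f \<in> bergman_space" "bergman_inner f f = 0"
  shows "f = (\<lambda>_. 0)"
  using assms by (intro norm_sq_eq_0) (auto simp: inner_self)

text \<open>Because \<open>M\<close> is invariant under the adjoint, \<open>B * (f - P f)\<close> is
  again orthogonal to \<open>M\<close>, and \<open>B * P f\<close> is the projection of
  \<open>B * f\<close>. The symbol \<open>\<phi>\<close> is kept apart from \<open>B\<close> because
  the values of a Blaschke product off the disk are meaningless; functions of the space vanish
  there, so both define the same operator.\<close>

lemma reducing_subspace_projection: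
  assumes red: "reducing_subspace (mult_op \<phi>) M" and B: "B \<in> bergman_space" "\<And>x. cmod (B x) \<le> 1"
    and \<phi>: "\<And>x. x \<in> unit_disk \<Longrightarrow> \<phi> x = B x"
  obtains P where "commuting_projection B P" "\<And>f. f \<in> bergman_space \<Longrightarrow> P f \<in> M" "\<And>f. f \<in> M \<Longrightarrow> P f = f"
proof -
  have M: "closed_subspace M" using red by (simp add: reducing_subspace_def)
  have Mb: "f \<in> bergman_space" if "f \<in> M" for f using that closed_subspace_subset[OF M] by blast
  note sq = bergman_sq_integrable
  have mo: "mult_op \<phi> f = (\<lambda>x. B x * f x)" if "f \<in> bergman_space" for f
    using \<phi> bergman_outside[OF that] by (fastforce simp: mult_op_def)
  have Bf: "(\<lambda>x. B x * f x) \<in> bergman_space" if "f \<in> bergman_space" for f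
    by (rule bergman_mult_bounded[OF that bergman_holomorphic[OF B(1)], of 1]) (use B in auto)
  \<comment> \<open>The adjoint is a definite description, so existence and uniqueness come first;
    its value is the projection of \<open>cnj (B x) * g x\<close> to the Bergman space.\<close>
  have adj: "bergman_adjoint (mult_op \<phi>) g \<in> bergman_space \<and>
     (\<forall>f\<in>bergman_space. bergman_inner (mult_op \<phi> f) g = bergman_inner f (bergman_adjoint (mult_op \<phi>) g))"
    if g: "g \<in> bergman_space" for g
  proof -
    have Bm [measurable]: "B \<in> borel_measurable borel" "g \<in> borel_measurable borel"
      using bergman_measurable[OF B(1)] bergman_measurable[OF g] by auto
    have s: "sq_integrable (\<lambda>x. cnj (B x) * g x)"
    proof (rule sq_integrable_bound[OF _ sq[OF g], of _ 1])
      show "cmod (cnj (B x) * g x) \<le> 1 * cmod (g x)" for x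
        using B(2)[of x] by (simp add: norm_mult mult_left_le_one_le)
    qed auto
    have eq: "bergman_inner (mult_op \<phi> f) g = bergman_inner f (\<lambda>x. cnj (B x) * g x)" if "f \<in> bergman_space" for f
      using mo[OF that] by (simp add: bergman_inner_def mult_ac)
    obtain h where h: "h \<in> bergman_space" "\<And>f. f \<in> bergman_space \<Longrightarrow> bergman_inner f (\<lambda>x. cnj (B x) * g x - h x) = 0"
      using projection_exists[OF closed_subspace_bergman s] by blast
    have hh: "bergman_inner (mult_op \<phi> f) g = bergman_inner f h" if "f \<in> bergman_space" for f
      using h(2)[OF that] eq[OF that] by (simp add: inner_diff_right s sq h that)
    have "\<exists>!h. h \<in> bergman_space \<and> (\<forall>f\<in>bergman_space. bergman_inner (mult_op \<phi> f) g = bergman_inner f h)"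
    proof (rule ex1I[of _ h])
      fix k assume k: "k \<in> bergman_space \<and> (\<forall>f\<in>bergman_space. bergman_inner (mult_op \<phi> f) g = bergman_inner f k)"
      have d: "(\<lambda>x. k x - h x) \<in> bergman_space" using k h by (intro bergman_diff) auto
      have "bergman_inner (\<lambda>x. k x - h x) (\<lambda>x. k x - h x) = 0"
        using k h hh d by (subst inner_diff_right) (auto simp: sq)
      from inner_self_eq_0[OF d this] show "k = h" by (metis eq_iff_diff_eq_0 ext)
    qed (use h hh in auto)
    from theI'[OF this] show ?thesis unfolding bergman_adjoint_def .
  qed
  have "\<exists>h. h \<in> M \<and> (\<forall>g\<in>M. bergman_inner g (\<lambda>x. f x - h x) = 0)" if "f \<in> bergman_space" for f
    using projection_exists[OF M sq[OF that]] by blast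
  then obtain P where P: "\<And>f. f \<in> bergman_space \<Longrightarrow> P f \<in> M"
    "\<And>f g. f \<in> bergman_space \<Longrightarrow> g \<in> M \<Longrightarrow> bergman_inner g (\<lambda>x. f x - P f x) = 0"
    by metis
  \<comment> \<open>Linearity, idempotence and commutation with \<open>B\<close> all follow from
    this uniqueness.\<close>
  have uniq: "P f = h" if f: "f \<in> bergman_space" and h: "h \<in> M" "\<And>g. g \<in> M \<Longrightarrow> bergman_inner g (\<lambda>x. f x - h x) = 0" for f h
  proof -
    have d: "(\<lambda>x. P f x - h x) \<in> M" by (intro closed_subspace_diff M P f h)
    have "bergman_inner (\<lambda>x. P f x - h x) (\<lambda>x. (f x - h x) - (f x - P f x)) = 0"
      using h(2)[OF d] P(2)[OF f d] inner_diff_right[OF sq[OF bergman_diff[OF f Mb[OF h(1)]]]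
          sq[OF bergman_diff[OF f Mb[OF P(1)[OF f]]]] sq[OF Mb[OF d]]] by simp
    then have "bergman_inner (\<lambda>x. P f x - h x) (\<lambda>x. P f x - h x) = 0" by simp
    from inner_self_eq_0[OF Mb[OF d] this] show ?thesis by (metis eq_iff_diff_eq_0 ext)
  qed
  have left: "bergman_inner (\<lambda>x. f x - P f x) g = 0" if "f \<in> bergman_space" "g \<in> M" for f g
    using P(2)[OF that] inner_commute[of "\<lambda>x. f x - P f x" g] by simp
  have "commuting_projection B P"
  proof
    show "B \<in> bergman_space" "cmod (B x) \<le> 1" for x by fact+
    show Pb: "P f \<in> bergman_space" if "f \<in> bergman_space" for f using Mb P that by blast
    show "P (\<lambda>x. f x - g x) = (\<lambda>x. P f x - P g x)" if fg: "f \<in> bergman_space" "g \<in> bergman_space" for f g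
    proof (rule uniq)
      fix k assume k: "k \<in> M"
      have "bergman_inner k (\<lambda>x. (f x - P f x) - (g x - P g x)) = 0"
        using P(2)[OF _ k] fg by (subst inner_diff_right) (auto intro!: sq bergman_diff Pb Mb[OF k])
      then show "bergman_inner k (\<lambda>x. f x - g x - (P f x - P g x)) = 0" by (simp add: algebra_simps)
    qed (use fg P M in \<open>auto intro!: bergman_diff closed_subspace_diff\<close>)
    show "P (\<lambda>x. c * f x) = (\<lambda>x. c * P f x)" if f: "f \<in> bergman_space" for f c
    proof (rule uniq)
      fix k assume k: "k \<in> M"
      show "bergman_inner k (\<lambda>x. c * f x - c * P f x) = 0"
        using P(2)[OF f k] inner_cmult_right[of k c "\<lambda>x. f x - P f x"] by (simp add: algebra_simps)
    qed (use f P M in \<open>auto intro!: bergman_cmult closed_subspace_cmult\<close>)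
    show "bergman_inner (P f) g = bergman_inner f (P g)" if fg: "f \<in> bergman_space" "g \<in> bergman_space" for f g
    proof -
      have "bergman_inner (P f) (\<lambda>x. g x - P g x) = 0" using P fg by blast
      moreover have "bergman_inner (\<lambda>x. f x - P f x) (P g) = 0" using left P fg by blast
      ultimately show ?thesis using fg by (simp add: inner_diff_right inner_diff_left sq Pb)
    qed
    show "P (P f) = P f" if "f \<in> bergman_space" for f
      by (rule uniq) (use that P Pb in \<open>auto simp: bergman_inner_def\<close>)
    show "P (\<lambda>x. B x * f x) = (\<lambda>x. B x * P f x)" if f: "f \<in> bergman_space" for f
    proof (rule uniq[OF Bf[OF f]])
      show "(\<lambda>x. B x * P f x) \<in> M"
        using red P(1)[OF f] mo[OF Pb[OF f]] by (auto simp: reducing_subspace_def)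
      fix k assume k: "k \<in> M"
      have ak: "bergman_adjoint (mult_op \<phi>) k \<in> M" using red k by (auto simp: reducing_subspace_def)
      have d: "(\<lambda>x. f x - P f x) \<in> bergman_space" by (intro bergman_diff f Pb)
      have "bergman_inner (\<lambda>x. B x * (f x - P f x)) k = bergman_inner (\<lambda>x. f x - P f x) (bergman_adjoint (mult_op \<phi>) k)"
        using adj[OF Mb[OF k]] d mo[OF d] by auto
      also have "\<dots> = 0" by (rule left[OF f ak])
      finally show "bergman_inner k (\<lambda>x. B x * f x - B x * P f x) = 0"
        using inner_commute[of k "\<lambda>x. B x * f x - B x * P f x"] by (simp add: algebra_simps)
    qed
  qed
  moreover have "P f = f" if "f \<in> M" for f
    by (rule uniq) (use that Mb in \<open>auto simp: bergman_inner_def\<close>)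
  ultimately show thesis using P that by blast
qed

context bounded_symbol
begin

lemma B_mult_bergman: "f \<in> bergman_space \<Longrightarrow> (\<lambda>x. B x * f x) \<in> bergman_space"
  by (rule bergman_mult_bounded[OF _ bergman_holomorphic[OF B_bergman], of _ 1]) (auto intro: B_le)

end

context commuting_projection
begin

lemma P_add:
  assumes "f \<in> bergman_space" "g \<in> bergman_space"
  shows "P (\<lambda>x. f x + g x) = (\<lambda>x. P f x + P g x)"
  using P_diff[OF assms(1) bergman_cmult[OF assms(2), of "-1"]] P_cmult[OF assms(2), of "-1"] by simp

lemma P_zero: "P (\<lambda>_. 0) = (\<lambda>_. 0)"
  using P_cmult[OF bergman_zero, of 0] by simp

lemma P_sum:
  assumes "\<And>i. i \<in> I \<Longrightarrow> f i \<in> bergman_space"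
  shows "P (\<lambda>x. \<Sum>i\<in>I. f i x) = (\<lambda>x. \<Sum>i\<in>I. P (f i) x)"
  using assms by (induction I rule: infinite_finite_induct) (auto simp: P_zero P_add bergman_sum)

lemma P_contraction:
  assumes "f \<in> bergman_space"
  shows "norm_sq (P f) \<le> norm_sq f"
proof -
  have "bergman_inner f (P f) = bergman_inner (P f) (P f)"
    using P_selfadj[OF assms P_bergman[OF assms]] P_idem[OF assms] by simp
  then have "Re (bergman_inner f (P f)) = norm_sq (P f)" by (simp add: inner_self)
  moreover have "norm_sq (\<lambda>x. f x - P f x) = norm_sq f + norm_sq (P f) - 2 * Re (bergman_inner f (P f))"
    by (intro norm_sq_diff bergman_sq_integrable assms P_bergman)
  ultimately show ?thesis using norm_sq_nonneg[of "\<lambda>x. f x - P f x"] by linarith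
qed

lemma commuting_projection_complement: "commuting_projection B (\<lambda>f x. f x - P f x)"
proof
  note sq = bergman_sq_integrable
  show "bergman_inner (\<lambda>x. f x - P f x) g = bergman_inner f (\<lambda>x. g x - P g x)"
    if "f \<in> bergman_space" "g \<in> bergman_space" for f g
    using that by (simp add: inner_diff_left inner_diff_right P_selfadj P_bergman sq)
  show "(\<lambda>x. B x * f x - P (\<lambda>x. B x * f x) x) = (\<lambda>x. B x * (f x - P f x))" if "f \<in> bergman_space" for f
    using that by (simp add: P_mult right_diff_distrib)
  show "(\<lambda>x. c * f x - P (\<lambda>x. c * f x) x) = (\<lambda>x. c * (f x - P f x))" if "f \<in> bergman_space" for f c
    using that by (simp add: P_cmult right_diff_distrib)
  show "(\<lambda>x. (f x - g x) - P (\<lambda>x. f x - g x) x) = (\<lambda>x. (f x - P f x) - (g x - P g x))"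
    if "f \<in> bergman_space" "g \<in> bergman_space" for f g
    using that by (simp add: P_diff algebra_simps)
qed (auto simp: B_bergman B_le P_bergman bergman_diff P_diff P_idem)

end

section \<open>Integrals over level sets\<close>

lemma set_integrable_mult_cnj:
  assumes "f \<in> bergman_space" "g \<in> bergman_space" "A \<in> sets borel"
  shows "set_integrable area_measure A (\<lambda>x. f x * cnj (g x))"
  unfolding set_integrable_def using assms by (intro integrable_mult_indicator integrable_mult_cnj bergman_sq_integrable) auto

lemma set_integrable_sq:
  assumes "f \<in> bergman_space" "A \<in> sets borel"
  shows "set_integrable area_measure A (\<lambda>x. (cmod (f x))\<^sup>2)"
  unfolding set_integrable_def using bergman_sq_integrable[OF assms(1)] assms(2)
  by (intro integrable_mult_indicator) (auto simp: sq_integrable_def)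

lemma integrable_bounded_mult:
  assumes "integrable area_measure H" and "g \<in> borel_measurable borel" and "\<And>x. cmod (g x) \<le> C"
  shows "integrable area_measure (\<lambda>x. g x * H x :: complex)"
proof (rule Bochner_Integration.integrable_bound)
  show "integrable area_measure (\<lambda>x. of_real C * H x)" using assms by simp
  have [measurable]: "H \<in> borel_measurable area_measure" "g \<in> borel_measurable borel"
    using assms by (auto dest: borel_measurable_integrable)
  show "(\<lambda>x. g x * H x) \<in> borel_measurable area_measure" by measurable
  show "AE x in area_measure. norm (g x * H x) \<le> norm (of_real C * H x)"
  proof (rule AE_I2)
    fix x
    have "cmod (g x) * cmod (H x) \<le> \<bar>C\<bar> * cmod (H x)"
      by (intro mult_right_mono) (use assms(3)[of x] in linarith, simp)
    then show "norm (g x * H x) \<le> norm (of_real C * H x)" by (simp add: norm_mult)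
  qed
qed

context bounded_symbol
begin

lemma B_borel [measurable]: "B \<in> borel_measurable borel"
  using bergman_measurable[OF B_bergman] by simp

text \<open>For bounded \<open>B\<close> this forces the image under \<open>B\<close> of the complex measure with density \<open>H\<close>
  to vanish (\<open>moment_free_level_set\<close>).\<close>

definition moment_free :: "(complex \<Rightarrow> complex) \<Rightarrow> bool" where
  "moment_free H \<longleftrightarrow> integrable area_measure H \<and>
     (\<forall>n m. (LINT x|area_measure. B x ^ n * cnj (B x) ^ m * H x) = 0)"

lemma B_power_le: "cmod (B x ^ n * cnj (B x) ^ m) \<le> 1"
  using B_le[of x] by (simp add: norm_mult norm_power power_le_one mult_le_one)

lemma moment_free_integrable: "moment_free H \<Longrightarrow> integrable area_measure (\<lambda>x. B x ^ n * cnj (B x) ^ m * H x)"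
  by (intro integrable_bounded_mult[of _ _ 1] B_power_le) (auto simp: moment_free_def)

lemma moment_free_mult_B: "moment_free H \<Longrightarrow> moment_free (\<lambda>x. B x * H x)"
  unfolding moment_free_def
proof (safe)
  assume H: "integrable area_measure H" "\<forall>n m. (LINT x|area_measure. B x ^ n * cnj (B x) ^ m * H x) = 0"
  show "integrable area_measure (\<lambda>x. B x * H x)" by (intro integrable_bounded_mult[of _ _ 1] H B_le) auto
  show "(LINT x|area_measure. B x ^ n * cnj (B x) ^ m * (B x * H x)) = 0" for n m
    using H(2)[rule_format, of "Suc n" m] by (simp add: mult_ac)
qed

lemma moment_free_mult_cnj: "moment_free H \<Longrightarrow> moment_free (\<lambda>x. cnj (B x) * H x)"
  unfolding moment_free_def
proof (safe)
  assume H: "integrable area_measure H" "\<forall>n m. (LINT x|area_measure. B x ^ n * cnj (B x) ^ m * H x) = 0"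
  show "integrable area_measure (\<lambda>x. cnj (B x) * H x)" by (intro integrable_bounded_mult[of _ _ 1] H) (auto simp: B_le)
  show "(LINT x|area_measure. B x ^ n * cnj (B x) ^ m * (cnj (B x) * H x)) = 0" for n m
    using H(2)[rule_format, of n "Suc m"] by (simp add: mult_ac)
qed

lemma moment_free_cmult: "moment_free H \<Longrightarrow> moment_free (\<lambda>x. c * H x)"
  by (auto simp: moment_free_def mult.left_commute[of _ c])

lemma moment_free_add:
  assumes "moment_free H" "moment_free K"
  shows "moment_free (\<lambda>x. H x + K x)"
proof -
  have "(LINT x|area_measure. B x ^ n * cnj (B x) ^ m * (H x + K x)) = 0" for n m
    using assms moment_free_integrable[OF assms(1), of n m] moment_free_integrable[OF assms(2), of n m]
    by (simp add: distrib_left moment_free_def)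
  then show ?thesis using assms by (simp add: moment_free_def)
qed

text \<open>Multiplication by \<open>B\<close> and by \<open>cnj B\<close> preserves moment-free
  densities, hence so does every real polynomial in the real and imaginary parts of
  \<open>B\<close>. The density is arbitrary in the induction because a product of polynomials is
  applied one factor after the other.\<close>

lemma moment_free_polynomial:
  assumes "real_polynomial_function r" "moment_free H"
  shows "moment_free (\<lambda>x. of_real (r (B x)) * H x)"
  using assms
proof (induction arbitrary: H)
  case (linear f)
  have f: "f y = Re y * f 1 + Im y * f \<i>" for y
  proof -
    interpret bounded_linear f by fact
    have "f y = f (Re y *\<^sub>R 1 + Im y *\<^sub>R \<i>)" by (intro arg_cong[where f = f]) (simp add: complex_eq_iff)
    then show ?thesis by (simp add: add scaleR)
  qed
  \<comment> \<open>The Wirtinger coefficients of the real linear form \<open>f\<close>, for which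
    \<open>f y = a * y + b * cnj y\<close>.\<close>
  define a b where "a = (of_real (f 1) - \<i> * of_real (f \<i>)) / 2" and "b = (of_real (f 1) + \<i> * of_real (f \<i>)) / 2"
  have *: "of_real (f y) = a * y + b * cnj y" for y
    by (subst f) (simp add: a_def b_def complex_eq_iff field_simps)
  have "moment_free (\<lambda>x. a * (B x * H x) + b * (cnj (B x) * H x))"
    using linear by (intro moment_free_add moment_free_cmult moment_free_mult_B moment_free_mult_cnj)
  then show ?case by (simp add: * algebra_simps)
next
  case (const c)
  then show ?case by (rule moment_free_cmult)
next
  case (add f g)
  from moment_free_add[OF add.IH(1)[OF add.prems] add.IH(2)[OF add.prems]] show ?case
    by (simp add: algebra_simps)
next
  case (mult f g)
  from mult.IH(1)[OF mult.IH(2)[OF mult.prems]] show ?case by (simp add: algebra_simps)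
qed

text \<open>The values of \<open>B\<close> lie in the closed unit disk, where \<open>q\<close> is
  uniformly approximated by polynomials; the error is at most \<open>e\<close> times the integral of
  \<open>cmod (H x)\<close>.\<close>

lemma moment_free_continuous:
  assumes H: "moment_free H" and q: "continuous_on UNIV q"
  shows "(LINT x|area_measure. of_real (q (B x)) * H x) = 0"
proof -
  have Hi: "integrable area_measure H" using H by (simp add: moment_free_def)
  have [measurable]: "H \<in> borel_measurable area_measure" "q \<in> borel_measurable borel"
    using Hi q by (auto dest: borel_measurable_integrable intro: borel_measurable_continuous_onI)
  define I where "I = (LINT x|area_measure. cmod (H x))"
  have "cmod (LINT x|area_measure. of_real (q (B x)) * H x) \<le> e * I" if e: "e > 0" for e
  proof -
    obtain r where r: "real_polynomial_function r" "\<And>x. x \<in> cball (0::complex) 1 \<Longrightarrow> \<bar>q x - r x\<bar> < e"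
      using Stone_Weierstrass_real_polynomial_function[of "cball (0::complex) 1" q e] q e
      by (metis compact_cball continuous_on_subset top_greatest)
    have rc: "continuous_on UNIV r"
      using r(1) continuous_on_polymonial_function real_polynomial_function_eq by blast
    have [measurable]: "r \<in> borel_measurable borel" using rc by (rule borel_measurable_continuous_onI)
    have bd: "cmod (of_real (q (B x) - r (B x))) \<le> e" for x
      using r(2)[of "B x"] B_le[of x] by (simp del: of_real_diff)
    have "\<forall>n m. (LINT x|area_measure. B x ^ n * cnj (B x) ^ m * (of_real (r (B x)) * H x)) = 0"
      using moment_free_polynomial[OF r(1) H] unfolding moment_free_def by blast
    from this[rule_format, of 0 0] have "(LINT x|area_measure. of_real (r (B x)) * H x) = 0" by simp
    moreover have "integrable area_measure (\<lambda>x. of_real (r (B x)) * H x)"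
      using moment_free_polynomial[OF r(1) H] unfolding moment_free_def by auto
    moreover have i2: "integrable area_measure (\<lambda>x. of_real (q (B x) - r (B x)) * H x)"
      by (rule integrable_bounded_mult[OF Hi _ bd]) measurable
    ultimately have "(LINT x|area_measure. of_real (q (B x)) * H x) = (LINT x|area_measure. of_real (q (B x) - r (B x)) * H x)"
      using Bochner_Integration.integral_add[of area_measure "\<lambda>x. of_real (r (B x)) * H x" "\<lambda>x. of_real (q (B x) - r (B x)) * H x"]
      by (simp add: algebra_simps)
    also have "cmod \<dots> \<le> (LINT x|area_measure. cmod (of_real (q (B x) - r (B x)) * H x))"
      by (rule integral_norm_bound)
    also have "\<dots> \<le> (LINT x|area_measure. e * cmod (H x))"
    proof (rule integral_mono)
      show "integrable area_measure (\<lambda>x. cmod (of_real (q (B x) - r (B x)) * H x))" using i2 by simp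
      show "integrable area_measure (\<lambda>x. e * cmod (H x))" using Hi by simp
      show "cmod (of_real (q (B x) - r (B x)) * H x) \<le> e * cmod (H x)" for x
        using bd[of x] by (simp add: norm_mult mult_right_mono)
    qed
    finally show ?thesis by (simp add: I_def)
  qed
  moreover have "((\<lambda>e. e * I) \<longlongrightarrow> 0 * I) (at_right 0)" by (intro tendsto_intros)
  ultimately have "cmod (LINT x|area_measure. of_real (q (B x)) * H x) \<le> 0 * I"
    by (intro tendsto_lowerbound[where F = "at_right 0" and f = "\<lambda>e. e * I"])
      (auto simp: eventually_at_filter)
  then show ?thesis by simp
qed

definition level_set :: "complex \<Rightarrow> real \<Rightarrow> complex set" where
  "level_set c e = {x \<in> unit_disk. cmod (B x - c) < e}"

lemma level_set_borel [measurable]: "level_set c e \<in> sets borel"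
proof -
  have [measurable]: "unit_disk \<in> sets borel" by auto
  show ?thesis unfolding level_set_def by measurable
qed

lemma moment_free_level_set:
  assumes H: "moment_free H"
  shows "(LINT x:level_set c e|area_measure. H x) = 0"
proof -
  have Hi: "integrable area_measure H" using H by (simp add: moment_free_def)
  have Hm [measurable]: "H \<in> borel_measurable area_measure"
    using Hi by (auto dest: borel_measurable_integrable)
  \<comment> \<open>Continuous functions that increase to the indicator of the open disk of radius
    \<open>e\<close> about \<open>c\<close>. They vanish outside it, so the limit is right on its
    boundary as well.\<close>
  define q where "q n y = min 1 (real n * max 0 (e - cmod (y - c)))" for n y
  have qc: "continuous_on UNIV (q n)" for n
    unfolding q_def by (intro continuous_intros)
  have [measurable]: "q n \<in> borel_measurable borel" for n using qc by (rule borel_measurable_continuous_onI)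
  have q01: "0 \<le> q n y" "q n y \<le> 1" for n y by (auto simp: q_def)
  have qlim: "(\<lambda>n. q n y) \<longlonglongrightarrow> indicator {y. cmod (y - c) < e} y" for y
  proof (cases "cmod (y - c) < e")
    case True
    obtain N where N: "1 \<le> real N * (e - cmod (y - c))"
      using True by (metis diff_gt_0_iff_gt reals_Archimedean3 less_imp_le)
    have "q n y = 1" if "n \<ge> N" for n
    proof -
      have "real N * (e - cmod (y - c)) \<le> real n * (e - cmod (y - c))"
        using that True by (intro mult_right_mono) auto
      with N have "1 \<le> real n * (e - cmod (y - c))" by (rule order_trans)
      then show ?thesis using True by (simp add: q_def min_absorb1)
    qed
    then show ?thesis using True
      by (intro tendsto_eventually) (auto simp: eventually_at_top_linorder)
  next
    case False
    then show ?thesis by (simp add: q_def)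
  qed
  have "(\<lambda>n. LINT x|area_measure. of_real (q n (B x)) * H x)
      \<longlonglongrightarrow> (LINT x|area_measure. of_real (indicator {y. cmod (y - c) < e} (B x)) * H x)"
  proof (rule integral_dominated_convergence[where w = "\<lambda>x. cmod (H x)"])
    show "AE x in area_measure. (\<lambda>n. of_real (q n (B x)) * H x)
      \<longlonglongrightarrow> of_real (indicator {y. cmod (y - c) < e} (B x)) * H x"
      by (intro AE_I2 tendsto_intros qlim)
    show "AE x in area_measure. norm (of_real (q n (B x)) * H x) \<le> cmod (H x)" for n
      using q01 by (intro AE_I2) (simp add: norm_mult mult_left_le_one_le)
  qed (use Hi in auto)
  then have "(LINT x|area_measure. of_real (indicator {y. cmod (y - c) < e} (B x)) * H x) = 0"
    by (simp add: moment_free_continuous[OF H qc] LIMSEQ_const_iff)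
  also have "(LINT x|area_measure. of_real (indicator {y. cmod (y - c) < e} (B x)) * H x)
      = (LINT x:level_set c e|area_measure. H x)"
    unfolding set_lebesgue_integral_def
  proof (rule integral_cong_AE)
    show "AE x in area_measure. of_real (indicator {y. cmod (y - c) < e} (B x)) * H x = indicator (level_set c e) x *\<^sub>R H x"
      using AE_unit_disk by eventually_elim (auto simp: level_set_def indicator_def)
  qed measurable
  finally show ?thesis .
qed

end

context commuting_projection
begin

lemma P_mult_power: "f \<in> bergman_space \<Longrightarrow> (\<lambda>x. B x ^ n * f x) \<in> bergman_space \<and> P (\<lambda>x. B x ^ n * f x) = (\<lambda>x. B x ^ n * P f x)"
proof (induction n)
  case (Suc n)
  then have "(\<lambda>x. B x ^ n * f x) \<in> bergman_space" by blast
  from P_mult[OF this] B_mult_bergman[OF this] Suc show ?case by (simp add: mult.assoc)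
qed simp

lemma selfadjoint_moment_free:
  assumes f: "f \<in> bergman_space" and g: "g \<in> bergman_space"
  shows "moment_free (\<lambda>x. P f x * cnj (g x) - f x * cnj (P g x))"
proof -
  note sq = bergman_sq_integrable
  have i: "integrable area_measure (\<lambda>x. P f x * cnj (g x))" "integrable area_measure (\<lambda>x. f x * cnj (P g x))"
    using assms by (auto intro!: integrable_mult_cnj sq P_bergman)
  have "(LINT x|area_measure. B x ^ n * cnj (B x) ^ m * (P f x * cnj (g x) - f x * cnj (P g x))) = 0" for n m
  proof -
    have "bergman_inner (\<lambda>x. B x ^ n * P f x) (\<lambda>x. B x ^ m * g x) = bergman_inner (\<lambda>x. B x ^ n * f x) (\<lambda>x. B x ^ m * P g x)"
      using P_selfadj[of "\<lambda>x. B x ^ n * f x" "\<lambda>x. B x ^ m * g x"] P_mult_power[OF f, of n] P_mult_power[OF g, of m] by simp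
    then have "0 = bergman_inner (\<lambda>x. B x ^ n * P f x) (\<lambda>x. B x ^ m * g x) - bergman_inner (\<lambda>x. B x ^ n * f x) (\<lambda>x. B x ^ m * P g x)"
      by simp
    also have "\<dots> = (LINT x|area_measure. (B x ^ n * P f x) * cnj (B x ^ m * g x) - (B x ^ n * f x) * cnj (B x ^ m * P g x))"
      unfolding bergman_inner_def
      by (rule Bochner_Integration.integral_diff[symmetric])
        (auto intro!: integrable_mult_cnj sq simp del: complex_cnj_mult simp: P_mult_power[OF f] P_mult_power[OF g] P_mult_power[OF P_bergman[OF f]] P_mult_power[OF P_bergman[OF g]])
    finally show ?thesis by (simp add: algebra_simps)
  qed
  with i show ?thesis by (simp add: moment_free_def)
qed

lemma level_set_selfadjoint:
  assumes f: "f \<in> bergman_space" and g: "g \<in> bergman_space"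
  shows "(LINT x:level_set c e|area_measure. P f x * cnj (g x)) = (LINT x:level_set c e|area_measure. f x * cnj (P g x))"
  using moment_free_level_set[OF selfadjoint_moment_free[OF assms], of c e] assms
  by (subst (asm) set_integral_diff) (auto intro!: set_integrable_mult_cnj P_bergman)

text \<open>With \<open>g = P f\<close> and idempotence, self-adjointness over the level set equates
  the integral of \<open>(cmod (P f x))\<^sup>2\<close> with that of
  \<open>f x * cnj (P f x)\<close>, and half of the latter's bound is absorbed. Thus bounds for the
  mass over shrinking level sets pass from \<open>f\<close> to \<open>P f\<close>.\<close>

lemma level_set_contraction:
  assumes f: "f \<in> bergman_space"
  shows "(LINT x:level_set c e|area_measure. (cmod (P f x))\<^sup>2) \<le> (LINT x:level_set c e|area_measure. (cmod (f x))\<^sup>2)"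
proof -
  let ?E = "level_set c e"
  have "complex_of_real (LINT x:?E|area_measure. (cmod (P f x))\<^sup>2) = (LINT x:?E|area_measure. P f x * cnj (P f x))"
    unfolding set_lebesgue_integral_def
    by (subst integral_complex_of_real[symmetric]) (simp add: complex_norm_square[symmetric] scaleR_conv_of_real)
  also have "\<dots> = (LINT x:?E|area_measure. f x * cnj (P f x))"
    using level_set_selfadjoint[OF f P_bergman[OF f], of c e] by (simp add: P_idem f)
  finally have "(LINT x:?E|area_measure. (cmod (P f x))\<^sup>2) = Re (LINT x:?E|area_measure. f x * cnj (P f x))"
    by (metis Re_complex_of_real)
  also have "\<dots> \<le> cmod (LINT x:?E|area_measure. f x * cnj (P f x))" by (rule complex_Re_le_cmod)
  also have "\<dots> \<le> (LINT x:?E|area_measure. cmod (f x * cnj (P f x)))"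
    by (intro set_integral_norm_bound set_integrable_mult_cnj f P_bergman) auto
  also have "\<dots> \<le> (LINT x:?E|area_measure. (cmod (f x))\<^sup>2 / 2 + (cmod (P f x))\<^sup>2 / 2)"
  proof (rule set_integral_mono)
    show "set_integrable area_measure ?E (\<lambda>x. cmod (f x * cnj (P f x)))"
      by (intro set_integrable_norm set_integrable_mult_cnj f P_bergman) auto
    show "set_integrable area_measure ?E (\<lambda>x. (cmod (f x))\<^sup>2 / 2 + (cmod (P f x))\<^sup>2 / 2)"
      by (intro set_integral_add set_integrable_divide set_integrable_sq f P_bergman) auto
    show "cmod (f x * cnj (P f x)) \<le> (cmod (f x))\<^sup>2 / 2 + (cmod (P f x))\<^sup>2 / 2" for x
      using sum_squares_bound[of "cmod (f x)" "cmod (P f x)"] by (simp add: norm_mult)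
  qed
  also have "\<dots> = (LINT x:?E|area_measure. (cmod (f x))\<^sup>2) / 2 + (LINT x:?E|area_measure. (cmod (P f x))\<^sup>2) / 2"
    by (subst set_integral_add(2)) (auto intro!: set_integrable_divide set_integrable_sq f P_bergman)
  finally show ?thesis by simp
qed

end

section \<open>Difference quotients\<close>

text \<open>With \<open>f = B\<close> this is the test function that singles out \<open>w\<close> in
  its fibre. If \<open>f w = 0\<close>, it divides out the zero without leaving the Bergman space,
  and iterated it expands \<open>diff_quot B w\<close> in powers of the increment of
  \<open>w\<close>.\<close>

definition diff_quot :: "(complex \<Rightarrow> complex) \<Rightarrow> complex \<Rightarrow> complex \<Rightarrow> complex" where
  "diff_quot f w x = (if x \<notin> unit_disk then 0 else if x = w then deriv f w else (f x - f w) / (x - w))"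

lemma diff_quot_holomorphic:
  assumes "f holomorphic_on unit_disk" "w \<in> unit_disk"
  shows "diff_quot f w holomorphic_on unit_disk"
proof -
  have "(\<lambda>x. if x = w then deriv f w else (f x - f w) / (x - w)) holomorphic_on unit_disk"
    by (rule pole_lemma[OF assms(1)]) (use assms(2) in \<open>simp add: interior_open\<close>)
  then show ?thesis by (rule holomorphic_transform) (auto simp: diff_quot_def)
qed

lemma diff_quot_outside: "x \<notin> unit_disk \<Longrightarrow> diff_quot f w x = 0"
  by (simp add: diff_quot_def)

lemma diff_quot_self: "w \<in> unit_disk \<Longrightarrow> diff_quot f w w = deriv f w"
  by (simp add: diff_quot_def)

lemma diff_quot_mult: "x \<in> unit_disk \<Longrightarrow> (x - w) * diff_quot f w x = f x - f w"
  by (simp add: diff_quot_def)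

lemma disk_contains_cball:
  assumes "w \<in> unit_disk"
  obtains \<delta> where "\<delta> > 0" "cball w \<delta> \<subseteq> unit_disk"
proof -
  have "open unit_disk" by simp
  then obtain e where "e > 0" "cball w e \<subseteq> unit_disk" using assms open_contains_cball by metis
  then show thesis by (rule that)
qed

text \<open>At distance at least \<open>\<delta>\<close> from \<open>w\<close> the quotient is
  estimated directly, and closer to \<open>w\<close> by the maximum principle.\<close>

lemma diff_quot_le:
  assumes f: "f holomorphic_on unit_disk" "\<And>x. x \<in> unit_disk \<Longrightarrow> cmod (f x) \<le> C"
    and w: "cball w \<delta> \<subseteq> unit_disk" "\<delta> > 0" and x: "x \<in> unit_disk"
  shows "cmod (diff_quot f w x) \<le> 2 * C / \<delta>"
proof -
  have wD: "w \<in> unit_disk" using w by (auto simp: subset_iff)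
  have far: "cmod (diff_quot f w y) \<le> 2 * C / \<delta>" if y: "y \<in> unit_disk" "cmod (y - w) \<ge> \<delta>" for y
  proof -
    have "cmod (f y - f w) \<le> 2 * C" using f(2)[OF y(1)] f(2)[OF wD] norm_triangle_ineq4[of "f y" "f w"] by linarith
    moreover have "y \<noteq> w" using y w(2) by auto
    moreover have "cmod (f y - f w) / cmod (y - w) \<le> 2 * C / \<delta>"
      using calculation y w order_trans[OF norm_ge_zero f(2)[OF y(1)]] by (intro frac_le) auto
    ultimately show ?thesis using y by (simp add: diff_quot_def norm_divide)
  qed
  show ?thesis
  proof (cases "cmod (x - w) \<ge> \<delta>")
    case False
    have hol: "diff_quot f w holomorphic_on unit_disk" by (rule diff_quot_holomorphic[OF f(1) wD])
    show ?thesis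
    proof (rule maximum_modulus_frontier[of "diff_quot f w" "cball w \<delta>"])
      show "diff_quot f w holomorphic_on interior (cball w \<delta>)"
        by (rule holomorphic_on_subset[OF hol]) (use w interior_subset in blast)
      show "continuous_on (closure (cball w \<delta>)) (diff_quot f w)"
        using w by (intro holomorphic_on_imp_continuous_on holomorphic_on_subset[OF hol]) auto
      show "cmod (diff_quot f w z) \<le> 2 * C / \<delta>" if "z \<in> frontier (cball w \<delta>)" for z
        using that w by (intro far) (auto simp: dist_norm norm_minus_commute subset_iff)
    qed (use False in \<open>auto simp: dist_norm norm_minus_commute\<close>)
  qed (use x far in auto)
qed

text \<open>Near \<open>w\<close> the quotient is bounded by compactness, and away from it by
  \<open>(cmod (f x) + cmod (f w)) / \<delta>\<close>; the sum of both bounds is square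
  integrable.\<close>

lemma diff_quot_bergman:
  assumes f: "f \<in> bergman_space" and w: "w \<in> unit_disk"
  shows "diff_quot f w \<in> bergman_space"
proof (rule bergman_spaceI)
  show hol: "diff_quot f w holomorphic_on unit_disk" by (rule diff_quot_holomorphic[OF bergman_holomorphic[OF f] w])
  obtain \<delta> where \<delta>: "\<delta> > 0" "cball w \<delta> \<subseteq> unit_disk" using disk_contains_cball[OF w] by blast
  have "compact (diff_quot f w ` cball w \<delta>)"
    by (intro compact_continuous_image holomorphic_on_imp_continuous_on holomorphic_on_subset[OF hol \<delta>(2)] compact_cball)
  then obtain K where K: "K > 0" "\<And>x. x \<in> cball w \<delta> \<Longrightarrow> cmod (diff_quot f w x) \<le> K"
    using compact_imp_bounded bounded_pos by (metis (no_types, lifting) image_eqI)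
  have m: "diff_quot f w \<in> borel_measurable borel"
  proof -
    have "(\<lambda>x. if x \<in> unit_disk then diff_quot f w x else 0) \<in> borel_measurable borel"
      by (intro borel_measurable_continuous_on_if holomorphic_on_imp_continuous_on hol) auto
    also have "(\<lambda>x. if x \<in> unit_disk then diff_quot f w x else 0) = diff_quot f w"
      by (auto simp: diff_quot_outside)
    finally show ?thesis .
  qed
  note [measurable] = m
  have fm [measurable]: "f \<in> borel_measurable borel" using bergman_measurable[OF f] by simp
  define g :: "complex \<Rightarrow> complex" where "g x = of_real (K + (cmod (f x) + cmod (f w)) / \<delta>)" for x :: complex
  have "sq_integrable (\<lambda>x. of_real (cmod (f x)) :: complex)"
    by (rule sq_integrable_bound[OF _ bergman_sq_integrable[OF f], of _ 1]) auto
  from sq_integrable_add[OF sq_integrable_const[of "of_real (K + cmod (f w) / \<delta>)"] sq_integrable_cmult[OF this, of "of_real (1 / \<delta>)"]]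
  have g: "sq_integrable g" by (simp add: g_def[abs_def] add_divide_distrib algebra_simps)
  show "sq_integrable (diff_quot f w)"
  proof (rule sq_integrable_bound[OF m g, of 1])
    fix x assume x: "x \<in> unit_disk"
    have gx: "cmod (g x) = K + (cmod (f x) + cmod (f w)) / \<delta>"
      using K(1) \<delta> unfolding g_def norm_of_real by (intro abs_of_nonneg) auto
    show "cmod (diff_quot f w x) \<le> 1 * cmod (g x)"
    proof (cases "x \<in> cball w \<delta>")
      case True
      have "(cmod (f x) + cmod (f w)) / \<delta> \<ge> 0" using \<delta> by auto
      then show ?thesis using K(2)[OF True] gx by simp
    next
      case False
      then have d: "cmod (x - w) \<ge> \<delta>" "x \<noteq> w" using \<delta> by (auto simp: dist_norm norm_minus_commute)
      have "cmod (f x - f w) / cmod (x - w) \<le> (cmod (f x) + cmod (f w)) / \<delta>"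
        using d \<delta> by (intro frac_le norm_triangle_ineq4) auto
      then show ?thesis using x d gx K(1) by (simp add: diff_quot_def norm_divide)
    qed
  qed simp
qed (simp add: diff_quot_outside)

lemma holomorphic_eq_off_point:
  assumes "f holomorphic_on unit_disk" "g holomorphic_on unit_disk"
    and eq: "\<And>x. x \<in> unit_disk \<Longrightarrow> x \<noteq> w \<Longrightarrow> f x = g x" and x: "x \<in> unit_disk"
  shows "f x = g x"
proof (cases "x = w")
  case True
  have "(\<lambda>x. f x - g x) holomorphic_on unit_disk" by (intro holomorphic_intros assms)
  then have "isCont (\<lambda>x. f x - g x) w"
    using x True holomorphic_on_imp_continuous_on continuous_on_eq_continuous_at open_ball by blast
  then have "(\<lambda>x. f x - g x) \<midarrow>w\<rightarrow> f w - g w" by (simp add: isCont_def)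
  moreover have "\<forall>\<^sub>F x in at w. f x - g x = 0"
    using eventually_at_in_open'[of unit_disk w] x True eq
    by (auto simp: eventually_at_filter elim!: eventually_mono)
  ultimately have "(\<lambda>x. 0) \<midarrow>w\<rightarrow> f w - g w" by (subst (asm) tendsto_cong) auto
  then have "f w - g w = 0" using tendsto_const_iff[of "at w"] by (simp add: tendsto_const_iff)
  then show ?thesis using True by simp
qed (use x eq in auto)

text \<open>The recursion of divided differences. It shows how the quotient varies with its node:
  the increment from \<open>u\<close> to \<open>w\<close> is \<open>w - u\<close> times another
  quotient.\<close>

lemma diff_quot_resolvent:
  assumes f: "f holomorphic_on unit_disk" and w: "w \<in> unit_disk" "u \<in> unit_disk" and x: "x \<in> unit_disk"
  shows "diff_quot f w x - diff_quot f u x = (w - u) * diff_quot (diff_quot f u) w x"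
proof (rule holomorphic_eq_off_point[OF _ _ _ x])
  show "(\<lambda>x. diff_quot f w x - diff_quot f u x) holomorphic_on unit_disk"
    by (intro holomorphic_on_diff diff_quot_holomorphic f w)
  show "(\<lambda>x. (w - u) * diff_quot (diff_quot f u) w x) holomorphic_on unit_disk"
    by (intro holomorphic_on_mult holomorphic_on_const diff_quot_holomorphic f w)
  fix x assume x: "x \<in> unit_disk" "x \<noteq> w"
  have "(x - w) * (diff_quot f w x - diff_quot f u x)
      = (x - w) * diff_quot f w x - (x - u) * diff_quot f u x + (w - u) * diff_quot f u x"
    by (simp add: algebra_simps)
  also have "\<dots> = (w - u) * diff_quot f u x - (f w - f u)" using x by (simp add: diff_quot_mult)
  also have "f w - f u = (w - u) * diff_quot f u w" using w by (simp add: diff_quot_mult)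
  also have "(w - u) * diff_quot f u x - (w - u) * diff_quot f u w
      = (w - u) * ((x - w) * diff_quot (diff_quot f u) w x)"
    using x diff_quot_mult[of x w "diff_quot f u"] by (simp add: right_diff_distrib)
  also have "\<dots> = (x - w) * ((w - u) * diff_quot (diff_quot f u) w x)" by simp
  finally show "diff_quot f w x - diff_quot f u x = (w - u) * diff_quot (diff_quot f u) w x"
    using x by simp
qed

section \<open>Localization at a point of a fibre\<close>

lemma fsigma_unit_disk: "fsigma unit_disk"
proof -
  have "unit_disk = (\<Union>n::nat. cball 0 (1 - 1 / real (Suc n)))"
  proof (intro equalityI subsetI)
    fix x :: complex assume "x \<in> unit_disk"
    then obtain n where "1 / real (Suc n) < 1 - cmod x"
      using reals_Archimedean[of "1 - cmod x"] by (auto simp: inverse_eq_divide)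
    then have "x \<in> cball 0 (1 - 1 / real (Suc n))" by simp
    then show "x \<in> (\<Union>n::nat. cball 0 (1 - 1 / real (Suc n)))" by blast
  next
    fix x :: complex assume "x \<in> (\<Union>n::nat. cball 0 (1 - 1 / real (Suc n)))"
    then obtain n where "cmod x \<le> 1 - 1 / real (Suc n)" by auto
    moreover have "1 / real (Suc n) > 0" by simp
    ultimately have "cmod x < 1" by linarith
    then show "x \<in> unit_disk" by simp
  qed
  then show ?thesis using fsigma.intros[of "\<lambda>n. cball 0 (1 - 1 / real (Suc n))"] by simp
qed

lemma set_integrable_bounded:
  fixes G :: "complex \<Rightarrow> complex"
  assumes "continuous_on unit_disk G" "A \<in> sets borel" "A \<subseteq> unit_disk" "\<And>x. x \<in> A \<Longrightarrow> cmod (G x) \<le> C"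
  shows "set_integrable area_measure A G" "cmod (LINT x:A|area_measure. G x) \<le> C * measure area_measure A"
proof -
  have [measurable]: "A \<in> sets borel" by fact
  have "(\<lambda>x. if x \<in> unit_disk then G x else 0) \<in> borel_measurable borel"
    using assms by (intro borel_measurable_continuous_on_if) auto
  then have m: "(\<lambda>x. indicator A x *\<^sub>R (if x \<in> unit_disk then G x else 0)) \<in> borel_measurable borel"
    by measurable
  have eq: "(\<lambda>x. indicator A x *\<^sub>R (if x \<in> unit_disk then G x else 0)) = (\<lambda>x. indicator A x *\<^sub>R G x)"
    using assms by (auto simp: indicator_def fun_eq_iff)
  have iA: "integrable area_measure (\<lambda>x. indicator A x *\<^sub>R C)"
    by (rule integrable_mult_indicator) auto
  show i: "set_integrable area_measure A G"
    unfolding set_integrable_def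
  proof (rule Bochner_Integration.integrable_bound[OF iA])
    show "(\<lambda>x. indicator A x *\<^sub>R G x) \<in> borel_measurable area_measure" using m eq by simp
    show "AE x in area_measure. norm (indicator A x *\<^sub>R G x) \<le> norm (indicator A x *\<^sub>R C)"
      using assms(4) by (intro AE_I2) (auto simp: indicator_def intro: order_trans[OF _ abs_ge_self])
  qed
  have "cmod (LINT x:A|area_measure. G x) \<le> (LINT x:A|area_measure. cmod (G x))"
    by (rule set_integral_norm_bound[OF i])
  also have "\<dots> \<le> (LINT x:A|area_measure. C)"
    using assms(4) by (intro set_integral_mono set_integrable_norm i) (use iA in \<open>auto simp: set_integrable_def\<close>)
  also have "\<dots> = C * measure area_measure A"
    by (simp add: set_lebesgue_integral_def mult.commute)
  finally show "cmod (LINT x:A|area_measure. G x) \<le> C * measure area_measure A" .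
qed

context bounded_symbol
begin

lemma B_holomorphic: "B holomorphic_on unit_disk"
  using B_bergman by (rule bergman_holomorphic)

lemma symbol_derivative:
  assumes "z \<in> unit_disk"
  shows "(B has_field_derivative deriv B z) (at z)"
  by (rule holomorphic_derivI[OF B_holomorphic open_ball assms])

lemma symbol_linear_bounds:
  assumes z: "z \<in> unit_disk" and \<eta>: "\<eta> > 0"
  obtains \<delta> where "\<delta> > 0" "ball z \<delta> \<subseteq> unit_disk"
    "\<And>x. x \<in> ball z \<delta> \<Longrightarrow> (cmod (deriv B z) - \<eta>) * cmod (x - z) \<le> cmod (B x - B z)"
    "\<And>x. x \<in> ball z \<delta> \<Longrightarrow> cmod (B x - B z) \<le> (cmod (deriv B z) + \<eta>) * cmod (x - z)"
proof -
  have "(B has_derivative (*) (deriv B z)) (at z)"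
    using symbol_derivative[OF z] by (simp add: has_field_derivative_def)
  then obtain d where d: "d > 0" "\<And>y. cmod (y - z) < d \<Longrightarrow> cmod (B y - B z - deriv B z * (y - z)) \<le> \<eta> * cmod (y - z)"
    unfolding has_derivative_at_alt using \<eta> by blast
  obtain d' where d': "d' > 0" "ball z d' \<subseteq> unit_disk" using z openE[OF open_ball] by blast
  show thesis
  proof (rule that[of "min d d'"])
    fix x assume "x \<in> ball z (min d d')"
    then have *: "cmod (B x - B z - deriv B z * (x - z)) \<le> \<eta> * cmod (x - z)"
      by (intro d) (simp add: dist_norm norm_minus_commute)
    show "(cmod (deriv B z) - \<eta>) * cmod (x - z) \<le> cmod (B x - B z)"
      using * norm_triangle_sub[of "deriv B z * (x - z)" "B x - B z"]
      unfolding left_diff_distrib norm_mult[symmetric] norm_minus_commute[of "deriv B z * (x - z)"] by linarith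
    show "cmod (B x - B z) \<le> (cmod (deriv B z) + \<eta>) * cmod (x - z)"
      using * norm_triangle_sub[of "B x - B z" "deriv B z * (x - z)"]
      unfolding distrib_right norm_mult[symmetric] by linarith
  qed (use d d' in auto)
qed

text \<open>Near \<open>z\<close> the level set lies between the disks of radius
  \<open>e / (b + \<eta>)\<close> and \<open>e / (b - \<eta>)\<close>, where \<open>b\<close> is the
  modulus of the derivative, and a disk of radius \<open>d\<close> inside the unit disk has
  normalized area \<open>d\<^sup>2\<close>. The lower bound on \<open>cmod (B x - B z)\<close> keeps
  other points of the fibre out of the ball.\<close>

lemma level_set_area:
  assumes z: "z \<in> unit_disk" "deriv B z \<noteq> 0"
  shows "\<exists>\<delta>>0. ball z \<delta> \<subseteq> unit_disk \<and>
    (\<forall>x\<in>ball z \<delta>. cmod (deriv B z) / 2 * cmod (x - z) \<le> cmod (B x - B z)) \<and>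
    (\<forall>d. 0 < d \<longrightarrow> d \<le> \<delta> \<longrightarrow>
      ((\<lambda>e. measure area_measure (level_set (B z) e \<inter> ball z d) / e\<^sup>2) \<longlongrightarrow> 1 / (cmod (deriv B z))\<^sup>2) (at_right 0))"
proof -
  define b where "b = cmod (deriv B z)"
  have b: "b > 0" using z by (simp add: b_def)
  obtain \<delta> where \<delta>: "\<delta> > 0" "ball z \<delta> \<subseteq> unit_disk"
    "\<And>x. x \<in> ball z \<delta> \<Longrightarrow> (b - b / 2) * cmod (x - z) \<le> cmod (B x - B z)"
    using symbol_linear_bounds[OF z(1), of "b / 2"] b unfolding b_def by (metis half_gt_zero)
  have bnds: "\<forall>\<^sub>F e in at_right 0. 1 / (b + \<eta>)\<^sup>2 \<le> measure area_measure (level_set (B z) e \<inter> ball z d) / e\<^sup>2 \<and>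
      measure area_measure (level_set (B z) e \<inter> ball z d) / e\<^sup>2 \<le> 1 / (b - \<eta>)\<^sup>2"
    if \<eta>: "0 < \<eta>" "\<eta> < b" and d: "0 < d" "d \<le> \<delta>" for \<eta> d
  proof -
    obtain r where r: "r > 0" "ball z r \<subseteq> unit_disk"
      "\<And>x. x \<in> ball z r \<Longrightarrow> (b - \<eta>) * cmod (x - z) \<le> cmod (B x - B z)"
      "\<And>x. x \<in> ball z r \<Longrightarrow> cmod (B x - B z) \<le> (b + \<eta>) * cmod (x - z)"
      using symbol_linear_bounds[OF z(1) \<eta>(1)] unfolding b_def by metis
    \<comment> \<open>The first bound keeps both comparison disks inside \<open>ball z r\<close>,
      the second puts the inner one into \<open>ball z d\<close>, and the third brings the points of
      the level set from \<open>ball z d\<close> into \<open>ball z r\<close>, where the sharper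
      estimates hold.\<close>
    define e0 where "e0 = min (min (r * (b - \<eta>)) (d * (b + \<eta>))) (r * b / 2)"
    have "e0 > 0" using r \<eta> d b by (simp add: e0_def)
    then have "\<forall>\<^sub>F e in at_right 0. e \<in> {0<..<e0}"
      by (rule eventually_at_right_real)
    then show ?thesis
    proof eventually_elim
      case (elim e)
      then have e: "e > 0" "e < r * (b - \<eta>)" "e < d * (b + \<eta>)" "e < r * b / 2" by (auto simp: e0_def)
      have sub1: "ball z (e / (b + \<eta>)) \<subseteq> level_set (B z) e \<inter> ball z d"
      proof
        fix x assume "x \<in> ball z (e / (b + \<eta>))"
        then have x: "cmod (x - z) < e / (b + \<eta>)" by (simp add: dist_norm norm_minus_commute)
        have "e / (b + \<eta>) < d" using e b \<eta> by (simp add: pos_divide_less_eq)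
        moreover have "e / (b + \<eta>) < r"
        proof -
          have "r * (b - \<eta>) \<le> r * (b + \<eta>)" using r(1) \<eta> by (intro mult_left_mono) auto
          then show ?thesis using e b \<eta> by (simp add: pos_divide_less_eq)
        qed
        ultimately have xr: "x \<in> ball z r" "x \<in> ball z d" using x by (auto simp: dist_norm norm_minus_commute)
        have "cmod (B x - B z) < e"
          using r(4)[OF xr(1)] x b \<eta> by (simp add: pos_less_divide_eq mult.commute)
        then show "x \<in> level_set (B z) e \<inter> ball z d" using xr r(2) by (auto simp: level_set_def)
      qed
      have sub2: "level_set (B z) e \<inter> ball z d \<subseteq> ball z (e / (b - \<eta>))"
      proof
        fix x assume x: "x \<in> level_set (B z) e \<inter> ball z d"
        then have "(b - b / 2) * cmod (x - z) < e" using \<delta>(3)[of x] d by (auto simp: level_set_def)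
        then have "cmod (x - z) * b < r * b" using e by (simp add: algebra_simps)
        then have "x \<in> ball z r" using b by (simp add: dist_norm norm_minus_commute)
        from r(3)[OF this] x have "(b - \<eta>) * cmod (x - z) < e" by (auto simp: level_set_def)
        then show "x \<in> ball z (e / (b - \<eta>))"
          using \<eta> by (simp add: dist_norm norm_minus_commute pos_less_divide_eq mult.commute)
      qed
      have sub3: "ball z (e / (b - \<eta>)) \<subseteq> unit_disk"
      proof -
        have "e / (b - \<eta>) \<le> r" using e \<eta> by (simp add: pos_divide_le_eq)
        then show ?thesis using r(2) subset_ball by blast
      qed
      have sub4: "ball z (e / (b + \<eta>)) \<subseteq> unit_disk" using sub1 by (auto simp: level_set_def)
      have [measurable]: "ball z d \<in> sets borel" by simp
      have "measure area_measure (ball z (e / (b + \<eta>))) \<le> measure area_measure (level_set (B z) e \<inter> ball z d)"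
        by (intro area.finite_measure_mono sub1) (simp add: level_set_borel)
      moreover have "measure area_measure (level_set (B z) e \<inter> ball z d) \<le> measure area_measure (ball z (e / (b - \<eta>)))"
        by (intro area.finite_measure_mono sub2) simp
      ultimately have "(e / (b + \<eta>))\<^sup>2 \<le> measure area_measure (level_set (B z) e \<inter> ball z d)"
        "measure area_measure (level_set (B z) e \<inter> ball z d) \<le> (e / (b - \<eta>))\<^sup>2"
        using measure_ball_area[OF sub3] measure_ball_area[OF sub4] e b \<eta> by simp_all
      then show ?case
        using e b \<eta> by (simp add: power_divide divide_simps mult.commute)
    qed
  qed
  have "((\<lambda>e. measure area_measure (level_set (B z) e \<inter> ball z d) / e\<^sup>2) \<longlongrightarrow> 1 / b\<^sup>2) (at_right 0)"
    if d: "0 < d" "d \<le> \<delta>" for d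
  proof (rule order_tendstoI)
    have ev: "\<forall>\<^sub>F \<eta> in at_right 0. \<eta> \<in> {0<..<b}" by (rule eventually_at_right_real[OF b])
    fix a assume a: "a < 1 / b\<^sup>2"
    have "((\<lambda>\<eta>. 1 / (b + \<eta>)\<^sup>2) \<longlongrightarrow> 1 / (b + 0)\<^sup>2) (at_right 0)"
      using b by (intro tendsto_intros) auto
    then have "\<forall>\<^sub>F \<eta> in at_right 0. a < 1 / (b + \<eta>)\<^sup>2" using a by (intro order_tendstoD(1)) auto
    from eventually_happens'[OF _ eventually_conj[OF this ev]] obtain \<eta> where "a < 1 / (b + \<eta>)\<^sup>2" "0 < \<eta>" "\<eta> < b" by auto
    with bnds[of \<eta> d] d show "\<forall>\<^sub>F e in at_right 0. a < measure area_measure (level_set (B z) e \<inter> ball z d) / e\<^sup>2"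
      by (auto elim!: eventually_mono)
  next
    have ev: "\<forall>\<^sub>F \<eta> in at_right 0. \<eta> \<in> {0<..<b}" by (rule eventually_at_right_real[OF b])
    fix a assume a: "1 / b\<^sup>2 < a"
    have "((\<lambda>\<eta>. 1 / (b - \<eta>)\<^sup>2) \<longlongrightarrow> 1 / (b - 0)\<^sup>2) (at_right 0)"
      using b by (intro tendsto_intros) auto
    then have "\<forall>\<^sub>F \<eta> in at_right 0. 1 / (b - \<eta>)\<^sup>2 < a" using a by (intro order_tendstoD(2)) auto
    from eventually_happens'[OF _ eventually_conj[OF this ev]] obtain \<eta> where "1 / (b - \<eta>)\<^sup>2 < a" "0 < \<eta>" "\<eta> < b" by auto
    with bnds[of \<eta> d] d show "\<forall>\<^sub>F e in at_right 0. measure area_measure (level_set (B z) e \<inter> ball z d) / e\<^sup>2 < a"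
      by (auto elim!: eventually_mono)
  qed
  with \<delta> show ?thesis by (intro exI[of _ \<delta>]) (auto simp: b_def[symmetric])
qed

text \<open>The part of the level set in the ball shrinks to \<open>z\<close>, so that a continuous
  integrand may be replaced by its value at \<open>z\<close>.\<close>

lemma level_set_average:
  assumes z: "z \<in> unit_disk" "deriv B z \<noteq> 0"
  shows "\<exists>\<delta>>0. ball z \<delta> \<subseteq> unit_disk \<and>
    (\<forall>x\<in>ball z \<delta>. cmod (deriv B z) / 2 * cmod (x - z) \<le> cmod (B x - B z)) \<and>
    (\<forall>d (G :: complex \<Rightarrow> complex). 0 < d \<longrightarrow> d \<le> \<delta> \<longrightarrow> continuous_on unit_disk G \<longrightarrow>
      ((\<lambda>e. (LINT x:level_set (B z) e \<inter> ball z d|area_measure. G x) / e\<^sup>2)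
         \<longlongrightarrow> (G z / (cmod (deriv B z))\<^sup>2 :: complex)) (at_right 0))"
proof -
  define b where "b = cmod (deriv B z)"
  have b: "b > 0" using z by (simp add: b_def)
  obtain \<delta> where \<delta>: "\<delta> > 0" "ball z \<delta> \<subseteq> unit_disk"
    "\<And>x. x \<in> ball z \<delta> \<Longrightarrow> b / 2 * cmod (x - z) \<le> cmod (B x - B z)"
    "\<And>d. 0 < d \<Longrightarrow> d \<le> \<delta> \<Longrightarrow>
      ((\<lambda>e. measure area_measure (level_set (B z) e \<inter> ball z d) / e\<^sup>2) \<longlongrightarrow> 1 / b\<^sup>2) (at_right 0)"
    using level_set_area[OF z] unfolding b_def by auto
  have "((\<lambda>e. (LINT x:level_set (B z) e \<inter> ball z d|area_measure. G x) / e\<^sup>2) \<longlongrightarrow> G z / b\<^sup>2) (at_right 0)"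
    if d: "0 < d" "d \<le> \<delta>" and G: "continuous_on unit_disk G" for d and G :: "complex \<Rightarrow> complex"
  proof -
    define A where "A e = level_set (B z) e \<inter> ball z d" for e
    define m where "m e = measure area_measure (A e) / e\<^sup>2" for e
    have mlim: "(m \<longlongrightarrow> 1 / b\<^sup>2) (at_right 0)"
      using \<delta>(4)[OF d] by (simp add: m_def[abs_def] A_def)
    have Ab: "A e \<in> sets borel" "A e \<subseteq> unit_disk" for e
      by (auto simp: A_def level_set_borel) (auto simp: level_set_def)
    have m0: "m e \<ge> 0" for e by (simp add: m_def)
    have "((\<lambda>e. (LINT x:A e|area_measure. G x) / e\<^sup>2 - G z * of_real (m e)) \<longlongrightarrow> 0) (at_right 0)"
    proof (rule tendstoI)
      fix \<epsilon> :: real assume \<epsilon>: "\<epsilon> > 0"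
      define k where "k = 1 / b\<^sup>2 + 1"
      define \<eta> where "\<eta> = \<epsilon> / (2 * k)"
      have b2: "k > 0" by (simp add: k_def add_nonneg_pos)
      have \<eta>: "\<eta> > 0" using \<epsilon> b2 by (simp add: \<eta>_def)
      have "continuous (at z) G" using G z(1) by (simp add: continuous_on_eq_continuous_at)
      then obtain r where r: "r > 0" "\<And>x. cmod (x - z) < r \<Longrightarrow> cmod (G x - G z) < \<eta>"
        using \<eta> unfolding continuous_at_eps_delta dist_norm by blast
      have "\<forall>\<^sub>F e in at_right 0. m e < 1 / b\<^sup>2 + 1" using mlim by (intro order_tendstoD(2)) auto
      moreover have "\<forall>\<^sub>F e in at_right 0. e \<in> {0<..<r * b / 2}"
        using r b by (intro eventually_at_right_real) auto
      ultimately show "\<forall>\<^sub>F e in at_right 0. dist ((LINT x:A e|area_measure. G x) / e\<^sup>2 - G z * of_real (m e)) 0 < \<epsilon>"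
      proof eventually_elim
        case (elim e)
        have e: "e > 0" "e < r * b / 2" using elim by auto
        have near: "cmod (G x - G z) \<le> \<eta>" if "x \<in> A e" for x
        proof -
          have "b / 2 * cmod (x - z) < e" using that \<delta>(3)[of x] d by (auto simp: A_def level_set_def)
          then have "cmod (x - z) * b < r * b" using e by (simp add: algebra_simps)
          then show ?thesis using r(2)[of x] b by (simp add: less_imp_le)
        qed
        have "continuous_on unit_disk (\<lambda>x. G x - G z)" by (intro continuous_intros G)
        note bd = set_integrable_bounded[OF this Ab[of e] near]
        note cst = set_integrable_bounded[OF continuous_on_const Ab[of e] order_refl, of "G z"]
        have "(LINT x:A e|area_measure. G x) = (LINT x:A e|area_measure. (G x - G z) + G z)" by simp
        also have "\<dots> = (LINT x:A e|area_measure. G x - G z) + (LINT x:A e|area_measure. G z)"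
          by (rule set_integral_add(2)[OF bd(1) cst(1)])
        also have "(LINT x:A e|area_measure. G z) = G z * of_real (measure area_measure (A e))"
          using Ab(1)[of e] by (simp add: set_lebesgue_integral_def scaleR_conv_of_real mult.commute)
        finally have "(LINT x:A e|area_measure. G x) / e\<^sup>2 - G z * of_real (m e) = (LINT x:A e|area_measure. G x - G z) / e\<^sup>2"
          using e by (simp add: m_def field_simps)
        also have "cmod \<dots> \<le> \<eta> * m e"
          using bd(2) e by (simp add: norm_divide m_def divide_right_mono norm_power)
        also have "\<dots> \<le> \<eta> * k" using elim \<eta> by (intro mult_left_mono) (auto simp: k_def)
        also have "\<dots> = \<epsilon> / 2" using b2 by (simp add: \<eta>_def)
        also have "\<dots> < \<epsilon>" using \<epsilon> by simp
        finally show ?case by simp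
      qed
    qed
    moreover have "((\<lambda>e. G z * of_real (m e)) \<longlongrightarrow> G z * of_real (1 / b\<^sup>2)) (at_right 0)"
      by (intro tendsto_intros mlim)
    ultimately have "((\<lambda>e. ((LINT x:A e|area_measure. G x) / e\<^sup>2 - G z * of_real (m e)) + G z * of_real (m e))
       \<longlongrightarrow> 0 + G z * of_real (1 / b\<^sup>2)) (at_right 0)"
      by (rule tendsto_add)
    then show ?thesis by (simp add: A_def)
  qed
  with \<delta> show ?thesis by (intro exI[of _ \<delta>]) (auto simp: b_def[symmetric])
qed

lemma symbol_not_constant:
  assumes "z \<in> unit_disk" "deriv B z \<noteq> 0"
  shows "\<not> (\<lambda>x. B x - c) constant_on unit_disk"
proof
  assume "(\<lambda>x. B x - c) constant_on unit_disk"
  then obtain k where "\<And>x. x \<in> unit_disk \<Longrightarrow> B x = k" unfolding constant_on_def by (metis diff_add_cancel)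
  then have "deriv B z = deriv (\<lambda>_. k) z"
    using assms(1) by (intro deriv_cong_ev eventually_mono[OF eventually_nhds_in_open[OF open_ball assms(1)]]) auto
  with assms show False by simp
qed

lemma symbol_AE_neq:
  assumes "z \<in> unit_disk" "deriv B z \<noteq> 0"
  shows "AE x in area_measure. \<not> (x \<in> unit_disk \<and> B x - c = 0)"
proof -
  have "countable {x \<in> unit_disk. B x - c = 0}"
    by (rule holomorphic_countable_zeros[OF _ _ _ fsigma_unit_disk symbol_not_constant[OF assms]])
      (auto intro!: holomorphic_intros B_holomorphic)
  then have "{x \<in> unit_disk. B x - c = 0} \<in> null_sets lborel" by (rule countable_imp_null_set_lborel)
  from AE_not_in[OF this] show ?thesis unfolding AE_area_measure by eventually_elim auto
qed

text \<open>The level sets decrease to the zeros of \<open>B - c\<close>, a countable and hence null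
  set, because \<open>B\<close> is not constant.\<close>

lemma level_set_measure_tendsto_0:
  assumes z: "z \<in> unit_disk" "deriv B z \<noteq> 0"
  shows "((\<lambda>e. measure area_measure (level_set c e)) \<longlongrightarrow> 0) (at_right 0)"
proof -
  define A where "A n = level_set c (1 / real (Suc n))" for n
  have A: "(\<Inter>n. A n) = {x \<in> unit_disk. B x - c = 0}"
  proof (intro equalityI subsetI)
    fix x assume x: "x \<in> (\<Inter>n. A n)"
    have "cmod (B x - c) \<le> 0"
    proof (rule ccontr)
      assume "\<not> cmod (B x - c) \<le> 0"
      then obtain n where "1 / real (Suc n) < cmod (B x - c)"
        using reals_Archimedean[of "cmod (B x - c)"] by (auto simp: inverse_eq_divide)
      moreover have "cmod (B x - c) < 1 / real (Suc n)" using x by (auto simp: A_def level_set_def)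
      ultimately show False by simp
    qed
    then show "x \<in> {x \<in> unit_disk. B x - c = 0}" using x by (auto simp: A_def level_set_def)
  qed (auto simp: A_def level_set_def)
  then have ae: "AE x in area_measure. x \<notin> (\<Inter>n. A n)"
    using symbol_AE_neq[OF z, of c] by simp
  have Am: "A n \<in> sets area_measure" for n by (simp add: A_def level_set_borel)
  then have "(\<Inter>n. A n) \<in> sets area_measure" by (intro sets.countable_INT) auto
  then have "(\<Inter>n. A n) \<in> null_sets area_measure" using AE_iff_null_sets ae by blast
  then have "measure area_measure (\<Inter>n. A n) = 0"
    by (simp add: null_sets_def measure_def)
  moreover have "(\<lambda>n. measure area_measure (A n)) \<longlonglongrightarrow> measure area_measure (\<Inter>n. A n)"
  proof (rule area.finite_Lim_measure_decseq)
    show "range A \<subseteq> sets area_measure" using Am by auto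
    show "decseq A"
    proof (rule decseq_SucI)
      fix n
      have "1 / real (Suc (Suc n)) \<le> 1 / real (Suc n)" by (simp add: frac_le)
      then show "A (Suc n) \<subseteq> A n" unfolding A_def level_set_def by auto
    qed
  qed
  ultimately have lim: "(\<lambda>n. measure area_measure (A n)) \<longlonglongrightarrow> 0" by simp
  show ?thesis
  proof (rule tendstoI)
    fix \<epsilon> :: real assume "\<epsilon> > 0"
    then obtain n where n: "measure area_measure (A n) < \<epsilon>"
      using order_tendstoD(2)[OF lim] by (metis eventually_happens trivial_limit_sequentially)
    have "\<forall>\<^sub>F e in at_right 0. e \<in> {0<..<1 / real (Suc n)}"
      by (rule eventually_at_right_real) simp
    then show "\<forall>\<^sub>F e in at_right 0. dist (measure area_measure (level_set c e)) 0 < \<epsilon>"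
    proof eventually_elim
      case (elim e)
      have "measure area_measure (level_set c e) \<le> measure area_measure (A n)"
        using elim by (intro area.finite_measure_mono Am) (auto simp: A_def level_set_def)
      with n show ?case by simp
    qed
  qed
qed

end

section \<open>Pairings with difference quotients over shrinking level sets\<close>

lemma set_integral_mono_set:
  assumes "f \<in> bergman_space" "A \<in> sets borel" "A' \<in> sets borel" "A \<subseteq> A'"
  shows "(LINT x:A|area_measure. (cmod (f x))\<^sup>2) \<le> (LINT x:A'|area_measure. (cmod (f x))\<^sup>2)"
  using set_integrable_sq[OF assms(1,2)] set_integrable_sq[OF assms(1,3)] assms(4)
  unfolding set_integrable_def set_lebesgue_integral_def
  by (intro integral_mono) (auto simp: indicator_def)

lemma set_integral_sq_complex:
  "complex_of_real (LINT x:A|area_measure. (cmod (f x))\<^sup>2) = (LINT x:A|area_measure. f x * cnj (f x))"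
  unfolding set_lebesgue_integral_def
  by (subst integral_complex_of_real[symmetric]) (simp add: complex_norm_square[symmetric] scaleR_conv_of_real)

text \<open>A form of the Cauchy-Schwarz inequality with a free weight \<open>s\<close>: a small
  second integral can be played off against a first one that is merely bounded.\<close>

lemma set_integral_mult_cnj_le:
  assumes f: "f \<in> bergman_space" and g: "g \<in> bergman_space" and A: "A \<in> sets borel" and s: "s > 0"
  shows "cmod (LINT x:A|area_measure. f x * cnj (g x))
     \<le> s * (LINT x:A|area_measure. (cmod (f x))\<^sup>2) + (LINT x:A|area_measure. (cmod (g x))\<^sup>2) / s"
proof -
  have "cmod (LINT x:A|area_measure. f x * cnj (g x)) \<le> (LINT x:A|area_measure. cmod (f x * cnj (g x)))"
    by (intro set_integral_norm_bound set_integrable_mult_cnj assms)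
  also have "\<dots> \<le> (LINT x:A|area_measure. s * (cmod (f x))\<^sup>2 + (cmod (g x))\<^sup>2 / s)"
  proof (rule set_integral_mono)
    show "set_integrable area_measure A (\<lambda>x. cmod (f x * cnj (g x)))"
      by (intro set_integrable_norm set_integrable_mult_cnj assms)
    show "set_integrable area_measure A (\<lambda>x. s * (cmod (f x))\<^sup>2 + (cmod (g x))\<^sup>2 / s)"
      by (intro set_integral_add(1) set_integrable_divide set_integrable_mult_right set_integrable_sq assms)
    show "cmod (f x * cnj (g x)) \<le> s * (cmod (f x))\<^sup>2 + (cmod (g x))\<^sup>2 / s" for x
    proof -
      have "0 \<le> (s * cmod (f x) - cmod (g x))\<^sup>2 / s + cmod (f x) * cmod (g x)" using s by simp
      also have "\<dots> = s * (cmod (f x))\<^sup>2 + (cmod (g x))\<^sup>2 / s - cmod (f x) * cmod (g x)"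
        using s by (simp add: field_simps power2_eq_square)
      finally show ?thesis by (simp add: norm_mult)
    qed
  qed
  also have "\<dots> = s * (LINT x:A|area_measure. (cmod (f x))\<^sup>2) + (LINT x:A|area_measure. (cmod (g x))\<^sup>2) / s"
    by (subst set_integral_add(2))
      (auto intro!: set_integrable_divide set_integrable_mult_right set_integrable_sq assms)
  finally show ?thesis .
qed

context bounded_symbol
begin

lemma diff_quot_continuous: "w \<in> unit_disk \<Longrightarrow> continuous_on unit_disk (diff_quot B w)"
  by (intro holomorphic_on_imp_continuous_on diff_quot_holomorphic B_holomorphic)

lemma diff_quot_off_ball:
  assumes "x \<in> level_set (B z) e" "x \<notin> ball z d" "d > 0"
  shows "cmod (diff_quot B z x) \<le> e / d"
proof -
  have x: "x \<in> unit_disk" "cmod (B x - B z) < e" "cmod (x - z) \<ge> d"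
    using assms by (auto simp: level_set_def dist_norm norm_minus_commute)
  then have "x \<noteq> z" using assms by auto
  moreover have "cmod (B x - B z) / cmod (x - z) \<le> e / d"
    using x assms norm_ge_zero[of "B x - B z"] by (intro frac_le) linarith+
  ultimately show ?thesis using x by (simp add: diff_quot_def norm_divide)
qed

text \<open>The rate \<open>e\<^sup>2\<close> is that of the area near a single regular point of the
  fibre. As the level set may come close to infinitely many such points, the bound is a genuine
  condition on \<open>f\<close>.\<close>

definition level_bounded :: "complex \<Rightarrow> (complex \<Rightarrow> complex) \<Rightarrow> real \<Rightarrow> bool" where
  "level_bounded c f C \<longleftrightarrow> (\<forall>\<^sub>F e in at_right 0. (LINT x:level_set c e|area_measure. (cmod (f x))\<^sup>2) \<le> C * e\<^sup>2)"

text \<open>Since the measure of the level set tends to 0, this is of smaller order than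
  \<open>e\<^sup>2\<close>.\<close>

lemma set_integral_sq_off_ball:
  assumes z: "z \<in> unit_disk" and d: "d > 0" and e: "e > 0"
  shows "(LINT x:level_set (B z) e - ball z d|area_measure. (cmod (diff_quot B z x))\<^sup>2)
     \<le> e\<^sup>2 / d\<^sup>2 * measure area_measure (level_set (B z) e)"
proof -
  let ?A = "level_set (B z) e - ball z d"
  have A: "?A \<in> sets borel" using level_set_borel by simp
  have b: "diff_quot B z \<in> bergman_space" by (rule diff_quot_bergman[OF B_bergman z])
  have "(LINT x:?A|area_measure. (cmod (diff_quot B z x))\<^sup>2) \<le> (LINT x:?A|area_measure. e\<^sup>2 / d\<^sup>2)"
  proof (rule set_integral_mono)
    show "set_integrable area_measure ?A (\<lambda>x. (cmod (diff_quot B z x))\<^sup>2)" by (rule set_integrable_sq[OF b A])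
    show "set_integrable area_measure ?A (\<lambda>x. e\<^sup>2 / d\<^sup>2)"
      unfolding set_integrable_def using A by (intro integrable_mult_indicator) auto
    show "(cmod (diff_quot B z x))\<^sup>2 \<le> e\<^sup>2 / d\<^sup>2" if "x \<in> ?A" for x
      using that diff_quot_off_ball[of x z e d] d by (simp add: power_divide[symmetric] power_mono)
  qed
  also have "\<dots> = e\<^sup>2 / d\<^sup>2 * measure area_measure ?A"
    by (simp add: set_lebesgue_integral_def)
  also have "\<dots> \<le> e\<^sup>2 / d\<^sup>2 * measure area_measure (level_set (B z) e)"
    by (intro mult_left_mono area.finite_measure_mono) (auto simp: level_set_borel)
  finally show ?thesis .
qed

text \<open>Inside a small ball about \<open>w\<close> the mass divided by \<open>e\<^sup>2\<close>
  converges, and outside it the quotient itself is of order \<open>e\<close>.\<close>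

lemma diff_quot_level_bounded:
  assumes w: "w \<in> unit_disk" "deriv B w \<noteq> 0"
  obtains C where "level_bounded (B w) (diff_quot B w) C"
proof -
  let ?f = "diff_quot B w"
  from level_set_average[OF w] obtain \<delta> where \<delta>: "\<delta> > 0" "ball w \<delta> \<subseteq> unit_disk"
    and avg: "\<forall>d (G :: complex \<Rightarrow> complex). 0 < d \<longrightarrow> d \<le> \<delta> \<longrightarrow> continuous_on unit_disk G \<longrightarrow>
      ((\<lambda>e. (LINT x:level_set (B w) e \<inter> ball w d|area_measure. G x) / e\<^sup>2)
         \<longlongrightarrow> (G w / (cmod (deriv B w))\<^sup>2)) (at_right 0)"
    by (elim exE conjE) (rule that)
  have fb: "?f \<in> bergman_space" by (rule diff_quot_bergman[OF B_bergman w(1)])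
  define l where "l = ?f w * cnj (?f w) / (cmod (deriv B w))\<^sup>2"
  have "((\<lambda>e. (LINT x:level_set (B w) e \<inter> ball w \<delta>|area_measure. ?f x * cnj (?f x)) / e\<^sup>2) \<longlongrightarrow> l) (at_right 0)"
  proof -
    have "continuous_on unit_disk (\<lambda>x. ?f x * cnj (?f x))"
      by (intro continuous_on_mult continuous_on_cnj diff_quot_continuous w)
    from avg[rule_format, OF \<delta>(1) order_refl this] show ?thesis by (simp add: l_def)
  qed
  then have "\<forall>\<^sub>F e in at_right 0. cmod ((LINT x:level_set (B w) e \<inter> ball w \<delta>|area_measure. ?f x * cnj (?f x)) / e\<^sup>2) < cmod l + 1"
    by (intro order_tendstoD(2)[OF tendsto_norm]) auto
  moreover have "\<forall>\<^sub>F e in at_right 0. e \<in> {0<..<(1::real)}" by (rule eventually_at_right_real) simp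
  ultimately have "level_bounded (B w) ?f (cmod l + 1 + measure area_measure UNIV / \<delta>\<^sup>2)"
    unfolding level_bounded_def
  proof eventually_elim
    case (elim e)
    let ?E = "level_set (B w) e"
    have e: "e > 0" using elim by auto
    have m: "?E \<inter> ball w \<delta> \<in> sets borel" "?E - ball w \<delta> \<in> sets borel" using level_set_borel by simp_all
    have "cmod (complex_of_real (LINT x:?E \<inter> ball w \<delta>|area_measure. (cmod (?f x))\<^sup>2)) / e\<^sup>2 < cmod l + 1"
      using elim(1) unfolding set_integral_sq_complex by (simp add: norm_divide norm_power)
    then have "(LINT x:?E \<inter> ball w \<delta>|area_measure. (cmod (?f x))\<^sup>2) / e\<^sup>2 < cmod l + 1"
      by (smt (verit) divide_right_mono norm_of_real zero_le_power2)
    then have near: "(LINT x:?E \<inter> ball w \<delta>|area_measure. (cmod (?f x))\<^sup>2) \<le> (cmod l + 1) * e\<^sup>2"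
      using e by (simp add: divide_less_eq less_imp_le)
    have "(LINT x:?E - ball w \<delta>|area_measure. (cmod (?f x))\<^sup>2) \<le> e\<^sup>2 / \<delta>\<^sup>2 * measure area_measure ?E"
      by (rule set_integral_sq_off_ball[OF w(1) \<delta>(1) e])
    also have "\<dots> \<le> e\<^sup>2 / \<delta>\<^sup>2 * measure area_measure UNIV"
      by (intro mult_left_mono area.finite_measure_mono) auto
    finally have far: "(LINT x:?E - ball w \<delta>|area_measure. (cmod (?f x))\<^sup>2) \<le> (measure area_measure UNIV / \<delta>\<^sup>2) * e\<^sup>2"
      by (simp add: mult.commute)
    have "(LINT x:?E|area_measure. (cmod (?f x))\<^sup>2) = (LINT x:(?E \<inter> ball w \<delta>) \<union> (?E - ball w \<delta>)|area_measure. (cmod (?f x))\<^sup>2)"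
      by (intro arg_cong2[where f = "\<lambda>A. set_lebesgue_integral area_measure A"]) auto
    also have "\<dots> = (LINT x:?E \<inter> ball w \<delta>|area_measure. (cmod (?f x))\<^sup>2) + (LINT x:?E - ball w \<delta>|area_measure. (cmod (?f x))\<^sup>2)"
      by (rule set_integral_Un) (use m in \<open>auto intro!: set_integrable_sq fb\<close>)
    finally show ?case using near far by (simp add: algebra_simps)
  qed
  then show thesis by (rule that)
qed

text \<open>Only \<open>z\<close> contributes to the limit: \<open>diff_quot B z\<close> vanishes at all other points of its fibre
  and is \<open>O(e)\<close> on the part of the level set that is far from \<open>z\<close>.\<close>

lemma level_set_pairing:
  assumes z: "z \<in> unit_disk" "deriv B z \<noteq> 0" and u: "u \<in> bergman_space" "level_bounded (B z) u C"
  shows "((\<lambda>e. (LINT x:level_set (B z) e|area_measure. u x * cnj (diff_quot B z x)) / e\<^sup>2)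
     \<longlongrightarrow> u z / deriv B z) (at_right 0)"
proof -
  let ?f = "diff_quot B z"
  from level_set_average[OF z] obtain \<delta> where \<delta>: "\<delta> > 0" "ball z \<delta> \<subseteq> unit_disk"
    and avg: "\<forall>d (G :: complex \<Rightarrow> complex). 0 < d \<longrightarrow> d \<le> \<delta> \<longrightarrow> continuous_on unit_disk G \<longrightarrow>
      ((\<lambda>e. (LINT x:level_set (B z) e \<inter> ball z d|area_measure. G x) / e\<^sup>2)
         \<longlongrightarrow> (G z / (cmod (deriv B z))\<^sup>2)) (at_right 0)"
    by (elim exE conjE) (rule that)
  have fb: "?f \<in> bergman_space" by (rule diff_quot_bergman[OF B_bergman z(1)])
  have near: "((\<lambda>e. (LINT x:level_set (B z) e \<inter> ball z \<delta>|area_measure. u x * cnj (?f x)) / e\<^sup>2)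
     \<longlongrightarrow> u z * cnj (?f z) / (cmod (deriv B z))\<^sup>2) (at_right 0)"
  proof -
    have "continuous_on unit_disk (\<lambda>x. u x * cnj (?f x))"
      by (intro continuous_on_mult continuous_on_cnj diff_quot_continuous z(1)
        holomorphic_on_imp_continuous_on[OF bergman_holomorphic[OF u(1)]])
    from avg[rule_format, OF \<delta>(1) order_refl this] show ?thesis by simp
  qed
  have "u z * cnj (?f z) / (cmod (deriv B z))\<^sup>2 = u z / deriv B z"
  proof -
    have "u z * cnj (?f z) / (cmod (deriv B z))\<^sup>2 = u z * cnj (deriv B z) / (deriv B z * cnj (deriv B z))"
      using z unfolding complex_norm_square[symmetric] by (simp add: diff_quot_self)
    then show ?thesis using z by simp
  qed
  note near = near[unfolded this]
  have far: "((\<lambda>e. (LINT x:level_set (B z) e - ball z \<delta>|area_measure. u x * cnj (?f x)) / e\<^sup>2) \<longlongrightarrow> 0) (at_right 0)"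
  proof (rule tendstoI)
    fix \<epsilon> :: real assume \<epsilon>: "\<epsilon> > 0"
    \<comment> \<open>The weight \<open>s\<close> makes the term of \<open>u\<close> at most
      \<open>\<epsilon> / 2\<close>; the other term is below \<open>\<epsilon> / 2\<close> once the
      level set has small area. Taking \<open>k\<close> larger than the modulus of \<open>C\<close>
      avoids a division by 0.\<close>
    define k where "k = \<bar>C\<bar> + 1"
    have k: "k > 0" "\<bar>C\<bar> \<le> k" by (auto simp: k_def)
    define s where "s = \<epsilon> / (2 * k)"
    have s: "s > 0" using \<epsilon> k by (simp add: s_def)
    have "s * \<bar>C\<bar> \<le> s * k" using s k by (intro mult_left_mono) auto
    also have "\<dots> = \<epsilon> / 2" using k by (simp add: s_def)
    finally have sC: "s * \<bar>C\<bar> \<le> \<epsilon> / 2" .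
    have "\<forall>\<^sub>F e in at_right 0. measure area_measure (level_set (B z) e) < \<epsilon> / 2 * (\<delta>\<^sup>2 * s)"
      using \<epsilon> \<delta> s by (intro order_tendstoD(2)[OF level_set_measure_tendsto_0[OF z]]) auto
    moreover have "\<forall>\<^sub>F e in at_right 0. e \<in> {0<..<(1::real)}" by (rule eventually_at_right_real) simp
    ultimately show "\<forall>\<^sub>F e in at_right 0. dist ((LINT x:level_set (B z) e - ball z \<delta>|area_measure. u x * cnj (?f x)) / e\<^sup>2) 0 < \<epsilon>"
      using u(2)[unfolded level_bounded_def]
    proof eventually_elim
      case (elim e)
      let ?E = "level_set (B z) e"
      have e: "e > 0" using elim by auto
      have m: "?E - ball z \<delta> \<in> sets borel" "?E \<in> sets borel" using level_set_borel by simp_all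
      have "cmod (LINT x:?E - ball z \<delta>|area_measure. u x * cnj (?f x))
        \<le> s * (LINT x:?E - ball z \<delta>|area_measure. (cmod (u x))\<^sup>2) + (LINT x:?E - ball z \<delta>|area_measure. (cmod (?f x))\<^sup>2) / s"
        by (rule set_integral_mult_cnj_le[OF u(1) fb m(1) s])
      also have "\<dots> \<le> s * (\<bar>C\<bar> * e\<^sup>2) + e\<^sup>2 / \<delta>\<^sup>2 * measure area_measure ?E / s"
      proof (intro add_mono mult_left_mono divide_right_mono)
        have "(LINT x:?E - ball z \<delta>|area_measure. (cmod (u x))\<^sup>2) \<le> (LINT x:?E|area_measure. (cmod (u x))\<^sup>2)"
          by (rule set_integral_mono_set[OF u(1) m]) auto
        also have "\<dots> \<le> C * e\<^sup>2" using elim by simp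
        also have "\<dots> \<le> \<bar>C\<bar> * e\<^sup>2" by (intro mult_right_mono) auto
        finally show "(LINT x:?E - ball z \<delta>|area_measure. (cmod (u x))\<^sup>2) \<le> \<bar>C\<bar> * e\<^sup>2" .
      qed (use s set_integral_sq_off_ball[OF z(1) \<delta>(1) e] in auto)
      finally have "cmod (LINT x:?E - ball z \<delta>|area_measure. u x * cnj (?f x)) / e\<^sup>2
          \<le> (s * (\<bar>C\<bar> * e\<^sup>2) + e\<^sup>2 / \<delta>\<^sup>2 * measure area_measure ?E / s) / e\<^sup>2"
        by (rule divide_right_mono) simp
      also have "\<dots> = s * \<bar>C\<bar> + measure area_measure ?E / (\<delta>\<^sup>2 * s)"
        using e s \<delta> by (simp add: field_simps)
      also have "measure area_measure ?E / (\<delta>\<^sup>2 * s) < \<epsilon> / 2"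
        using elim(1) s \<delta> by (simp add: pos_divide_less_eq)
      finally show ?case using sC by (simp add: norm_divide norm_power)
    qed
  qed
  have "\<forall>\<^sub>F e in at_right 0. (LINT x:level_set (B z) e \<inter> ball z \<delta>|area_measure. u x * cnj (?f x)) / e\<^sup>2
     + (LINT x:level_set (B z) e - ball z \<delta>|area_measure. u x * cnj (?f x)) / e\<^sup>2
     = (LINT x:level_set (B z) e|area_measure. u x * cnj (?f x)) / e\<^sup>2"
  proof (rule always_eventually, rule allI)
    fix e :: real
    let ?E = "level_set (B z) e"
    have m: "?E \<inter> ball z \<delta> \<in> sets borel" "?E - ball z \<delta> \<in> sets borel" using level_set_borel by simp_all
    have "(LINT x:?E|area_measure. u x * cnj (?f x)) = (LINT x:(?E \<inter> ball z \<delta>) \<union> (?E - ball z \<delta>)|area_measure. u x * cnj (?f x))"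
      by (intro arg_cong2[where f = "\<lambda>A. set_lebesgue_integral area_measure A"]) auto
    also have "\<dots> = (LINT x:?E \<inter> ball z \<delta>|area_measure. u x * cnj (?f x)) + (LINT x:?E - ball z \<delta>|area_measure. u x * cnj (?f x))"
      by (rule set_integral_Un) (use m in \<open>auto intro!: set_integrable_mult_cnj fb u\<close>)
    finally show "(LINT x:?E \<inter> ball z \<delta>|area_measure. u x * cnj (?f x)) / e\<^sup>2
      + (LINT x:?E - ball z \<delta>|area_measure. u x * cnj (?f x)) / e\<^sup>2 = (LINT x:?E|area_measure. u x * cnj (?f x)) / e\<^sup>2"
      by (simp add: add_divide_distrib)
  qed
  from Lim_transform_eventually[OF tendsto_add[OF near far] this] show ?thesis by simp
qed

end

section \<open>The action of a commuting projection on fibres\<close>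

lemma finite_separated_radius:
  fixes F :: "complex set"
  assumes "finite F" "\<And>v. v \<in> F \<Longrightarrow> \<delta> v > 0"
  obtains d where "d > 0" "\<And>v. v \<in> F \<Longrightarrow> d \<le> \<delta> v" "disjoint_family_on (\<lambda>v. ball v d) F"
proof -
  \<comment> \<open>The element 1 keeps the minimum defined for empty \<open>F\<close>; half the
    pairwise distances make the balls disjoint.\<close>
  define S where "S = insert 1 (\<delta> ` F \<union> (\<lambda>(u, v). dist u v / 2) ` {(u, v) \<in> F \<times> F. u \<noteq> v})"
  have "finite {(u, v) \<in> F \<times> F. u \<noteq> v}"
    by (rule finite_subset[of _ "F \<times> F"]) (use assms(1) in auto)
  then have fin: "finite S" using assms(1) by (simp add: S_def)
  have pos: "Min S > 0" using fin assms(2) by (subst Min_gr_iff) (auto simp: S_def)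
  have "Min S \<le> \<delta> v" if "v \<in> F" for v using fin that by (intro Min_le) (auto simp: S_def)
  moreover have "disjoint_family_on (\<lambda>v. ball v (Min S)) F"
    unfolding disjoint_family_on_def
  proof (intro ballI impI)
    fix u v assume uv: "u \<in> F" "v \<in> F" "u \<noteq> v"
    then have "dist u v / 2 \<in> S" by (force simp: S_def)
    then have "Min S \<le> dist u v / 2" using fin by (intro Min_le)
    then show "ball u (Min S) \<inter> ball v (Min S) = {}" by (intro disjoint_ballI) auto
  qed
  ultimately show thesis using pos that by blast
qed

context commuting_projection
begin

text \<open>These are the coefficients in the formal expansion
  \<open>P f z / B' z = (\<Sum>w. fiber_coeff z w * f w / B' w)\<close> over the fibre \<open>B w = B z\<close>:
  among the points of that fibre, \<open>diff_quot B w\<close> is nonzero only at \<open>w\<close>.\<close>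

definition fiber_coeff :: "complex \<Rightarrow> complex \<Rightarrow> complex" where
  "fiber_coeff z w = P (diff_quot B w) z / deriv B z"

lemma P_diff_quot_bergman: "w \<in> unit_disk \<Longrightarrow> P (diff_quot B w) \<in> bergman_space"
  by (intro P_bergman diff_quot_bergman B_bergman)

lemma P_level_bounded:
  assumes "f \<in> bergman_space" "level_bounded c f C"
  shows "level_bounded c (P f) C"
  using assms(2) unfolding level_bounded_def
  by eventually_elim (use level_set_contraction[OF assms(1), of c] order_trans in blast)

lemma fiber_coeff_tendsto:
  assumes z: "z \<in> unit_disk" "deriv B z \<noteq> 0" and w: "w \<in> unit_disk" "deriv B w \<noteq> 0" and eq: "B z = B w"
  shows "((\<lambda>e. (LINT x:level_set (B z) e|area_measure. P (diff_quot B w) x * cnj (diff_quot B z x)) / e\<^sup>2)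
     \<longlongrightarrow> fiber_coeff z w) (at_right 0)"
proof -
  obtain C where "level_bounded (B w) (diff_quot B w) C" using diff_quot_level_bounded[OF w] .
  then have "level_bounded (B z) (P (diff_quot B w)) C"
    unfolding eq by (intro P_level_bounded diff_quot_bergman B_bergman w)
  from level_set_pairing[OF z P_diff_quot_bergman[OF w(1)] this] show ?thesis
    by (simp add: fiber_coeff_def)
qed

text \<open>Both coefficients are limits of integrals over the same level sets, since
  \<open>B z = B w\<close>; moving \<open>P\<close> across the product and conjugating exchanges the
  two points.\<close>

lemma fiber_coeff_hermitian:
  assumes z: "z \<in> unit_disk" "deriv B z \<noteq> 0" and w: "w \<in> unit_disk" "deriv B w \<noteq> 0" and eq: "B z = B w"
  shows "fiber_coeff z w = cnj (fiber_coeff w z)"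
proof (rule tendsto_unique[OF trivial_limit_at_right_real fiber_coeff_tendsto[OF assms]])
  have "((\<lambda>e. cnj ((LINT x:level_set (B w) e|area_measure. P (diff_quot B z) x * cnj (diff_quot B w x)) / e\<^sup>2))
     \<longlongrightarrow> cnj (fiber_coeff w z)) (at_right 0)"
    by (intro tendsto_cnj fiber_coeff_tendsto w z eq[symmetric])
  moreover have "cnj ((LINT x:level_set (B w) e|area_measure. P (diff_quot B z) x * cnj (diff_quot B w x)) / e\<^sup>2)
      = (LINT x:level_set (B z) e|area_measure. P (diff_quot B w) x * cnj (diff_quot B z x)) / e\<^sup>2" for e
  proof -
    have "cnj (LINT x:level_set (B w) e|area_measure. P (diff_quot B z) x * cnj (diff_quot B w x))
        = (LINT x:level_set (B w) e|area_measure. diff_quot B w x * cnj (P (diff_quot B z) x))"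
      unfolding set_lebesgue_integral_def by (subst Bochner_Integration.integral_cnj[symmetric]) (simp add: mult.commute)
    also have "\<dots> = (LINT x:level_set (B z) e|area_measure. P (diff_quot B w) x * cnj (diff_quot B z x))"
      unfolding eq by (rule level_set_selfadjoint[symmetric]) (intro diff_quot_bergman B_bergman w z)+
    finally show ?thesis by simp
  qed
  ultimately show "((\<lambda>e. (LINT x:level_set (B z) e|area_measure. P (diff_quot B w) x * cnj (diff_quot B z x)) / e\<^sup>2)
     \<longlongrightarrow> cnj (fiber_coeff w z)) (at_right 0)"
    by (simp only:)
qed

text \<open>The mass of \<open>P (diff_quot B w)\<close> over the level set, divided by
  \<open>e\<^sup>2\<close>, is eventually at most \<open>C\<close>. In the limit each of the
  disjoint balls around the points of \<open>F\<close> carries one summand of it, and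
  \<open>C\<close> does not depend on \<open>F\<close>.\<close>

lemma fiber_coeff_column_bound:
  assumes w: "w \<in> unit_disk" "deriv B w \<noteq> 0"
  obtains C where "\<And>F. finite F \<Longrightarrow> (\<And>v. v \<in> F \<Longrightarrow> v \<in> unit_disk \<and> deriv B v \<noteq> 0 \<and> B v = B w) \<Longrightarrow>
     (\<Sum>v\<in>F. (cmod (fiber_coeff v w))\<^sup>2) \<le> C"
proof -
  let ?u = "P (diff_quot B w)"
  have ub: "?u \<in> bergman_space" by (rule P_diff_quot_bergman[OF w(1)])
  obtain C where "level_bounded (B w) (diff_quot B w) C" using diff_quot_level_bounded[OF w] .
  then have C: "level_bounded (B w) ?u C"
    by (intro P_level_bounded diff_quot_bergman B_bergman w)
  have "(\<Sum>v\<in>F. (cmod (fiber_coeff v w))\<^sup>2) \<le> C"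
    if F: "finite F" "\<And>v. v \<in> F \<Longrightarrow> v \<in> unit_disk \<and> deriv B v \<noteq> 0 \<and> B v = B w" for F
  proof -
    have "\<exists>\<delta>>0. \<forall>d. 0 < d \<longrightarrow> d \<le> \<delta> \<longrightarrow>
      ((\<lambda>e. (LINT x:level_set (B w) e \<inter> ball v d|area_measure. ?u x * cnj (?u x)) / e\<^sup>2)
         \<longlongrightarrow> ?u v * cnj (?u v) / (cmod (deriv B v))\<^sup>2) (at_right 0)" if v: "v \<in> F" for v
    proof -
      have v': "v \<in> unit_disk" "deriv B v \<noteq> 0" "B v = B w" using F(2)[OF v] by auto
      from level_set_average[OF v'(1,2)] obtain \<delta> where "\<delta> > 0"
        and avg: "\<forall>d (G :: complex \<Rightarrow> complex). 0 < d \<longrightarrow> d \<le> \<delta> \<longrightarrow> continuous_on unit_disk G \<longrightarrow>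
          ((\<lambda>e. (LINT x:level_set (B v) e \<inter> ball v d|area_measure. G x) / e\<^sup>2)
             \<longlongrightarrow> (G v / (cmod (deriv B v))\<^sup>2)) (at_right 0)"
        by (elim exE conjE) (rule that)
      have "continuous_on unit_disk (\<lambda>x. ?u x * cnj (?u x))"
        by (intro continuous_on_mult continuous_on_cnj holomorphic_on_imp_continuous_on bergman_holomorphic ub)
      from avg[rule_format, OF _ _ this] \<open>\<delta> > 0\<close> v'(3) show ?thesis
        by (intro exI[of _ \<delta>] conjI allI impI) simp_all
    qed
    then have "\<forall>v\<in>F. \<exists>\<delta>>0. \<forall>d. 0 < d \<longrightarrow> d \<le> \<delta> \<longrightarrow>
      ((\<lambda>e. (LINT x:level_set (B w) e \<inter> ball v d|area_measure. ?u x * cnj (?u x)) / e\<^sup>2)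
         \<longlongrightarrow> ?u v * cnj (?u v) / (cmod (deriv B v))\<^sup>2) (at_right 0)" by blast
    from bchoice[OF this] obtain \<delta> where \<delta>: "\<forall>v\<in>F. \<delta> v > 0 \<and> (\<forall>d. 0 < d \<longrightarrow> d \<le> \<delta> v \<longrightarrow>
      ((\<lambda>e. (LINT x:level_set (B w) e \<inter> ball v d|area_measure. ?u x * cnj (?u x)) / e\<^sup>2)
         \<longlongrightarrow> ?u v * cnj (?u v) / (cmod (deriv B v))\<^sup>2) (at_right 0))"
      by (elim exE) (rule that)
    have \<delta>0: "\<delta> v > 0" if "v \<in> F" for v using \<delta> that by blast
    obtain d where d: "d > 0" "\<And>v. v \<in> F \<Longrightarrow> d \<le> \<delta> v" "disjoint_family_on (\<lambda>v. ball v d) F"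
      by (rule finite_separated_radius[OF F(1), of \<delta>], erule \<delta>0, rule that)
    define J where "J v e = (LINT x:level_set (B w) e \<inter> ball v d|area_measure. (cmod (?u x))\<^sup>2)" for v e
    have Jlim: "((\<lambda>e. J v e / e\<^sup>2) \<longlongrightarrow> (cmod (fiber_coeff v w))\<^sup>2) (at_right 0)" if v: "v \<in> F" for v
    proof -
      have "((\<lambda>e. complex_of_real (J v e / e\<^sup>2)) \<longlongrightarrow> complex_of_real ((cmod (fiber_coeff v w))\<^sup>2)) (at_right 0)"
        using \<delta>[rule_format, OF v, THEN conjunct2, rule_format, OF d(1) d(2)[OF v]]
        unfolding J_def of_real_divide set_integral_sq_complex fiber_coeff_def norm_divide power_divide
          complex_norm_square[symmetric, of "?u v"]
        by simp
      from tendsto_Re[OF this] show ?thesis by simp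
    qed
    have "((\<lambda>e. \<Sum>v\<in>F. J v e / e\<^sup>2) \<longlongrightarrow> (\<Sum>v\<in>F. (cmod (fiber_coeff v w))\<^sup>2)) (at_right 0)"
      by (intro tendsto_sum Jlim)
    moreover have "\<forall>\<^sub>F e in at_right 0. (\<Sum>v\<in>F. J v e / e\<^sup>2) \<le> C"
    proof -
      have "\<forall>\<^sub>F e in at_right 0. e \<in> {0<..<(1::real)}" by (rule eventually_at_right_real) simp
      then show ?thesis using C[unfolded level_bounded_def]
      proof eventually_elim
        case (elim e)
        let ?E = "level_set (B w) e"
        have e: "e > 0" using elim by auto
        have m: "?E \<inter> ball v d \<in> sets borel" for v using level_set_borel by simp
        have mU: "(\<Union>v\<in>F. ?E \<inter> ball v d) \<in> sets borel" using m F(1) by (intro sets.finite_UN) auto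
        have "(\<Sum>v\<in>F. J v e) = (LINT x:(\<Union>v\<in>F. ?E \<inter> ball v d)|area_measure. (cmod (?u x))\<^sup>2)"
          unfolding J_def
        proof (rule set_integral_finite_Union[symmetric])
          show "disjoint_family_on (\<lambda>v. ?E \<inter> ball v d) F"
            using d(3) unfolding disjoint_family_on_def by blast
          show "set_integrable area_measure (?E \<inter> ball v d) (\<lambda>x. (cmod (?u x))\<^sup>2)" for v
            by (rule set_integrable_sq[OF ub m])
        qed (use F m in auto)
        also have "\<dots> \<le> (LINT x:?E|area_measure. (cmod (?u x))\<^sup>2)"
          by (rule set_integral_mono_set[OF ub mU level_set_borel]) auto
        also have "\<dots> \<le> C * e\<^sup>2" using elim by simp
        finally show ?case using e by (simp add: sum_divide_distrib[symmetric] divide_le_eq)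
      qed
    qed
    ultimately show ?thesis by (intro tendsto_upperbound[where F = "at_right 0"]) auto
  qed
  then show thesis by (rule that)
qed

end

section \<open>Holomorphic dependence on the points of the fibre\<close>

text \<open>The real derivative of \<open>cnj (f x)\<close> is conjugate linear and that of
  \<open>g\<close> complex linear; since they agree, comparing them at \<open>1\<close> and
  \<open>\<i>\<close> forces both to vanish.\<close>

lemma holomorphic_cnj_constant:
  assumes f: "f holomorphic_on S" and g: "g holomorphic_on S" and eq: "\<And>x. x \<in> S \<Longrightarrow> g x = cnj (f x)"
    and S: "open S" "convex S" and xy: "x \<in> S" "y \<in> S"
  shows "f x = f y"
proof -
  have "(f has_field_derivative 0) (at z within S)" if z: "z \<in> S" for z
  proof -
    have df: "(f has_field_derivative deriv f z) (at z)" by (rule holomorphic_derivI[OF f S(1) z])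
    have "(g has_field_derivative deriv g z) (at z)" by (rule holomorphic_derivI[OF g S(1) z])
    then have dg: "(g has_derivative (\<lambda>h. deriv g z * h)) (at z)" by (simp add: has_field_derivative_def)
    have "((\<lambda>x. cnj (f x)) has_derivative (\<lambda>h. cnj (deriv f z * h))) (at z)"
      using df by (intro has_derivative_cnj) (simp add: has_field_derivative_def)
    moreover have "((\<lambda>x. cnj (f x)) has_derivative (\<lambda>h. deriv g z * h)) (at z)"
      by (rule has_derivative_transform_within_open[OF dg S(1) z]) (simp add: eq)
    ultimately have *: "cnj (deriv f z * h) = deriv g z * h" for h
      by (metis has_derivative_unique)
    from *[of 1] *[of \<i>] have "deriv f z = 0" by (simp add: complex_eq_iff)
    with df show ?thesis using has_field_derivative_at_within by metis
  qed
  from has_field_derivative_zero_constant[OF S(2) this] xy show ?thesis by metis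
qed

context bounded_symbol
begin

text \<open>A Taylor expansion in the node with quadratic remainder. Its terms are Bergman functions
  with scalar coefficients depending on \<open>w\<close>, so that \<open>P\<close> can be applied
  term by term.\<close>

lemma diff_quot_expansion:
  assumes w: "w \<in> unit_disk" and u: "u \<in> unit_disk"
  defines "g \<equiv> diff_quot (diff_quot B u) u"
  shows "diff_quot B w = (\<lambda>x. diff_quot B u x + (w - u) * g x + (w - u)\<^sup>2 * diff_quot g w x)"
proof
  fix x
  show "diff_quot B w x = diff_quot B u x + (w - u) * g x + (w - u)\<^sup>2 * diff_quot g w x"
  proof (cases "x \<in> unit_disk")
    case True
    have "diff_quot B w x = diff_quot B u x + (w - u) * diff_quot (diff_quot B u) w x"
      using diff_quot_resolvent[OF B_holomorphic w u True] by (simp add: diff_eq_eq add.commute)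
    also have "diff_quot (diff_quot B u) w x = g x + (w - u) * diff_quot g w x"
      unfolding g_def using diff_quot_resolvent[OF diff_quot_holomorphic[OF B_holomorphic u] w u True]
      by (simp add: diff_eq_eq add.commute)
    finally show ?thesis by (simp add: algebra_simps power2_eq_square)
  qed (simp add: g_def diff_quot_outside)
qed

end

context commuting_projection
begin

lemma P_diff_quot_expansion:
  assumes w: "w \<in> unit_disk" and u: "u \<in> unit_disk"
  defines "g \<equiv> diff_quot (diff_quot B u) u"
  shows "P (diff_quot B w) x = P (diff_quot B u) x + (w - u) * P g x + (w - u)\<^sup>2 * P (diff_quot g w) x"
proof -
  have b: "diff_quot B u \<in> bergman_space" "g \<in> bergman_space" "diff_quot g w \<in> bergman_space"
    unfolding g_def by (intro diff_quot_bergman B_bergman w u)+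
  show ?thesis
    unfolding diff_quot_expansion[OF w u, folded g_def]
    using b by (simp add: P_add P_cmult bergman_add bergman_cmult)
qed

lemma P_bounded_eval:
  assumes h: "h \<in> bergman_space" "\<And>x. x \<in> unit_disk \<Longrightarrow> cmod (h x) \<le> C" and z: "cmod z \<le> r" "r < 1"
  shows "cmod (P h z) \<le> sqrt (C\<^sup>2 * measure area_measure UNIV) / (1 - r)"
proof -
  have "cmod (P h z) \<le> sqrt (norm_sq (P h)) / (1 - r)"
    using z by (intro bergman_eval_le P_bergman h ball_in_unit_disk) auto
  also have "\<dots> \<le> sqrt (C\<^sup>2 * measure area_measure UNIV) / (1 - r)"
    using P_contraction[OF h(1)] bergman_bounded(2)[OF bergman_holomorphic[OF h(1)] h(2) bergman_outside[OF h(1)]] z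
    by (intro divide_right_mono real_sqrt_le_mono) auto
  finally show ?thesis .
qed

text \<open>Node and evaluation point move at once, as they do along a pair of local inverses.
  Expanding in the node at \<open>u = a c\<close> leaves terms that are visibly differentiable and a
  remainder that is quadratic in \<open>a y - u\<close>.\<close>

lemma P_diff_quot_differentiable:
  assumes a: "(a has_field_derivative a') (at c)" "a c \<in> unit_disk"
    and b: "(b has_field_derivative b') (at c)" "b c \<in> unit_disk"
  shows "(\<lambda>y. P (diff_quot B (a y)) (b y)) field_differentiable (at c)"
proof -
  define u where "u = a c"
  have u: "u \<in> unit_disk" using a by (simp add: u_def)
  define g where "g = diff_quot (diff_quot B u) u"
  define R where "R y = (a y - u)\<^sup>2 * P (diff_quot g (a y)) (b y)" for y
  obtain \<delta>' where \<delta>': "\<delta>' > 0" "cball u \<delta>' \<subseteq> unit_disk" using disk_contains_cball[OF u] .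
  \<comment> \<open>Half the radius, so that disks of radius \<open>\<delta>\<close> about all nodes
    near \<open>u\<close> stay in the unit disk and the remainder is bounded uniformly in the
    node.\<close>
  define \<delta> where "\<delta> = \<delta>' / 2"
  have \<delta>: "\<delta> > 0" using \<delta>' by (simp add: \<delta>_def)
  have sub: "cball w \<delta> \<subseteq> unit_disk" if "w \<in> cball u \<delta>" for w
  proof
    fix x assume "x \<in> cball w \<delta>"
    then have "dist u x \<le> \<delta>'" using that dist_triangle[of u x w] by (simp add: \<delta>_def)
    then show "x \<in> unit_disk" using \<delta>' by auto
  qed
  have uc: "cball u \<delta> \<subseteq> unit_disk" using sub[of u] \<delta> by simp
  have h0: "diff_quot B u holomorphic_on unit_disk" by (rule diff_quot_holomorphic[OF B_holomorphic u])
  have hg: "g holomorphic_on unit_disk" unfolding g_def by (rule diff_quot_holomorphic[OF h0 u])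
  have gb: "g \<in> bergman_space" unfolding g_def by (intro diff_quot_bergman B_bergman u)
  \<comment> \<open>Three nested difference quotients, starting from the bound 1 on
    \<open>B\<close>.\<close>
  define C where "C = 2 * (2 * (2 * 1 / \<delta>) / \<delta>) / \<delta>"
  have "cmod (g x) \<le> 2 * (2 * 1 / \<delta>) / \<delta>" if "x \<in> unit_disk" for x
    unfolding g_def
    by (rule diff_quot_le[OF h0 _ uc \<delta> that]) (rule diff_quot_le[OF B_holomorphic B_le uc \<delta>])
  then have hb: "cmod (diff_quot g w x) \<le> C" if "w \<in> cball u \<delta>" "x \<in> unit_disk" for w x
    unfolding C_def using diff_quot_le[OF hg _ sub[OF that(1)] \<delta> that(2)] by blast
  define r where "r = (cmod (b c) + 1) / 2"
  have r: "r < 1" "cmod (b c) < r" using b by (auto simp: r_def)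
  define K where "K = sqrt (C\<^sup>2 * measure area_measure UNIV) / (1 - r)"
  have ac: "isCont a c" and bc: "isCont b c" using a b by (auto intro: DERIV_isCont)
  have eva: "\<forall>\<^sub>F y in at c. a y \<in> ball u \<delta>"
    using ac \<delta> unfolding isCont_def by (intro topological_tendstoD) (auto simp: u_def)
  have evb: "\<forall>\<^sub>F y in at c. b y \<in> ball 0 r"
    using bc r unfolding isCont_def by (intro topological_tendstoD) auto
  have "(R has_field_derivative 0) (at c)"
    unfolding has_field_derivative_iff
  proof (rule Lim_null_comparison)
    have "((\<lambda>y. K * cmod ((a y - a c) / (y - c)) * cmod (a y - u)) \<longlongrightarrow> K * cmod a' * cmod (a c - u)) (at c)"
      using a(1) ac unfolding has_field_derivative_iff isCont_def by (intro tendsto_intros)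
    then show "((\<lambda>y. K * cmod ((a y - a c) / (y - c)) * cmod (a y - u)) \<longlongrightarrow> 0) (at c)"
      by (simp add: u_def)
    show "\<forall>\<^sub>F y in at c. norm ((R y - R c) / (y - c)) \<le> K * cmod ((a y - a c) / (y - c)) * cmod (a y - u)"
      using eva evb
    proof eventually_elim
      case (elim y)
      have ay: "a y \<in> cball u \<delta>" "a y \<in> unit_disk" using elim subsetD[OF uc, of "a y"] by auto
      have k: "cmod (P (diff_quot g (a y)) (b y)) \<le> K"
        unfolding K_def using elim r hb[OF ay(1)]
        by (intro P_bounded_eval diff_quot_bergman gb ay) auto
      have "norm ((R y - R c) / (y - c)) = cmod ((a y - a c) / (y - c)) * cmod (a y - u) * cmod (P (diff_quot g (a y)) (b y))"
        by (simp add: R_def u_def norm_mult norm_divide norm_power power2_eq_square)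
      also have "\<dots> \<le> cmod ((a y - a c) / (y - c)) * cmod (a y - u) * K"
        by (intro mult_left_mono k) auto
      finally show ?case by (simp add: mult_ac)
    qed
  qed
  then have Rd: "R field_differentiable (at c)" unfolding field_differentiable_def by blast
  have hol: "P (diff_quot B u) holomorphic_on unit_disk" "P g holomorphic_on unit_disk"
    by (intro bergman_holomorphic P_bergman gb diff_quot_bergman B_bergman u)+
  have comp: "(\<lambda>y. h (b y)) field_differentiable (at c)" if "h holomorphic_on unit_disk" for h
    using field_differentiable_compose[of b c h] b that
    by (metis (no_types, lifting) comp_def field_differentiable_def holomorphic_on_imp_differentiable_at open_ball ext)
  have ad: "a field_differentiable (at c)" using a(1) unfolding field_differentiable_def by blast
  have sum: "(\<lambda>y. P (diff_quot B u) (b y) + (a y - u) * P g (b y) + R y) field_differentiable (at c)"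
    by (intro field_differentiable_add field_differentiable_mult field_differentiable_diff field_differentiable_const
      comp hol Rd ad)
  have "P (diff_quot B (a y)) (b y) = P (diff_quot B u) (b y) + (a y - u) * P g (b y) + R y" if "a y \<in> unit_disk" for y
    unfolding R_def g_def by (rule P_diff_quot_expansion[OF that u])
  moreover have "\<forall>\<^sub>F y in nhds c. a y \<in> unit_disk"
    unfolding eventually_nhds_conv_at using a(2) uc eventually_mono[OF eva, of "\<lambda>y. a y \<in> unit_disk"]
    by (meson ball_subset_cball subset_iff)
  ultimately have "\<forall>\<^sub>F y in nhds c. P (diff_quot B (a y)) (b y) = P (diff_quot B u) (b y) + (a y - u) * P g (b y) + R y"
    by (auto elim: eventually_mono)
  then have "((\<lambda>y. P (diff_quot B (a y)) (b y)) has_field_derivative D) (at c) \<longleftrightarrow>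
    ((\<lambda>y. P (diff_quot B u) (b y) + (a y - u) * P g (b y) + R y) has_field_derivative D) (at c)" for D
    by (intro DERIV_cong_ev refl)
  with sum show ?thesis unfolding field_differentiable_def by blast
qed

end

section \<open>Local inverses, finite parts of fibres and critical points\<close>

context bounded_symbol
begin

lemma symbol_local_inverse:
  assumes "z \<in> S" "open S" "S \<subseteq> unit_disk" "deriv B z \<noteq> 0"
  obtains U \<rho> where "open U" "z \<in> U" "U \<subseteq> S" "open (B ` U)" "\<rho> holomorphic_on (B ` U)"
    "\<forall>x\<in>U. \<rho> (B x) = x \<and> deriv B x \<noteq> 0"
proof -
  have holS: "B holomorphic_on S" using B_holomorphic assms(3) by (rule holomorphic_on_subset)
  obtain r where r: "r > 0" "ball z r \<subseteq> S" "open (B ` ball z r)" "inj_on B (ball z r)"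
    using has_complex_derivative_locally_invertible[OF holS assms(1,2,4)] by blast
  have hol: "B holomorphic_on ball z r" using holS r(2) by (rule holomorphic_on_subset)
  obtain \<rho> where \<rho>: "\<rho> holomorphic_on (B ` ball z r)" "\<forall>x\<in>ball z r. \<rho> (B x) = x"
  proof (rule holomorphic_has_inverse[OF hol open_ball r(4)])
    fix g assume "g holomorphic_on (B ` ball z r)" "\<And>x. x \<in> ball z r \<Longrightarrow> g (B x) = x"
    then show thesis by (intro that[of g]) auto
  qed
  have "\<forall>x\<in>ball z r. \<rho> (B x) = x \<and> deriv B x \<noteq> 0"
    using \<rho>(2) holomorphic_injective_imp_regular[OF hol open_ball r(4)] by blast
  moreover have "z \<in> ball z r" using r(1) by simp
  ultimately show thesis using r \<rho>(1) by (intro that[of "ball z r" \<rho>] open_ball)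
qed

text \<open>A whole fibre may be infinite, but its part in a compact subset of the disk is finite
  when \<open>B\<close> is not constant; sums are taken over such parts only.\<close>

definition fiber_in :: "complex set \<Rightarrow> complex \<Rightarrow> complex set" where
  "fiber_in K z = {w \<in> K. B w = B z}"

lemma fiber_in_finite:
  assumes z: "z \<in> unit_disk" "deriv B z \<noteq> 0" and K: "compact K" "K \<subseteq> unit_disk"
  shows "finite (fiber_in K z')"
proof -
  have "finite {w \<in> K. B w - B z' = 0}"
    by (rule holomorphic_compact_finite_zeros[OF _ open_ball connected_ball K symbol_not_constant[OF z]])
      (auto intro!: holomorphic_intros B_holomorphic)
  then show ?thesis by (simp add: fiber_in_def)
qed

lemma critical_points_finite:
  assumes z: "z \<in> unit_disk" "deriv B z \<noteq> 0" and K: "compact K" "K \<subseteq> unit_disk"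
  shows "finite {w \<in> K. deriv B w = 0}"
proof (cases "deriv B constant_on unit_disk")
  \<comment> \<open>The zeros of a constant function need not be isolated, but this constant is the
    nonzero value at \<open>z\<close>.\<close>
  case True
  then obtain k where "\<forall>w\<in>unit_disk. deriv B w = k" unfolding constant_on_def by (elim exE) (rule that)
  then have "deriv B w = deriv B z" if "w \<in> unit_disk" for w
    using z(1) that by simp
  then have "deriv B w \<noteq> 0" if "w \<in> K" for w using z(2) subsetD[OF K(2) that] by simp
  then have eq: "{w \<in> K. deriv B w = 0} = {}" by blast
  show ?thesis unfolding eq by simp
next
  case False
  show ?thesis
    by (rule holomorphic_compact_finite_zeros[OF holomorphic_deriv[OF B_holomorphic open_ball] open_ball connected_ball K False])
qed

text \<open>Excludes the critical values taken on \<open>K\<close>, over which points of the fibre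
  merge. The point \<open>z\<close> need not lie in \<open>K\<close>, hence the separate condition
  on it.\<close>

definition regular_over :: "complex set \<Rightarrow> complex \<Rightarrow> bool" where
  "regular_over K z \<longleftrightarrow> deriv B z \<noteq> 0 \<and> (\<forall>w\<in>fiber_in K z. deriv B w \<noteq> 0)"

text \<open>Only finitely many points are removed: the critical points in the disk and the points
  lying over a critical value attained in \<open>K\<close>. A disk without a countable set is
  connected.\<close>

lemma regular_over_connected:
  assumes z: "z \<in> unit_disk" "deriv B z \<noteq> 0" and K: "compact K" "K \<subseteq> unit_disk" and s: "s < 1"
  shows "connected {y \<in> ball 0 s. regular_over K y}"
proof -
  define X where "X = {w \<in> cball 0 s. deriv B w = 0} \<union> (\<Union>v\<in>{w \<in> K. deriv B w = 0}. fiber_in (cball 0 s) v)"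
  have cs: "compact (cball (0::complex) s)" "cball (0::complex) s \<subseteq> unit_disk" using s by auto
  have "finite X"
    unfolding X_def by (intro finite_UnI finite_UN_I critical_points_finite[OF z] fiber_in_finite[OF z] cs K)
  then have "connected (ball 0 s - X)"
    by (intro connected_open_diff_countable) (auto intro: countable_finite)
  moreover have "{y \<in> ball 0 s. regular_over K y} = ball 0 s - X"
    by (auto simp: X_def regular_over_def fiber_in_def)
  ultimately show ?thesis by simp
qed

end

section \<open>Local constancy of the coefficients and of their sums over fibres\<close>

context commuting_projection
begin

text \<open>By \<open>fiber_coeff_hermitian\<close> the coefficient is both holomorphic and antiholomorphic along a pair
  of local inverses.\<close>

lemma fiber_coeff_locally_constant:
  assumes U: "U \<subseteq> unit_disk" "open (B ` U)" "\<rho> holomorphic_on (B ` U)"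
    "\<And>x. x \<in> U \<Longrightarrow> \<rho> (B x) = x" "\<And>x. x \<in> U \<Longrightarrow> deriv B x \<noteq> 0"
    and V: "V \<subseteq> unit_disk" "open (B ` V)" "\<sigma> holomorphic_on (B ` V)"
    "\<And>x. x \<in> V \<Longrightarrow> \<sigma> (B x) = x" "\<And>x. x \<in> V \<Longrightarrow> deriv B x \<noteq> 0"
    and c: "ball c r \<subseteq> B ` U" "ball c r \<subseteq> B ` V" and xy: "x \<in> ball c r" "y \<in> ball c r"
  shows "fiber_coeff (\<rho> x) (\<sigma> x) = fiber_coeff (\<rho> y) (\<sigma> y)"
proof -
  have \<rho>: "\<rho> y \<in> U" "B (\<rho> y) = y" if "y \<in> ball c r" for y using that c(1) U(4) by auto
  have \<sigma>: "\<sigma> y \<in> V" "B (\<sigma> y) = y" if "y \<in> ball c r" for y using that c(2) V(4) by auto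
  have d\<rho>: "(\<rho> has_field_derivative deriv \<rho> y) (at y)" if "y \<in> ball c r" for y
    using holomorphic_derivI[OF U(3,2)] that c by blast
  have d\<sigma>: "(\<sigma> has_field_derivative deriv \<sigma> y) (at y)" if "y \<in> ball c r" for y
    using holomorphic_derivI[OF V(3,2)] that c by blast
  have dB: "deriv B holomorphic_on unit_disk" by (rule holomorphic_deriv[OF B_holomorphic open_ball])
  have comp: "(\<lambda>y. deriv B (h y)) holomorphic_on ball c r"
    if "h holomorphic_on ball c r" "h ` ball c r \<subseteq> unit_disk" for h
    using holomorphic_on_compose_gen[OF that(1) dB that(2)] by (simp add: comp_def)
  have h\<rho>: "\<rho> holomorphic_on ball c r" and h\<sigma>: "\<sigma> holomorphic_on ball c r"
    by (rule holomorphic_on_subset[OF U(3) c(1)]) (rule holomorphic_on_subset[OF V(3) c(2)])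
  show ?thesis
  proof (rule holomorphic_cnj_constant[OF _ _ _ open_ball convex_ball xy])
    show "(\<lambda>y. fiber_coeff (\<rho> y) (\<sigma> y)) holomorphic_on ball c r"
      unfolding fiber_coeff_def
    proof (intro holomorphic_on_divide comp h\<rho>)
      show "(\<lambda>y. P (diff_quot B (\<sigma> y)) (\<rho> y)) holomorphic_on ball c r"
        unfolding holomorphic_on_def
      proof
        fix y assume y: "y \<in> ball c r"
        have "\<rho> y \<in> unit_disk" "\<sigma> y \<in> unit_disk" using subsetD[OF U(1) \<rho>(1)[OF y]] subsetD[OF V(1) \<sigma>(1)[OF y]] by simp_all
        then show "(\<lambda>y. P (diff_quot B (\<sigma> y)) (\<rho> y)) field_differentiable at y within ball c r"
          by (intro field_differentiable_at_within[OF P_diff_quot_differentiable[OF d\<sigma>[OF y] _ d\<rho>[OF y]]])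
      qed
    qed (use \<rho> U in auto)
    show "(\<lambda>y. fiber_coeff (\<sigma> y) (\<rho> y)) holomorphic_on ball c r"
      unfolding fiber_coeff_def
    proof (intro holomorphic_on_divide comp h\<sigma>)
      show "(\<lambda>y. P (diff_quot B (\<rho> y)) (\<sigma> y)) holomorphic_on ball c r"
        unfolding holomorphic_on_def
      proof
        fix y assume y: "y \<in> ball c r"
        have "\<rho> y \<in> unit_disk" "\<sigma> y \<in> unit_disk" using subsetD[OF U(1) \<rho>(1)[OF y]] subsetD[OF V(1) \<sigma>(1)[OF y]] by simp_all
        then show "(\<lambda>y. P (diff_quot B (\<rho> y)) (\<sigma> y)) field_differentiable at y within ball c r"
          by (intro field_differentiable_at_within[OF P_diff_quot_differentiable[OF d\<rho>[OF y] _ d\<sigma>[OF y]]])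
      qed
    qed (use \<sigma> V in auto)
    show "fiber_coeff (\<sigma> y) (\<rho> y) = cnj (fiber_coeff (\<rho> y) (\<sigma> y))" if "y \<in> ball c r" for y
      using that \<rho>[OF that] \<sigma>[OF that] U(1,5) V(1,5) by (intro fiber_coeff_hermitian) auto
  qed
qed

text \<open>The bound on the frontier keeps the points of the fibre from leaving \<open>K\<close>.\<close>

lemma fiber_sum_locally_constant:
  assumes K: "compact K" "K \<subseteq> unit_disk" and fr: "\<And>x. x \<in> frontier K \<Longrightarrow> r \<le> cmod (B x)"
    and z: "z \<in> unit_disk" "deriv B z \<noteq> 0" "cmod (B z) < r"
    and reg: "\<And>w. w \<in> fiber_in K z \<Longrightarrow> deriv B w \<noteq> 0"
  shows "\<forall>\<^sub>F y in nhds z. (\<Sum>w\<in>fiber_in K z. \<phi> (fiber_coeff z w)) = (\<Sum>w\<in>fiber_in K y. \<phi> (fiber_coeff y w) :: complex)"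
proof -
  define F where "F = fiber_in K z"
  have fin: "finite F" unfolding F_def by (rule fiber_in_finite[OF z(1,2) K])
  have int: "v \<in> interior K" if "v \<in> F" for v
  proof (rule ccontr)
    assume "v \<notin> interior K"
    then have "v \<in> frontier K"
      using that compact_imp_closed[OF K(1)] by (simp add: frontier_def closure_closed F_def fiber_in_def)
    from fr[OF this] that z show False by (simp add: F_def fiber_in_def)
  qed
  \<comment> \<open>Disjoint balls keep apart the points that are continued from different members
    of \<open>F\<close>.\<close>
  obtain d where d: "d > 0" "disjoint_family_on (\<lambda>v. ball v d) F"
    by (rule finite_separated_radius[OF fin, of "\<lambda>_. 1"]) (auto intro: that)
  have "\<exists>U \<rho>. open U \<and> v \<in> U \<and> U \<subseteq> interior K \<inter> ball v d \<and> open (B ` U) \<and> \<rho> holomorphic_on (B ` U) \<and>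
    (\<forall>x\<in>U. \<rho> (B x) = x \<and> deriv B x \<noteq> 0)" if v: "v \<in> F" for v
  proof -
    have "v \<in> interior K \<inter> ball v d" using int[OF v] d(1) by simp
    moreover have "open (interior K \<inter> ball v d)" by auto
    moreover have "interior K \<inter> ball v d \<subseteq> unit_disk" using K(2) interior_subset by blast
    moreover have "deriv B v \<noteq> 0" using v reg by (simp add: F_def)
    ultimately obtain U \<rho> where "open U" "v \<in> U" "U \<subseteq> interior K \<inter> ball v d" "open (B ` U)" "\<rho> holomorphic_on (B ` U)"
      "\<forall>x\<in>U. \<rho> (B x) = x \<and> deriv B x \<noteq> 0"
      by (rule symbol_local_inverse) (rule that)
    then show ?thesis by (intro exI[of _ U] exI[of _ \<rho>]) simp
  qed
  then have "\<forall>v\<in>F. \<exists>p. open (fst p) \<and> v \<in> fst p \<and> fst p \<subseteq> interior K \<inter> ball v d \<and> open (B ` fst p) \<and> snd p holomorphic_on (B ` fst p) \<and>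
    (\<forall>x\<in>fst p. snd p (B x) = x \<and> deriv B x \<noteq> 0)" by simp
  from bchoice[OF this] obtain p where p: "\<forall>v\<in>F. open (fst (p v)) \<and> v \<in> fst (p v) \<and> fst (p v) \<subseteq> interior K \<inter> ball v d \<and>
    open (B ` fst (p v)) \<and> snd (p v) holomorphic_on (B ` fst (p v)) \<and>
    (\<forall>x\<in>fst (p v). snd (p v) (B x) = x \<and> deriv B x \<noteq> 0)"
    by (elim exE) (rule that)
  define U \<rho> where "U v = fst (p v)" and "\<rho> v = snd (p v)" for v
  have U: "open (U v)" "v \<in> U v" "U v \<subseteq> interior K" "U v \<subseteq> ball v d" "open (B ` U v)" "\<rho> v holomorphic_on (B ` U v)"
    "\<And>x. x \<in> U v \<Longrightarrow> \<rho> v (B x) = x" "\<And>x. x \<in> U v \<Longrightarrow> deriv B x \<noteq> 0" if "v \<in> F" for v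
    using p[rule_format, OF that] by (auto simp: U_def \<rho>_def)
  obtain V \<sigma> where V: "open V" "z \<in> V" "V \<subseteq> unit_disk" "open (B ` V)" "\<sigma> holomorphic_on (B ` V)"
    and V': "\<forall>x\<in>V. \<sigma> (B x) = x \<and> deriv B x \<noteq> 0"
    by (rule symbol_local_inverse[OF z(1) open_ball order_refl z(2)]) (rule that)
  have V'': "\<sigma> (B x) = x" "deriv B x \<noteq> 0" if "x \<in> V" for x using V' that by auto
  note V = V V''
  \<comment> \<open>The part of \<open>K\<close> that the neighbourhoods leave uncovered. It
    contains no point of the fibre of \<open>z\<close>, and being compact it has an image that stays
    away from \<open>B z\<close>.\<close>
  define K' where "K' = K - (\<Union>v\<in>F. U v)"
  have "compact K'" unfolding K'_def using U fin by (intro compact_diff K open_UN) auto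
  moreover have "K' \<subseteq> unit_disk" using K by (auto simp: K'_def)
  ultimately have "compact (B ` K')"
    by (intro compact_continuous_image holomorphic_on_imp_continuous_on holomorphic_on_subset[OF B_holomorphic])
  then have cl: "closed (B ` K')" by (rule compact_imp_closed)
  define W where "W = (\<Inter>v\<in>F. B ` U v) \<inter> B ` V \<inter> - (B ` K')"
  have "open W" unfolding W_def using fin U V cl by (intro open_Int open_INT) auto
  moreover have "B z \<in> W"
  proof -
    have "B z \<in> B ` U v" if "v \<in> F" for v
      using that by (intro image_eqI[OF _ U(2)[OF that]]) (simp add: F_def fiber_in_def)
    moreover have "B z \<notin> B ` K'"
    proof
      assume "B z \<in> B ` K'"
      then obtain x where "x \<in> K'" "B x = B z" by auto
      moreover from this have "x \<in> F" by (auto simp: K'_def F_def fiber_in_def)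
      ultimately show False using U(2) by (auto simp: K'_def)
    qed
    ultimately show ?thesis using V(2) by (auto simp: W_def)
  qed
  ultimately obtain s where s: "s > 0" "ball (B z) s \<subseteq> W" using openE by blast
  have cB: "continuous_on V B" using V(3) B_holomorphic holomorphic_on_imp_continuous_on holomorphic_on_subset by blast
  have "open (V \<inter> B -` ball (B z) s)" by (rule continuous_open_preimage[OF cB V(1) open_ball])
  moreover have "z \<in> V \<inter> B -` ball (B z) s" using V(2) s by simp
  ultimately have "\<forall>\<^sub>F y in nhds z. y \<in> V \<inter> B -` ball (B z) s" by (rule eventually_nhds_in_open)
  then show ?thesis
  proof eventually_elim
    case (elim y)
    then have y: "y \<in> V" "B y \<in> ball (B z) s" by auto
    have inW: "B y \<in> B ` U v" if "v \<in> F" for v using y(2) s(2) that by (auto simp: W_def)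
    have \<rho>y: "\<rho> v (B y) \<in> U v" "B (\<rho> v (B y)) = B y" if "v \<in> F" for v
      using inW[OF that] U(7)[OF that] by auto
    have disj: "U u \<inter> U v = {}" if "u \<in> F" "v \<in> F" "u \<noteq> v" for u v
      using d(2) U(4)[OF that(1)] U(4)[OF that(2)] that unfolding disjoint_family_on_def by blast
    \<comment> \<open>Over a value in \<open>W\<close> the fibre has no point in \<open>K'\<close>
      and exactly one in each \<open>U v\<close>, given by the local inverse there.\<close>
    have "bij_betw (\<lambda>v. \<rho> v (B y)) F (fiber_in K y)"
      unfolding bij_betw_def
    proof
      show "inj_on (\<lambda>v. \<rho> v (B y)) F"
      proof (rule inj_onI, rule ccontr)
        fix u v assume uv: "u \<in> F" "v \<in> F" "\<rho> u (B y) = \<rho> v (B y)" "u \<noteq> v"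
        then show False using \<rho>y(1)[OF uv(1)] \<rho>y(1)[OF uv(2)] disj[of u v] by auto
      qed
      show "(\<lambda>v. \<rho> v (B y)) ` F = fiber_in K y"
      proof (intro equalityI subsetI)
        fix x assume "x \<in> (\<lambda>v. \<rho> v (B y)) ` F"
        then obtain v where v: "v \<in> F" "x = \<rho> v (B y)" by auto
        then show "x \<in> fiber_in K y"
          using \<rho>y[OF v(1)] U(3)[OF v(1)] interior_subset by (auto simp: fiber_in_def)
      next
        fix x assume x: "x \<in> fiber_in K y"
        have "x \<notin> K'"
        proof
          assume "x \<in> K'"
          then have "B y \<in> B ` K'" using x by (intro image_eqI[of _ _ x]) (simp_all add: fiber_in_def)
          then show False using y(2) s(2) by (auto simp: W_def)
        qed
        then obtain v where v: "v \<in> F" "x \<in> U v" using x by (auto simp: K'_def fiber_in_def)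
        have "x = \<rho> v (B y)" using U(7)[OF v] x by (simp add: fiber_in_def)
        then show "x \<in> (\<lambda>v. \<rho> v (B y)) ` F" using v(1) by blast
      qed
    qed
    then have "(\<Sum>w\<in>fiber_in K y. \<phi> (fiber_coeff y w)) = (\<Sum>v\<in>F. \<phi> (fiber_coeff y (\<rho> v (B y))))"
      by (rule sum.reindex_bij_betw[symmetric])
    also have "\<dots> = (\<Sum>v\<in>F. \<phi> (fiber_coeff z v))"
    proof (intro sum.cong refl arg_cong[where f = \<phi>])
      fix v assume v: "v \<in> F"
      have "fiber_coeff (\<sigma> (B y)) (\<rho> v (B y)) = fiber_coeff (\<sigma> (B z)) (\<rho> v (B z))"
      proof (rule fiber_coeff_locally_constant[OF V(3,4,5,6,7) _ U(5,6,7,8)[OF v]])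
        show "U v \<subseteq> unit_disk" using U(3)[OF v] K(2) interior_subset by blast
        show "ball (B z) s \<subseteq> B ` V" "ball (B z) s \<subseteq> B ` U v" using s(2) v by (auto simp: W_def)
      qed (use y s in auto)
      moreover have "\<sigma> (B y) = y" "\<sigma> (B z) = z" using V y by auto
      moreover have "\<rho> v (B z) = v" using U(7)[OF v U(2)[OF v]] v by (simp add: F_def fiber_in_def)
      ultimately show "fiber_coeff y (\<rho> v (B y)) = fiber_coeff z v" by simp
    qed
    finally show ?case by (simp add: F_def)
  qed
qed

lemma fiber_coeff_diagonal_locally_constant:
  assumes z: "z \<in> unit_disk" "deriv B z \<noteq> 0"
  shows "\<forall>\<^sub>F y in nhds z. fiber_coeff z z = fiber_coeff y y"
proof -
  obtain V \<sigma> where V: "open V" "z \<in> V" "V \<subseteq> unit_disk" "open (B ` V)" "\<sigma> holomorphic_on (B ` V)"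
    and V': "\<forall>x\<in>V. \<sigma> (B x) = x \<and> deriv B x \<noteq> 0"
    by (rule symbol_local_inverse[OF z(1) open_ball order_refl z(2)]) (rule that)
  have V'': "\<sigma> (B x) = x" "deriv B x \<noteq> 0" if "x \<in> V" for x using V' that by auto
  note V = V V''
  obtain s where s: "s > 0" "ball (B z) s \<subseteq> B ` V" using openE[OF V(4)] V(2) by blast
  have cB: "continuous_on V B" using V(3) B_holomorphic holomorphic_on_imp_continuous_on holomorphic_on_subset by blast
  have "open (V \<inter> B -` ball (B z) s)" by (rule continuous_open_preimage[OF cB V(1) open_ball])
  moreover have "z \<in> V \<inter> B -` ball (B z) s" using V(2) s by simp
  ultimately have "\<forall>\<^sub>F y in nhds z. y \<in> V \<inter> B -` ball (B z) s" by (rule eventually_nhds_in_open)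
  then show ?thesis
  proof eventually_elim
    case (elim y)
    have "fiber_coeff (\<sigma> (B y)) (\<sigma> (B y)) = fiber_coeff (\<sigma> (B z)) (\<sigma> (B z))"
      by (rule fiber_coeff_locally_constant[OF V(3,4,5,6,7) V(3,4,5,6,7) s(2) s(2)]) (use elim s in auto)
    then show ?case using V elim by auto
  qed
qed

text \<open>Around a loop the points of the fibre may be permuted, and with them the entries of a
  row. A sum over the row is insensitive to this, whatever function \<open>\<phi>\<close> of the
  entries is summed.\<close>

lemma fiber_sum_constant:
  assumes K: "compact K" "K \<subseteq> unit_disk" and fr: "\<And>x. x \<in> frontier K \<Longrightarrow> r \<le> cmod (B x)"
    and s: "s < 1" "\<And>x. x \<in> ball 0 s \<Longrightarrow> cmod (B x) < r"
    and z: "z \<in> ball 0 s" "regular_over K z" and y: "y \<in> ball 0 s" "regular_over K y"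
  shows "(\<Sum>w\<in>fiber_in K z. \<phi> (fiber_coeff z w)) = (\<Sum>w\<in>fiber_in K y. \<phi> (fiber_coeff y w) :: complex)"
proof (rule connected_local_const[where A = "{y \<in> ball 0 s. regular_over K y}"
      and f = "\<lambda>z. \<Sum>w\<in>fiber_in K z. \<phi> (fiber_coeff z w)"])
  have sD: "ball 0 s \<subseteq> unit_disk" using s by (simp add: subset_ball)
  show "connected {y \<in> ball 0 s. regular_over K y}"
    using z sD by (intro regular_over_connected[of z] K s) (auto simp: regular_over_def)
  show "\<forall>a\<in>{y \<in> ball 0 s. regular_over K y}. \<forall>\<^sub>F b in at a within {y \<in> ball 0 s. regular_over K y}.
    (\<Sum>w\<in>fiber_in K a. \<phi> (fiber_coeff a w)) = (\<Sum>w\<in>fiber_in K b. \<phi> (fiber_coeff b w))"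
  proof
    fix a assume a: "a \<in> {y \<in> ball 0 s. regular_over K y}"
    have "\<forall>\<^sub>F b in nhds a. (\<Sum>w\<in>fiber_in K a. \<phi> (fiber_coeff a w)) = (\<Sum>w\<in>fiber_in K b. \<phi> (fiber_coeff b w))"
      by (rule fiber_sum_locally_constant[OF K fr]) (use a s sD in \<open>auto simp: regular_over_def\<close>)
    then show "\<forall>\<^sub>F b in at a within {y \<in> ball 0 s. regular_over K y}.
      (\<Sum>w\<in>fiber_in K a. \<phi> (fiber_coeff a w)) = (\<Sum>w\<in>fiber_in K b. \<phi> (fiber_coeff b w))"
      by (auto simp: eventually_at_filter elim: eventually_mono)
  qed
qed (use z y in auto)

text \<open>On the diagonal the same local inverse is followed in both arguments, so no permutation
  can intervene. With the empty compact set the regular points are just those where the derivative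
  of \<open>B\<close> does not vanish.\<close>

lemma fiber_coeff_diagonal_constant:
  assumes z: "z \<in> unit_disk" "deriv B z \<noteq> 0" and y: "y \<in> unit_disk" "deriv B y \<noteq> 0"
  shows "fiber_coeff z z = fiber_coeff y y"
proof -
  define s where "s = (1 + max (cmod z) (cmod y)) / 2"
  have s: "s < 1" "cmod z < s" "cmod y < s" using z y by (auto simp: s_def)
  have sD: "ball 0 s \<subseteq> unit_disk" using s by (simp add: subset_ball)
  let ?A = "{y \<in> ball 0 s. regular_over {} y}"
  show ?thesis
  proof (rule connected_local_const[where A = ?A and f = "\<lambda>z. fiber_coeff z z"])
    show "connected ?A" by (rule regular_over_connected[OF z _ _ s(1)]) auto
    show "\<forall>a\<in>?A. \<forall>\<^sub>F b in at a within ?A. fiber_coeff a a = fiber_coeff b b"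
    proof
      fix a assume a: "a \<in> ?A"
      have "\<forall>\<^sub>F b in nhds a. fiber_coeff a a = fiber_coeff b b"
        by (rule fiber_coeff_diagonal_locally_constant) (use a sD in \<open>auto simp: regular_over_def\<close>)
      then show "\<forall>\<^sub>F b in at a within ?A. fiber_coeff a a = fiber_coeff b b"
        by (auto simp: eventually_at_filter elim: eventually_mono)
    qed
  qed (use z y s in \<open>auto simp: regular_over_def fiber_in_def\<close>)
qed

end

section \<open>Symbols with sparse zeros\<close>

text \<open>In the application \<open>C N * W N\<close> is the Blaschke product of the zeros with index at least \<open>N\<close>, and
  \<open>W N\<close> is the quotient of the linear factors in \<open>factor\<close> by the first \<open>N\<close> Blaschke factors.\<close>

locale sparse_symbol = bounded_symbol B for B +
  fixes a :: "nat \<Rightarrow> complex" and C W :: "nat \<Rightarrow> complex \<Rightarrow> complex" and s t r :: "nat \<Rightarrow> real"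
  assumes a_disk: "a k \<in> unit_disk"
    and a_inj: "inj a"
    and zeros: "x \<in> unit_disk \<Longrightarrow> B x = 0 \<longleftrightarrow> x \<in> range a"
    and simple: "deriv B (a k) \<noteq> 0"
    and s_less: "s N < 1" and t_less: "t N < 1"
    and inner: "k \<le> N \<Longrightarrow> cmod (a k) < s N"
    and s_le_t: "s N \<le> t N"
    and outer: "k > N \<Longrightarrow> cmod (a k) > t N"
    and small: "cmod x < s N \<Longrightarrow> cmod (B x) < r N"
    and large: "cmod x = t N \<Longrightarrow> r N \<le> cmod (B x)"
    and C_hol: "C N holomorphic_on unit_disk" and W_hol: "W N holomorphic_on unit_disk"
    and W_bounded: "\<exists>K. \<forall>x\<in>unit_disk. cmod (W N x) \<le> K"
    and factor: "x \<in> unit_disk \<Longrightarrow> B x = (\<Prod>k<N. x - a k) * C N x"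
    and CW_le: "x \<in> unit_disk \<Longrightarrow> cmod (C N x * W N x) \<le> 1"
    and CW_lim: "x \<in> unit_disk \<Longrightarrow> B x \<noteq> 0 \<Longrightarrow> (\<lambda>N. C N x * W N x) \<longlonglongrightarrow> 1"
begin

lemma B_zero [simp]: "B (a k) = 0"
  using zeros[OF a_disk[of k]] by blast

lemma W_mult_bergman:
  assumes "f \<in> bergman_space"
  shows "(\<lambda>x. W N x * f x) \<in> bergman_space"
proof -
  obtain K where K: "\<forall>x\<in>unit_disk. cmod (W N x) \<le> K" using W_bounded by blast
  then have "K \<ge> 0" using norm_ge_zero[of "W N 0"] by (meson centre_in_ball order_trans zero_less_one)
  then show ?thesis using bergman_mult_bounded[OF assms W_hol, of N K] K by blast
qed

lemma CW_hol: "(\<lambda>x. C N x * W N x) holomorphic_on unit_disk"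
  by (intro holomorphic_on_mult C_hol W_hol)

lemma CW_mult_bergman: "f \<in> bergman_space \<Longrightarrow> (\<lambda>x. (C N x * W N x) * f x) \<in> bergman_space"
  by (rule bergman_mult_bounded[OF _ CW_hol CW_le]) auto

text \<open>Each zero is divided out by a difference quotient. As the zeros are distinct, the
  product of the earlier linear factors is not 0 at the next one, so the quotient obtained so far
  still vanishes there.\<close>

lemma bergman_divide_zeros:
  assumes g: "g \<in> bergman_space" "\<And>k. k < N \<Longrightarrow> g (a k) = 0"
  shows "\<exists>G\<in>bergman_space. \<forall>x\<in>unit_disk. g x = (\<Prod>k<N. x - a k) * G x"
  using g
proof (induction N)
  case (Suc N)
  then obtain G where G: "G \<in> bergman_space" "\<And>x. x \<in> unit_disk \<Longrightarrow> g x = (\<Prod>k<N. x - a k) * G x" by auto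
  have "(\<Prod>k<N. a N - a k) \<noteq> 0" using a_inj by (auto simp: inj_def)
  then have "G (a N) = 0" using Suc.prems(2)[of N] G(2)[OF a_disk[of N]] by simp
  then have "G x = (x - a N) * diff_quot G (a N) x" if "x \<in> unit_disk" for x
    using diff_quot_mult[OF that, of "a N" G] by simp
  then have "g x = (\<Prod>k<Suc N. x - a k) * diff_quot G (a N) x" if "x \<in> unit_disk" for x
    using G(2)[OF that] that by simp
  then show ?case using diff_quot_bergman[OF G(1) a_disk] by blast
qed auto

text \<open>Otherwise \<open>B\<close> would have a double zero at \<open>a j\<close>, against the
  simplicity of its zeros.\<close>

lemma C_nonzero:
  assumes "j < N"
  shows "C N (a j) \<noteq> 0"
proof
  assume C0: "C N (a j) = 0"
  define g where "g x = (\<Prod>k\<in>{..<N} - {j}. x - a k) * C N x" for x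
  have "g holomorphic_on unit_disk" unfolding g_def by (intro holomorphic_intros C_hol)
  then have "(g has_field_derivative deriv g (a j)) (at (a j))"
    by (rule holomorphic_derivI[OF _ open_ball a_disk])
  moreover have "((\<lambda>x. x - a j) has_field_derivative 1) (at (a j))" by (auto intro!: derivative_eq_intros)
  ultimately have "((\<lambda>x. (x - a j) * g x) has_field_derivative 1 * g (a j) + deriv g (a j) * (a j - a j)) (at (a j))"
    by (intro DERIV_mult)
  then have d: "((\<lambda>x. (x - a j) * g x) has_field_derivative 0) (at (a j))"
    by (simp add: g_def C0)
  have "(B has_field_derivative 0) (at (a j))"
  proof (rule has_field_derivative_transform_within_open[OF d open_ball a_disk[of j]])
    fix x assume "x \<in> unit_disk"
    then show "(x - a j) * g x = B x"
      using assms by (simp add: g_def factor[of x N] prod.remove[of "{..<N}" j])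
  qed
  then show False using simple[of j] DERIV_imp_deriv by blast
qed

text \<open>Dominated convergence with majorant \<open>4 * (cmod (f x))\<^sup>2\<close>; the zeros
  of \<open>B\<close>, where no limit is assumed, form a null set.\<close>

lemma CW_mult_tendsto:
  assumes f: "f \<in> bergman_space"
  shows "(\<lambda>N. norm_sq (\<lambda>x. (C N x * W N x) * f x - f x)) \<longlonglongrightarrow> 0"
proof -
  have fm [measurable]: "f \<in> borel_measurable borel" using bergman_measurable[OF f] by simp
  have gm: "(\<lambda>x. (C N x * W N x) * f x) \<in> borel_measurable borel" for N
    using bergman_measurable[OF CW_mult_bergman[OF f]] by simp
  have "(\<lambda>N. LINT x|area_measure. (cmod ((C N x * W N x) * f x - f x))\<^sup>2) \<longlonglongrightarrow> (LINT x|area_measure. 0)"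
  proof (rule integral_dominated_convergence[where w = "\<lambda>x. 4 * (cmod (f x))\<^sup>2"])
    show "integrable area_measure (\<lambda>x. 4 * (cmod (f x))\<^sup>2)"
      using bergman_sq_integrable[OF f] by (simp add: sq_integrable_def)
    show "(\<lambda>x. (cmod ((C N x * W N x) * f x - f x))\<^sup>2) \<in> borel_measurable area_measure" for N
      using gm[of N] by measurable
    show "AE x in area_measure. norm ((cmod ((C N x * W N x) * f x - f x))\<^sup>2) \<le> 4 * (cmod (f x))\<^sup>2" for N
      using AE_unit_disk
    proof eventually_elim
      case (elim x)
      have "cmod ((C N x * W N x) * f x - f x) \<le> cmod ((C N x * W N x) * f x) + cmod (f x)"
        by (rule norm_triangle_ineq4)
      also have "cmod ((C N x * W N x) * f x) \<le> 1 * cmod (f x)"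
        unfolding norm_mult[of "C N x * W N x"] by (intro mult_right_mono CW_le elim) auto
      finally have "(cmod ((C N x * W N x) * f x - f x))\<^sup>2 \<le> (2 * cmod (f x))\<^sup>2"
        by (intro power_mono) auto
      then show ?case by (simp add: power_mult_distrib)
    qed
    show "AE x in area_measure. (\<lambda>N. (cmod ((C N x * W N x) * f x - f x))\<^sup>2) \<longlonglongrightarrow> 0"
      using AE_unit_disk symbol_AE_neq[OF a_disk[of 0] simple[of 0], of 0]
    proof eventually_elim
      case (elim x)
      then have "(\<lambda>N. (cmod ((C N x * W N x) * f x - f x))\<^sup>2) \<longlonglongrightarrow> (cmod (1 * f x - f x))\<^sup>2"
        by (intro tendsto_intros CW_lim) auto
      then show ?case by simp
    qed
  qed simp
  then show ?thesis by (simp add: norm_sq_def)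
qed

end

section \<open>The matrix of coefficients at the zeros\<close>

locale sparse_projection = sparse_symbol B a C W s t r + commuting_projection B P
  for B a C W s t r P
begin

lemma P_tendsto_eval:
  assumes "\<And>n. f n \<in> bergman_space" "g \<in> bergman_space"
    and "(\<lambda>n. norm_sq (\<lambda>x. f n x - g x)) \<longlonglongrightarrow> 0" and "\<rho> < 1"
  shows "uniform_limit (cball 0 \<rho>) (\<lambda>n. P (f n)) (P g) sequentially"
proof (rule bergman_tendsto_eval[OF _ _ _ order_refl \<open>\<rho> < 1\<close>])
  have "norm_sq (\<lambda>x. P (f n) x - P g x) \<le> norm_sq (\<lambda>x. f n x - g x)" for n
    using P_contraction[OF bergman_diff[OF assms(1,2)], of n] P_diff[OF assms(1,2), of n] by simp
  then show "(\<lambda>n. norm_sq (\<lambda>x. P (f n) x - P g x)) \<longlonglongrightarrow> 0"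
    by (intro tendsto_sandwich[OF _ _ tendsto_const assms(3)]) auto
qed (use assms P_bergman in auto)

definition zero_coeff :: "nat \<Rightarrow> nat \<Rightarrow> complex" where
  "zero_coeff k l = fiber_coeff (a k) (a l)"

lemma zero_coeff_hermitian: "zero_coeff k l = cnj (zero_coeff l k)"
  unfolding zero_coeff_def by (intro fiber_coeff_hermitian a_disk simple) simp

lemma zero_coeff_diagonal: "zero_coeff k k = zero_coeff 0 0"
  unfolding zero_coeff_def by (intro fiber_coeff_diagonal_constant a_disk simple)

lemma fiber_in_zeros: "fiber_in (cball 0 (t N)) (a k) = a ` {..N}"
proof (intro equalityI subsetI)
  fix x assume x: "x \<in> fiber_in (cball 0 (t N)) (a k)"
  then have "x \<in> unit_disk" using t_less[of N] by (auto simp: fiber_in_def)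
  with x obtain l where l: "x = a l" using zeros[of x] by (auto simp: fiber_in_def)
  have "\<not> l > N" using outer[of N l] x l by (auto simp: fiber_in_def)
  then show "x \<in> a ` {..N}" using l by auto
next
  fix x assume "x \<in> a ` {..N}"
  then obtain l where "x = a l" "l \<le> N" by auto
  then show "x \<in> fiber_in (cball 0 (t N)) (a k)" using inner[of l N] s_le_t[of N] by (simp add: fiber_in_def)
qed

text \<open>The zeros of \<open>B\<close> inside the circle of radius \<open>t N\<close> are
  \<open>a 0, ..., a N\<close>, and the base point can be moved from \<open>a k\<close> to
  \<open>a k'\<close> within the disk of radius \<open>s N\<close>.\<close>

lemma row_sum_constant:
  assumes "k \<le> N" "k' \<le> N"
  shows "(\<Sum>l\<le>N. \<phi> (zero_coeff k l)) = (\<Sum>l\<le>N. \<phi> (zero_coeff k' l) :: complex)"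
proof -
  have sum: "(\<Sum>l\<le>N. \<phi> (zero_coeff k l)) = (\<Sum>w\<in>fiber_in (cball 0 (t N)) (a k). \<phi> (fiber_coeff (a k) w))" for k
    unfolding fiber_in_zeros zero_coeff_def using inj_on_subset[OF a_inj subset_UNIV]
    by (subst sum.reindex) (auto simp: comp_def)
  have reg: "regular_over (cball 0 (t N)) (a k)" for k
    unfolding regular_over_def fiber_in_zeros using simple by auto
  show ?thesis
    unfolding sum
  proof (rule fiber_sum_constant[OF compact_cball _ _ s_less[of N] small[of _ N] _ reg _ reg])
    show "cball 0 (t N) \<subseteq> unit_disk" using t_less[of N] by auto
    have "cmod (a 0) < t N" using inner[of 0 N] s_le_t[of N] by simp
    then have "t N \<noteq> 0" using norm_ge_zero[of "a 0"] by linarith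
    then show "r N \<le> cmod (B x)" if "x \<in> frontier (cball 0 (t N))" for x
      using that by (intro large) (simp add: frontier_cball sphere_def)
  qed (use inner assms in auto)
qed

text \<open>The difference of the row sums for \<open>Suc N\<close> and for \<open>N\<close> is the
  entry in the last column.\<close>

lemma zero_coeff_column_constant:
  assumes "k \<le> N" "k' \<le> N"
  shows "zero_coeff k (Suc N) = zero_coeff k' (Suc N)"
  using row_sum_constant[of k N k' "\<lambda>x. x"] row_sum_constant[of k "Suc N" k' "\<lambda>x. x"] assms by simp

text \<open>By \<open>zero_coeff_column_constant\<close> and Hermitian symmetry the moduli off the diagonal depend only on
  the larger index. Comparing the sums of squares in rows \<open>0\<close> and \<open>N\<close> shows that they are all equal,
  and then the column bound forces them to be zero.\<close>

lemma zero_coeff_off_diagonal: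
  assumes "k \<noteq> l"
  shows "zero_coeff k l = 0"
proof -
  define \<beta> where "\<beta> l = (cmod (zero_coeff 0 l))\<^sup>2" for l
  have up: "(cmod (zero_coeff k l))\<^sup>2 = \<beta> l" if "k < l" for k l
    using zero_coeff_column_constant[of k "l - 1" 0] that by (simp add: \<beta>_def)
  have down: "(cmod (zero_coeff l k))\<^sup>2 = \<beta> l" if "k < l" for k l
    using up[OF that] zero_coeff_hermitian[of l k] by simp
  \<comment> \<open>Row 0 contributes \<open>\<beta> 0\<close> and then
    \<open>\<beta> 1, ..., \<beta> N\<close>; row \<open>N\<close> contributes \<open>N\<close>
    times \<open>\<beta> N\<close> and the diagonal entry. The diagonal terms agree and
    cancel.\<close>
  have row: "real N * \<beta> N = (\<Sum>l=1..N. \<beta> l)" for N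
  proof -
    have "complex_of_real (\<Sum>l\<le>N. (cmod (zero_coeff 0 l))\<^sup>2) = of_real (\<Sum>l\<le>N. (cmod (zero_coeff N l))\<^sup>2)"
      using row_sum_constant[of 0 N N "\<lambda>x. of_real ((cmod x)\<^sup>2)"] by simp
    then have eq: "(\<Sum>l\<le>N. (cmod (zero_coeff 0 l))\<^sup>2) = (\<Sum>l\<le>N. (cmod (zero_coeff N l))\<^sup>2)"
      by (simp only: of_real_eq_iff)
    have "(\<Sum>l\<le>N. (cmod (zero_coeff 0 l))\<^sup>2) = \<beta> 0 + (\<Sum>l=1..N. \<beta> l)"
      unfolding \<beta>_def by (simp add: sum.atLeast_Suc_atMost flip: atLeast0AtMost)
    moreover have "(\<Sum>l\<le>N. (cmod (zero_coeff N l))\<^sup>2) = (\<Sum>l<N. (cmod (zero_coeff N l))\<^sup>2) + (cmod (zero_coeff N N))\<^sup>2"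
      by (simp add: lessThan_Suc_atMost[symmetric])
    moreover have "(\<Sum>l<N. (cmod (zero_coeff N l))\<^sup>2) = real N * \<beta> N" using down by simp
    moreover have "(cmod (zero_coeff N N))\<^sup>2 = \<beta> 0" by (simp add: zero_coeff_diagonal[of N] \<beta>_def)
    ultimately show ?thesis using eq by simp
  qed
  \<comment> \<open>The identity for \<open>Suc N\<close> minus the one for
    \<open>N\<close>.\<close>
  have step: "\<beta> (Suc N) = \<beta> N" if "N \<ge> 1" for N
  proof -
    have "real N * \<beta> (Suc N) = real N * \<beta> N" using row[of "Suc N"] row[of N] by (simp add: algebra_simps)
    then show ?thesis using that by simp
  qed
  have const: "\<beta> (Suc N) = \<beta> 1" for N
    by (induction N) (auto simp: step)
  obtain K where K: "\<And>F. finite F \<Longrightarrow> (\<And>v. v \<in> F \<Longrightarrow> v \<in> unit_disk \<and> deriv B v \<noteq> 0 \<and> B v = B (a 0)) \<Longrightarrow>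
     (\<Sum>v\<in>F. (cmod (fiber_coeff v (a 0)))\<^sup>2) \<le> K"
    using fiber_coeff_column_bound[OF a_disk simple] by metis
  \<comment> \<open>For every \<open>N\<close>, column 0 has \<open>N\<close> entries off the
    diagonal of squared modulus \<open>\<beta> 1\<close>, while its sums of squares are
    bounded.\<close>
  have "real N * \<beta> 1 \<le> K" for N
  proof -
    have "(\<Sum>v\<in>a ` {1..N}. (cmod (fiber_coeff v (a 0)))\<^sup>2) \<le> K"
      using a_disk simple by (intro K) auto
    also have "(\<Sum>v\<in>a ` {1..N}. (cmod (fiber_coeff v (a 0)))\<^sup>2) = (\<Sum>l=1..N. (cmod (zero_coeff l 0))\<^sup>2)"
      unfolding zero_coeff_def using inj_on_subset[OF a_inj subset_UNIV]
      by (subst sum.reindex) (auto simp: comp_def)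
    also have "\<dots> = (\<Sum>l=1..N. \<beta> 1)"
    proof (rule sum.cong)
      fix l assume "l \<in> {1..N}"
      then show "(cmod (zero_coeff l 0))\<^sup>2 = \<beta> 1" using down[of 0 l] const[of "l - 1"] by simp
    qed simp
    finally show ?thesis by simp
  qed
  then have "\<beta> 1 \<le> 0" by (metis not_le reals_Archimedean3)
  then have "\<beta> (Suc N) = 0" for N using const[of N] by (simp add: \<beta>_def)
  then have z: "\<beta> l = 0" if "l > 0" for l using that by (metis gr0_implies_Suc)
  show ?thesis
  proof (cases "k < l")
    case True
    then show ?thesis using up[OF True] z[of l] by simp
  next
    case False
    then have "l < k" using assms by simp
    then show ?thesis using down[of l k] z[of k] by simp
  qed
qed

section \<open>Values of projected functions at the zeros\<close>

lemma P_vanish_multiple: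
  assumes "g \<in> bergman_space" "\<And>x. x \<in> unit_disk \<Longrightarrow> f x = B x * g x" "f \<in> bergman_space"
  shows "P f (a j) = 0"
proof -
  have "f = (\<lambda>x. B x * g x)"
    using assms bergman_outside by (intro ext) (metis mult_zero_right)
  then show ?thesis using P_mult[OF assms(1)] by simp
qed

lemma diff_quot_zero:
  assumes k: "k < N" and x: "x \<in> unit_disk"
  shows "diff_quot B (a k) x = C N x * (\<Prod>i\<in>{..<N} - {k}. x - a i)"
proof (rule holomorphic_eq_off_point[OF diff_quot_holomorphic[OF B_holomorphic a_disk] _ _ x, where w = "a k"])
  show "(\<lambda>x. C N x * (\<Prod>i\<in>{..<N} - {k}. x - a i)) holomorphic_on unit_disk"
    by (intro holomorphic_intros C_hol)
  fix x assume "x \<in> unit_disk" "x \<noteq> a k"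
  then show "diff_quot B (a k) x = C N x * (\<Prod>i\<in>{..<N} - {k}. x - a i)"
    using k by (simp add: diff_quot_def factor[of x N] prod.remove[of "{..<N}" k])
qed

lemma P_eval_CW:
  assumes h: "h \<in> bergman_space" and j: "j < N"
  shows "P (\<lambda>x. (C N x * W N x) * h x) (a j) = zero_coeff 0 0 * ((C N (a j) * W N (a j)) * h (a j))"
proof -
  define f where "f x = (C N x * W N x) * h x" for x
  have fb: "f \<in> bergman_space" unfolding f_def by (rule CW_mult_bergman[OF h])
  \<comment> \<open>With these coefficients \<open>S\<close> interpolates \<open>f\<close> at the
    first \<open>N\<close> zeros, since the difference quotient at \<open>a k\<close> equals
    \<open>deriv B (a k)\<close> there and vanishes at all other zeros.\<close>
  define b where "b k = f (a k) / deriv B (a k)" for k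
  define S where "S x = (\<Sum>k<N. b k * diff_quot B (a k) x)" for x
  have qb: "diff_quot B (a k) \<in> bergman_space" for k by (intro diff_quot_bergman B_bergman a_disk)
  have Sb: "S \<in> bergman_space" unfolding S_def by (intro bergman_sum bergman_cmult qb)
  have qa: "diff_quot B (a k) (a i) = (if i = k then deriv B (a k) else 0)" for i k
    using a_disk[of i] a_disk[of k] a_inj by (auto simp: diff_quot_def inj_def)
  have Sa: "S (a i) = f (a i)" if "i < N" for i
    unfolding S_def qa using that simple[of i] by (simp add: b_def if_distrib[of "\<lambda>y. _ * y"] sum.delta cong: if_cong)
  \<comment> \<open>The quotient of \<open>f - S\<close> by \<open>C N\<close>: every
    \<open>diff_quot B (a k)\<close> with \<open>k < N\<close> is \<open>C N\<close> times a
    polynomial. As \<open>C N\<close> does not vanish at the first \<open>N\<close> zeros,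
    \<open>H\<close> inherits the zeros of \<open>f - S\<close> there, and splitting them off shows
    that \<open>f - S\<close> is a multiple of \<open>B\<close>.\<close>
  define H where "H x = (if x \<in> unit_disk then W N x * h x - (\<Sum>k<N. b k * (\<Prod>i\<in>{..<N} - {k}. x - a i)) else 0)" for x
  have Hb: "H \<in> bergman_space"
  proof -
    define Q where "Q x = (if x \<in> unit_disk then \<Sum>k<N. b k * (\<Prod>i\<in>{..<N} - {k}. x - a i) else 0)" for x
    have cont: "continuous_on (cball 0 1) (\<lambda>x. \<Sum>k<N. b k * (\<Prod>i\<in>{..<N} - {k}. x - a i))"
      by (intro continuous_intros)
    then have "compact ((\<lambda>x. \<Sum>k<N. b k * (\<Prod>i\<in>{..<N} - {k}. x - a i)) ` cball 0 1)"
      by (intro compact_continuous_image) auto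
    from compact_imp_bounded[OF this, unfolded bounded_iff] obtain K where K: "\<forall>y\<in>(\<lambda>x. \<Sum>k<N. b k * (\<Prod>i\<in>{..<N} - {k}. x - a i)) ` cball 0 1. cmod y \<le> K"
      by (elim exE) (rule that)
    have "(\<lambda>x. \<Sum>k<N. b k * (\<Prod>i\<in>{..<N} - {k}. x - a i)) holomorphic_on unit_disk"
      by (intro holomorphic_intros)
    then have "Q holomorphic_on unit_disk" by (rule holomorphic_transform) (simp add: Q_def)
    then have "Q \<in> bergman_space" by (rule bergman_bounded(1)[of Q K]) (use K in \<open>auto simp: Q_def\<close>)
    from bergman_diff[OF W_mult_bergman[OF h] this] have "(\<lambda>x. W N x * h x - Q x) \<in> bergman_space" .
    moreover have "(\<lambda>x. W N x * h x - Q x) = H" using bergman_outside[OF h] by (auto simp: H_def Q_def)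
    ultimately show ?thesis by simp
  qed
  have fS: "f x - S x = C N x * H x" if "x \<in> unit_disk" for x
    using that unfolding f_def S_def H_def
    by (simp add: diff_quot_zero[of _ N x] right_diff_distrib sum_distrib_left mult_ac)
  have "H (a i) = 0" if "i < N" for i
    using fS[OF a_disk[of i]] Sa[OF that] C_nonzero[OF that] by simp
  from bergman_divide_zeros[OF Hb this] obtain G where G: "G \<in> bergman_space" "\<forall>x\<in>unit_disk. H x = (\<Prod>k<N. x - a k) * G x"
    by blast
  have "f x - S x = B x * G x" if "x \<in> unit_disk" for x
    using fS[OF that] G(2) that by (simp add: factor[of x N])
  then have "P (\<lambda>x. f x - S x) (a j) = 0"
    using P_vanish_multiple[OF G(1) _ bergman_diff[OF fb Sb]] by simp
  then have "P f (a j) = P S (a j)" by (simp add: P_diff fb Sb)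
  also have "P S (a j) = (\<Sum>k<N. b k * P (diff_quot B (a k)) (a j))"
    unfolding S_def by (simp add: P_sum P_cmult bergman_cmult qb)
  also have "\<dots> = (\<Sum>k<N. b k * (deriv B (a j) * zero_coeff j k))"
    using simple by (simp add: zero_coeff_def fiber_coeff_def)
  also have "\<dots> = (\<Sum>k<N. if k = j then b j * (deriv B (a j) * zero_coeff j j) else 0)"
    by (intro sum.cong) (auto simp: zero_coeff_off_diagonal)
  also have "\<dots> = zero_coeff 0 0 * f (a j)"
    using j simple by (simp add: b_def zero_coeff_diagonal[of j])
  finally show ?thesis by (simp add: f_def[abs_def])
qed

lemma P_eval_zero:
  assumes h: "h \<in> bergman_space"
  shows "P h (a j) = zero_coeff 0 0 * h (a j)"
proof -
  have aj: "a j \<in> cball 0 (cmod (a j))" "cmod (a j) < 1" using a_disk[of j] by auto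
  note lim = CW_mult_tendsto[OF h]
  have l1: "(\<lambda>N. (C N (a j) * W N (a j)) * h (a j)) \<longlonglongrightarrow> h (a j)"
    using tendsto_uniform_limitI[OF bergman_tendsto_eval[OF CW_mult_bergman[OF h] h lim order_refl aj(2)] aj(1)] .
  have l2: "(\<lambda>N. P (\<lambda>x. (C N x * W N x) * h x) (a j)) \<longlonglongrightarrow> P h (a j)"
    using tendsto_uniform_limitI[OF P_tendsto_eval[OF CW_mult_bergman[OF h] h lim aj(2)] aj(1)] .
  have "(\<lambda>N. P (\<lambda>x. (C N x * W N x) * h x) (a j)) \<longlonglongrightarrow> zero_coeff 0 0 * h (a j)"
  proof (rule Lim_transform_eventually[OF tendsto_mult[OF tendsto_const[of "zero_coeff 0 0"] l1]])
    show "\<forall>\<^sub>F N in sequentially. zero_coeff 0 0 * ((C N (a j) * W N (a j)) * h (a j)) = P (\<lambda>x. (C N x * W N x) * h x) (a j)"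
      using eventually_gt_at_top[of j] by eventually_elim (simp add: P_eval_CW[OF h])
  qed
  with l2 show ?thesis by (rule LIMSEQ_unique)
qed

text \<open>A function in the range of \<open>P\<close> is a limit of multiples \<open>B * P h\<close>, so the order of vanishing at
  \<open>a 0\<close> that is common to the whole range can always be raised by one.\<close>

lemma P_eq_zero:
  assumes van: "\<And>h j. h \<in> bergman_space \<Longrightarrow> P h (a j) = 0" and f: "f \<in> bergman_space"
  shows "P f = (\<lambda>_. 0)"
proof -
  \<comment> \<open>The induction treats all functions of the range at once, because its step passes
    from \<open>g\<close> to the auxiliary functions \<open>h N\<close>.\<close>
  have "(deriv ^^ m) (P g) (a 0) = 0" if "g \<in> bergman_space" "m < n" for g m n
    using that
  proof (induction n arbitrary: g m)
    case (Suc n)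
    note hyp = Suc.IH and m = Suc.prems(2)
    define u where "u = P g"
    have u: "u \<in> bergman_space" "P u = u" "\<And>k. u (a k) = 0"
      using P_bergman P_idem van Suc.prems(1) by (auto simp: u_def)
    have "\<exists>G\<in>bergman_space. \<forall>x\<in>unit_disk. u x = (\<Prod>k<N. x - a k) * G x" for N
      using bergman_divide_zeros[OF u(1,3)] by blast
    then obtain G where G: "\<And>N. G N \<in> bergman_space" "\<And>N x. x \<in> unit_disk \<Longrightarrow> u x = (\<Prod>k<N. x - a k) * G N x"
      by metis
    define h where "h N x = W N x * G N x" for N x
    have hb: "h N \<in> bergman_space" for N unfolding h_def by (rule W_mult_bergman[OF G(1)])
    \<comment> \<open>The linear factors of \<open>u\<close> and the function \<open>C N\<close>
      make up \<open>B\<close>, so the approximations of \<open>u\<close> are multiples of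
      \<open>B\<close>.\<close>
    have eq: "(\<lambda>x. (C N x * W N x) * u x) = (\<lambda>x. B x * h N x)" for N
    proof
      show "(C N x * W N x) * u x = B x * h N x" for x
      proof (cases "x \<in> unit_disk")
        case True
        then show ?thesis by (simp add: G(2)[of x N] factor[of x N] h_def)
      qed (simp add: bergman_outside[OF u(1)] bergman_outside[OF hb])
    qed
    define \<rho> where "\<rho> = (1 + cmod (a 0)) / 2"
    have \<rho>: "\<rho> < 1" "cmod (a 0) < \<rho>" using a_disk[of 0] by (auto simp: \<rho>_def)
    have "uniform_limit (cball 0 \<rho>) (\<lambda>N. P (\<lambda>x. (C N x * W N x) * u x)) (P u) sequentially"
      by (rule P_tendsto_eval[OF CW_mult_bergman[OF u(1)] u(1) CW_mult_tendsto[OF u(1)] \<rho>(1)])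
    then have "uniform_limit (ball 0 \<rho>) (\<lambda>N x. B x * P (h N) x) u sequentially"
      unfolding eq P_mult[OF hb] u(2) by (rule uniform_limit_on_subset) auto
    moreover have bsub: "ball 0 \<rho> \<subseteq> unit_disk" using \<rho> by (simp add: subset_ball)
    moreover have Phol: "P (h N) holomorphic_on unit_disk" for N by (intro bergman_holomorphic P_bergman hb)
    ultimately have "(\<lambda>N. (deriv ^^ m) (\<lambda>x. B x * P (h N) x) (a 0)) \<longlonglongrightarrow> (deriv ^^ m) u (a 0)"
      using \<rho> by (intro higher_deriv_complex_uniform_limit[where A = "ball 0 \<rho>"] always_eventually allI)
        (auto intro!: holomorphic_on_mult holomorphic_on_subset[OF B_holomorphic] holomorphic_on_subset[OF Phol])
    moreover have "(deriv ^^ m) (\<lambda>x. B x * P (h N) x) (a 0) = 0" for N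
    proof -
      have "(deriv ^^ m) (\<lambda>x. B x * P (h N) x) (a 0)
          = (\<Sum>i=0..m. of_nat (m choose i) * (deriv ^^ i) B (a 0) * (deriv ^^ (m - i)) (P (h N)) (a 0))"
        by (rule higher_deriv_mult[OF B_holomorphic Phol open_ball a_disk])
      also have "\<dots> = 0"
      proof (intro sum.neutral ballI)
        fix i assume "i \<in> {0..m}"
        show "of_nat (m choose i) * (deriv ^^ i) B (a 0) * (deriv ^^ (m - i)) (P (h N)) (a 0) = 0"
        \<comment> \<open>The only term with a derivative of order \<open>m\<close> of
          \<open>P (h N)\<close> carries the factor \<open>B (a 0) = 0\<close>.\<close>
        proof (cases "i = 0")
          case False
          then have "m - i < n" using \<open>i \<in> {0..m}\<close> m by auto
          then show ?thesis using hyp[OF hb] by simp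
        qed simp
      qed
      finally show ?thesis .
    qed
    ultimately show ?case by (simp add: LIMSEQ_const_iff u_def)
  qed simp
  then have "(deriv ^^ m) (P f) (a 0) = 0" for m using f by (metis lessI)
  then have "P f x = 0" if "x \<in> unit_disk" for x
    using holomorphic_fun_eq_0_on_connected[OF bergman_holomorphic[OF P_bergman[OF f]] open_ball connected_ball _ a_disk that] by blast
  then show ?thesis using bergman_outside[OF P_bergman[OF f]] by (intro ext) metis
qed

lemma zero_coeff_idempotent: "zero_coeff 0 0 = 0 \<or> zero_coeff 0 0 = 1"
proof -
  define e :: "complex \<Rightarrow> complex" where "e x = (if x \<in> unit_disk then 1 else 0)" for x
  have "e holomorphic_on unit_disk" by (rule holomorphic_transform[OF holomorphic_on_const[of 1]]) (simp add: e_def)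
  then have eb: "e \<in> bergman_space" by (rule bergman_bounded(1)[of e 1]) (auto simp: e_def)
  have "zero_coeff 0 0 * (zero_coeff 0 0 * e (a 0)) = zero_coeff 0 0 * e (a 0)"
    using P_eval_zero[OF P_bergman[OF eb], of 0] P_idem[OF eb] P_eval_zero[OF eb, of 0] by simp
  then show ?thesis using a_disk[of 0] by (simp add: e_def)
qed

theorem sparse_projection_trivial:
  "(\<forall>f\<in>bergman_space. P f = (\<lambda>_. 0)) \<or> (\<forall>f\<in>bergman_space. P f = f)"
  using zero_coeff_idempotent
proof
  assume "zero_coeff 0 0 = 0"
  then show ?thesis using P_eq_zero P_eval_zero by simp
next
  assume 1: "zero_coeff 0 0 = 1"
  interpret Q: sparse_projection B a C W s t r "\<lambda>f x. f x - P f x"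
    by (intro sparse_projection.intro sparse_symbol_axioms commuting_projection_complement)
  have "P f = f" if f: "f \<in> bergman_space" for f
  proof -
    have "(\<lambda>x. f x - P f x) = (\<lambda>_. 0)"
      by (rule Q.P_eq_zero[OF _ f]) (simp add: P_eval_zero 1)
    then show ?thesis by (metis eq_iff_diff_eq_0 ext)
  qed
  then show ?thesis by blast
qed

end

section \<open>Blaschke products\<close>

lemma one_minus_blaschke_denominator:
  assumes "cmod a < 1" "cmod x \<le> 1"
  shows "1 - cnj a * x \<noteq> 0" "cmod (1 - cnj a * x) \<ge> 1 - cmod x"
proof -
  have "cmod (cnj a * x) \<le> cmod a" using assms by (simp add: norm_mult mult_left_le)
  then have "cmod (cnj a * x) < 1" using assms by simp
  then show "1 - cnj a * x \<noteq> 0" by auto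
  have "cmod (cnj a * x) \<le> cmod x" using assms by (simp add: norm_mult mult_left_le_one_le)
  then show "cmod (1 - cnj a * x) \<ge> 1 - cmod x"
    using norm_triangle_ineq2[of 1 "cnj a * x"] by simp
qed

text \<open>For \<open>cmod a < 1\<close> the right side is positive inside the disk and 0 on the
  unit circle, which gives the modulus of a Blaschke factor in both cases.\<close>

lemma blaschke_factor_norm_sq:
  "(cmod (1 - cnj a * x))\<^sup>2 - (cmod (a - x))\<^sup>2 = (1 - (cmod a)\<^sup>2) * (1 - (cmod x)\<^sup>2)"
  unfolding cmod_power2 by (simp add: power2_eq_square algebra_simps)

lemma norm_blaschke_factor:
  assumes "a \<noteq> 0"
  shows "cmod (blaschke_factor a x) = cmod (a - x) / cmod (1 - cnj a * x)"
  using assms by (simp add: blaschke_factor_def norm_mult norm_divide)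

lemma blaschke_factor_less_1:
  assumes "a \<noteq> 0" "cmod a < 1" "cmod x < 1"
  shows "cmod (blaschke_factor a x) < 1"
proof -
  have "(1 - (cmod a)\<^sup>2) * (1 - (cmod x)\<^sup>2) > 0"
    using assms by (intro mult_pos_pos) (auto simp: power_less_one_iff abs_square_less_1)
  then have "(cmod (a - x))\<^sup>2 < (cmod (1 - cnj a * x))\<^sup>2" using blaschke_factor_norm_sq[of a x] by linarith
  then have "cmod (a - x) < cmod (1 - cnj a * x)" by (rule power_less_imp_less_base) simp
  then show ?thesis
    using one_minus_blaschke_denominator(1)[of a x] assms by (simp add: norm_blaschke_factor)
qed

lemma blaschke_factor_eq_1:
  assumes "a \<noteq> 0" "cmod a < 1" "cmod x = 1"
  shows "cmod (blaschke_factor a x) = 1"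
proof -
  have "(cmod (a - x))\<^sup>2 = (cmod (1 - cnj a * x))\<^sup>2" using blaschke_factor_norm_sq[of a x] assms by simp
  then have "cmod (a - x) = cmod (1 - cnj a * x)" by simp
  then show ?thesis
    using one_minus_blaschke_denominator(1)[of a x] assms by (simp add: norm_blaschke_factor)
qed

text \<open>Over the denominator \<open>a * (1 - cnj a * x)\<close> the numerator of the deviation
  is \<open>(1 - cmod a) * (a + cmod a * x)\<close>; so the deviations from 1 are summable along a
  Blaschke sequence.\<close>

lemma one_minus_blaschke_factor:
  assumes a: "a \<noteq> 0" "cmod a < 1" and x: "cmod x < 1"
  shows "cmod (1 - blaschke_factor a x) \<le> 2 * (1 - cmod a) / (1 - cmod x)"
proof -
  have d: "1 - cnj a * x \<noteq> 0" "cmod (1 - cnj a * x) \<ge> 1 - cmod x"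
    using one_minus_blaschke_denominator[of a x] a x by auto
  have aa: "a * cnj a = of_real (cmod a) * of_real (cmod a)"
    using complex_norm_square[of a] by (simp add: power2_eq_square)
  have "1 - blaschke_factor a x = (a * (1 - cnj a * x) - of_real (cmod a) * (a - x)) / (a * (1 - cnj a * x))"
    using a d by (simp add: blaschke_factor_def divide_simps)
  also have "a * (1 - cnj a * x) - of_real (cmod a) * (a - x) = of_real (1 - cmod a) * (a + of_real (cmod a) * x)"
  proof -
    have "a * (1 - cnj a * x) = a - (a * cnj a) * x" by (simp add: algebra_simps)
    then show ?thesis unfolding aa by (simp add: algebra_simps)
  qed
  finally have "cmod (1 - blaschke_factor a x) = (1 - cmod a) * cmod (a + of_real (cmod a) * x) / (cmod a * cmod (1 - cnj a * x))"
    using a by (simp add: norm_divide norm_mult del: of_real_diff)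
  also have "\<dots> \<le> (1 - cmod a) * (2 * cmod a) / (cmod a * (1 - cmod x))"
  proof (intro frac_le mult_left_mono)
    have "cmod (a + of_real (cmod a) * x) \<le> cmod a + cmod a * cmod x"
      using norm_triangle_ineq[of a "of_real (cmod a) * x"] by (simp add: norm_mult)
    also have "cmod a * cmod x \<le> cmod a" using x by (simp add: mult_left_le)
    finally show "cmod (a + of_real (cmod a) * x) \<le> 2 * cmod a" by simp
  qed (use a x d in auto)
  also have "\<dots> = 2 * (1 - cmod a) / (1 - cmod x)" using a by simp
  finally show ?thesis .
qed

lemma blaschke_factor_holomorphic:
  assumes "cmod a < 1"
  shows "blaschke_factor a holomorphic_on unit_disk"
proof (cases "a = 0")
  case True
  then show ?thesis by (simp add: blaschke_factor_def[abs_def] holomorphic_on_ident)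
next
  case False
  have "(\<lambda>x. of_real (cmod a) / a * ((a - x) / (1 - cnj a * x))) holomorphic_on unit_disk"
    using one_minus_blaschke_denominator(1)[OF assms] by (intro holomorphic_intros) auto
  then show ?thesis using False by (simp add: blaschke_factor_def[abs_def])
qed

lemma blaschke_factor_continuous:
  assumes "a \<noteq> 0" "cmod a < 1"
  shows "continuous_on (cball 0 1) (blaschke_factor a)"
proof -
  have "continuous_on (cball 0 1) (\<lambda>x. of_real (cmod a) / a * ((a - x) / (1 - cnj a * x)))"
    using one_minus_blaschke_denominator(1)[OF assms(2)] by (intro continuous_intros) auto
  then show ?thesis using assms by (simp add: blaschke_factor_def[abs_def])
qed

lemma blaschke_factor_eq_0:
  assumes "a \<noteq> 0" "cmod a < 1" "cmod x < 1"
  shows "blaschke_factor a x = 0 \<longleftrightarrow> x = a"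
  using one_minus_blaschke_denominator(1)[of a x] assms by (auto simp: blaschke_factor_def)

text \<open>Zeros at the origin are excluded, so that every factor has the normalized form; repeated
  zeros are allowed.\<close>

locale blaschke_zeros =
  fixes w :: "nat \<Rightarrow> complex"
  assumes w_nonzero: "w k \<noteq> 0" and w_less: "cmod (w k) < 1"
    and w_summable: "summable (\<lambda>k. 1 - cmod (w k))"
begin

lemma factor_le: "cmod x < 1 \<Longrightarrow> cmod (blaschke_factor (w k) x) \<le> 1"
  using blaschke_factor_less_1[OF w_nonzero w_less, of x k] by simp

lemma blaschke_convergent:
  assumes "cmod x < 1"
  shows "convergent_prod (\<lambda>k. blaschke_factor (w k) x)"
proof -
  have "summable (\<lambda>k. (2 / (1 - cmod x)) * (1 - cmod (w k)))" by (intro summable_mult w_summable)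
  then have "summable (\<lambda>k. norm (blaschke_factor (w k) x - 1))"
    by (rule summable_comparison_test'[where N = 0])
      (use one_minus_blaschke_factor[OF w_nonzero w_less assms] in \<open>simp add: norm_minus_commute\<close>)
  then show ?thesis
    by (intro abs_convergent_prod_imp_convergent_prod summable_imp_abs_convergent_prod)
qed

lemma blaschke_product_tendsto:
  assumes "cmod x < 1"
  shows "(\<lambda>N. \<Prod>k<N. blaschke_factor (w k) x) \<longlonglongrightarrow> blaschke_product w x"
  unfolding blaschke_product_def
  using convergent_prod_LIMSEQ[OF blaschke_convergent[OF assms]]
  by (subst LIMSEQ_lessThan_iff_atMost) (simp add: lessThan_Suc_atMost)

lemma partial_le: "cmod x < 1 \<Longrightarrow> cmod (\<Prod>k<N. blaschke_factor (w k) x) \<le> 1"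
  unfolding prod_norm[symmetric] by (intro prod_le_1) (auto intro: factor_le)

lemma blaschke_product_le: "cmod x < 1 \<Longrightarrow> cmod (blaschke_product w x) \<le> 1"
  by (rule tendsto_upperbound[OF tendsto_norm[OF blaschke_product_tendsto]]) (auto intro!: always_eventually partial_le)

text \<open>For factors in the closed unit disk the deviation of a product from 1 is at most the sum
  of the deviations of the factors. Applied to a tail, the bound measures how little the remaining
  zeros change the product on a smaller disk.\<close>

lemma one_minus_blaschke_product:
  assumes x: "cmod x < 1"
  shows "cmod (1 - blaschke_product w x) \<le> 2 / (1 - cmod x) * (\<Sum>k. 1 - cmod (w k))"
proof -
  have "cmod (1 - (\<Prod>k<N. blaschke_factor (w k) x)) \<le> 2 / (1 - cmod x) * (\<Sum>k. 1 - cmod (w k))" for N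
  proof -
    have "cmod ((\<Prod>k<N. 1) - (\<Prod>k<N. blaschke_factor (w k) x)) \<le> (\<Sum>k<N. cmod (1 - blaschke_factor (w k) x))"
      by (intro norm_prod_diff) (auto intro: factor_le[OF x])
    also have "\<dots> \<le> (\<Sum>k<N. 2 / (1 - cmod x) * (1 - cmod (w k)))"
      using one_minus_blaschke_factor[OF w_nonzero w_less x] by (intro sum_mono) simp
    also have "\<dots> = 2 / (1 - cmod x) * (\<Sum>k<N. 1 - cmod (w k))" by (simp add: sum_distrib_left)
    also have "\<dots> \<le> 2 / (1 - cmod x) * (\<Sum>k. 1 - cmod (w k))"
      using x w_less by (intro mult_left_mono sum_le_suminf w_summable) (auto simp: less_imp_le)
    finally show ?thesis by simp
  qed
  then show ?thesis
    by (intro tendsto_upperbound[OF tendsto_norm[OF tendsto_diff[OF tendsto_const blaschke_product_tendsto[OF x]]]]) auto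
qed

lemma shifted: "blaschke_zeros (\<lambda>k. w (k + N))"
  by unfold_locales (use w_nonzero w_less w_summable in \<open>auto simp: summable_iff_shift[of "\<lambda>k. 1 - cmod (w k)"]\<close>)

lemma blaschke_product_split:
  assumes x: "cmod x < 1"
  shows "blaschke_product w x = (\<Prod>k<N. blaschke_factor (w k) x) * blaschke_product (\<lambda>k. w (k + N)) x"
proof -
  interpret S: blaschke_zeros "\<lambda>k. w (k + N)" by (rule shifted)
  have "(\<lambda>n. \<Prod>k<n + N. blaschke_factor (w k) x) \<longlonglongrightarrow> blaschke_product w x"
    using blaschke_product_tendsto[OF x] by (rule LIMSEQ_ignore_initial_segment)
  moreover have "(\<Prod>k<n + N. blaschke_factor (w k) x) = (\<Prod>k<N. blaschke_factor (w k) x) * (\<Prod>k<n. blaschke_factor (w (k + N)) x)" for n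
    by (induction n) (auto simp: mult_ac)
  ultimately have "(\<lambda>n. (\<Prod>k<N. blaschke_factor (w k) x) * (\<Prod>k<n. blaschke_factor (w (k + N)) x)) \<longlonglongrightarrow> blaschke_product w x"
    by simp
  moreover have "(\<lambda>n. (\<Prod>k<N. blaschke_factor (w k) x) * (\<Prod>k<n. blaschke_factor (w (k + N)) x))
      \<longlonglongrightarrow> (\<Prod>k<N. blaschke_factor (w k) x) * blaschke_product (\<lambda>k. w (k + N)) x"
    by (intro tendsto_mult tendsto_const S.blaschke_product_tendsto x)
  ultimately show ?thesis by (rule LIMSEQ_unique)
qed

lemma blaschke_product_eq_0:
  assumes x: "cmod x < 1"
  shows "blaschke_product w x = 0 \<longleftrightarrow> x \<in> range w"
proof
  assume "blaschke_product w x = 0"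
  then obtain k where "blaschke_factor (w k) x = 0"
    using prodinf_nonzero[OF blaschke_convergent[OF x]] unfolding blaschke_product_def by blast
  then show "x \<in> range w" using blaschke_factor_eq_0[OF w_nonzero w_less x, of k] by simp
next
  assume "x \<in> range w"
  then obtain k where k: "x = w k" by blast
  then have "blaschke_factor (w k) x = 0" using blaschke_factor_eq_0[OF w_nonzero w_less x, of k] by simp
  then show "blaschke_product w x = 0" by (simp add: blaschke_product_split[OF x, of "Suc k"])
qed

lemma tail_sum_tendsto: "(\<lambda>N. \<Sum>k. 1 - cmod (w (k + N))) \<longlonglongrightarrow> 0"
  using suminf_exist_split2[OF w_summable] by simp

text \<open>The distance from a partial product to the full one is at most the deviation of the tail
  from 1, which tends to 0 uniformly on smaller disks.\<close>

lemma blaschke_product_holomorphic: "blaschke_product w holomorphic_on unit_disk"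
proof (rule holomorphic_uniform_sequence[OF open_ball])
  show "(\<lambda>x. \<Prod>k<N. blaschke_factor (w k) x) holomorphic_on unit_disk" for N
    by (intro holomorphic_on_prod blaschke_factor_holomorphic w_less)
  fix x :: complex assume x: "x \<in> unit_disk"
  obtain d where d: "d > 0" "cball x d \<subseteq> unit_disk" using disk_contains_cball[OF x] .
  have "compact (cmod ` cball x d)" by (intro compact_continuous_image continuous_intros compact_cball)
  then obtain y where y: "y \<in> cball x d" "\<And>v. v \<in> cball x d \<Longrightarrow> cmod v \<le> cmod y"
    using compact_attains_sup[of "cmod ` cball x d"] d by fastforce
  define \<rho> where "\<rho> = cmod y"
  have \<rho>: "\<rho> < 1" using y d by (auto simp: \<rho>_def)
  have "uniform_limit (cball x d) (\<lambda>N x. \<Prod>k<N. blaschke_factor (w k) x) (blaschke_product w) sequentially"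
  proof (rule uniform_limitI)
    fix e :: real assume e: "e > 0"
    have "(\<lambda>N. 2 / (1 - \<rho>) * (\<Sum>k. 1 - cmod (w (k + N)))) \<longlonglongrightarrow> 2 / (1 - \<rho>) * 0"
      by (intro tendsto_mult tendsto_const tail_sum_tendsto)
    then have "\<forall>\<^sub>F N in sequentially. 2 / (1 - \<rho>) * (\<Sum>k. 1 - cmod (w (k + N))) < e"
      using e by (intro order_tendstoD(2)) auto
    then show "\<forall>\<^sub>F N in sequentially. \<forall>v\<in>cball x d. dist (\<Prod>k<N. blaschke_factor (w k) v) (blaschke_product w v) < e"
    proof eventually_elim
      case (elim N)
      interpret S: blaschke_zeros "\<lambda>k. w (k + N)" by (rule shifted)
      have sum0: "0 \<le> (\<Sum>k. 1 - cmod (w (k + N)))"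
        using S.w_summable by (intro suminf_nonneg) (auto intro: less_imp_le w_less)
      show ?case
      proof
        fix v assume v: "v \<in> cball x d"
        then have v1: "cmod v < 1" "cmod v \<le> \<rho>" using d y by (auto simp: \<rho>_def)
        have "dist (\<Prod>k<N. blaschke_factor (w k) v) (blaschke_product w v)
            = cmod (\<Prod>k<N. blaschke_factor (w k) v) * cmod (1 - blaschke_product (\<lambda>k. w (k + N)) v)"
          unfolding dist_norm blaschke_product_split[OF v1(1), of N] norm_mult[symmetric] by (simp add: right_diff_distrib)
        also have "\<dots> \<le> 1 * cmod (1 - blaschke_product (\<lambda>k. w (k + N)) v)"
          by (intro mult_right_mono partial_le v1) auto
        also have "\<dots> \<le> 2 / (1 - cmod v) * (\<Sum>k. 1 - cmod (w (k + N)))"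
          using S.one_minus_blaschke_product[OF v1(1)] by simp
        also have "\<dots> \<le> 2 / (1 - \<rho>) * (\<Sum>k. 1 - cmod (w (k + N)))"
          using v1 \<rho> sum0 by (intro mult_right_mono divide_left_mono) auto
        also have "\<dots> < e" by (rule elim)
        finally show "dist (\<Prod>k<N. blaschke_factor (w k) v) (blaschke_product w v) < e" .
      qed
    qed
  qed
  with d show "\<exists>d>0. cball x d \<subseteq> unit_disk \<and>
    uniform_limit (cball x d) (\<lambda>N x. \<Prod>k<N. blaschke_factor (w k) x) (blaschke_product w) sequentially" by blast
qed

lemma blaschke_tail_tendsto:
  assumes x: "cmod x < 1"
  shows "(\<lambda>N. blaschke_product (\<lambda>k. w (k + N)) x) \<longlonglongrightarrow> 1"
proof -
  have "(\<lambda>N. 1 - blaschke_product (\<lambda>k. w (k + N)) x) \<longlonglongrightarrow> 0"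
  proof (rule Lim_null_comparison)
    show "\<forall>\<^sub>F N in sequentially. norm (1 - blaschke_product (\<lambda>k. w (k + N)) x) \<le> 2 / (1 - cmod x) * (\<Sum>k. 1 - cmod (w (k + N)))"
      using blaschke_zeros.one_minus_blaschke_product[OF shifted x] by auto
    have "(\<lambda>N. 2 / (1 - cmod x) * (\<Sum>k. 1 - cmod (w (k + N)))) \<longlonglongrightarrow> 2 / (1 - cmod x) * 0"
      by (intro tendsto_mult tendsto_const tail_sum_tendsto)
    then show "(\<lambda>N. 2 / (1 - cmod x) * (\<Sum>k. 1 - cmod (w (k + N)))) \<longlonglongrightarrow> 0" by simp
  qed
  from tendsto_diff[OF tendsto_const[of 1] this] show ?thesis by simp
qed

end

section \<open>Choice of the subsequence\<close>

definition separated_at :: "(nat \<Rightarrow> complex) \<Rightarrow> nat \<Rightarrow> bool" where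
  "separated_at b N \<longleftrightarrow> (\<exists>s t r. s < 1 \<and> t < 1 \<and> s \<le> t \<and> (\<forall>k\<le>N. cmod (b k) < s) \<and> (\<forall>k>N. t < cmod (b k)) \<and>
     (\<forall>x. cmod x < s \<longrightarrow> cmod (blaschke_product b x) < r) \<and>
     (\<forall>x. cmod x = t \<longrightarrow> r \<le> cmod (blaschke_product b x)))"

text \<open>The tolerance \<open>\<eta>\<close> refers to the first \<open>Suc N\<close> zeros only.
  This makes a recursive choice possible: later zeros cannot destroy the separation at
  \<open>N\<close> as long as their distances to the unit circle add up to at most
  \<open>\<eta>\<close>.\<close>

definition separating_tail :: "(nat \<Rightarrow> complex) \<Rightarrow> nat \<Rightarrow> real \<Rightarrow> bool" where
  "separating_tail a N \<eta> \<longleftrightarrow> \<eta> > 0 \<and> (\<forall>b. (\<forall>k\<le>N. b k = a k) \<longrightarrow> blaschke_zeros b \<longrightarrow>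
     (\<Sum>k. 1 - cmod (b (k + Suc N))) \<le> \<eta> \<longrightarrow> separated_at b N)"

text \<open>The product \<open>F\<close> of the first factors has modulus 1 on the unit circle and
  less inside. It is thus at most some \<open>\<rho> < 1\<close> on a disk containing its zeros and
  exceeds a larger level near the unit circle; a tail close to 1 preserves a gap.\<close>

lemma separating_tail_exists:
  assumes a: "\<And>k. k \<le> N \<Longrightarrow> a k \<noteq> 0 \<and> cmod (a k) < 1"
  shows "\<exists>\<eta>. separating_tail a N \<eta>"
proof -
  define F where "F x = (\<Prod>k<Suc N. blaschke_factor (a k) x)" for x
  have Fc: "continuous_on (cball 0 1) F"
    unfolding F_def using a by (intro continuous_on_prod blaschke_factor_continuous) auto
  have F1: "cmod (F x) = 1" if "cmod x = 1" for x
    unfolding F_def prod_norm[symmetric] using a that by (intro prod.neutral) (auto intro: blaschke_factor_eq_1)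
  have Fl: "cmod (F x) < 1" if "cmod x < 1" for x
  proof -
    have "cmod (F x) = (\<Prod>k<N. cmod (blaschke_factor (a k) x)) * cmod (blaschke_factor (a N) x)"
      by (simp add: F_def prod_norm[symmetric] norm_mult)
    also have "\<dots> \<le> 1 * cmod (blaschke_factor (a N) x)"
    proof (intro mult_right_mono prod_le_1)
      fix k assume "k \<in> {..<N}"
      then show "0 \<le> cmod (blaschke_factor (a k) x) \<and> cmod (blaschke_factor (a k) x) \<le> 1"
        using blaschke_factor_less_1[of "a k" x] a[of k] that by auto
    qed simp
    also have "\<dots> < 1" using blaschke_factor_less_1[of "a N" x] a[of N] that by simp
    finally show ?thesis .
  qed
  define m where "m = Max ((\<lambda>k. cmod (a k)) ` {..N})"
  have mk: "cmod (a k) \<le> m" if "k \<le> N" for k unfolding m_def using that by (intro Max_ge) auto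
  have m: "m < 1" unfolding m_def using a by (subst Max_less_iff) auto
  define s where "s = (1 + m) / 2"
  have s: "s < 1" "m < s" using m by (auto simp: s_def)
  have s0: "s \<ge> 0" using mk[of 0] s(2) norm_ge_zero[of "a 0"] by linarith
  have "continuous_on (cball 0 s) (\<lambda>x. cmod (F x))"
    using s by (intro continuous_on_norm continuous_on_subset[OF Fc]) auto
  then obtain y where y: "y \<in> cball 0 s" "\<And>x. x \<in> cball 0 s \<Longrightarrow> cmod (F x) \<le> cmod (F y)"
    using continuous_attains_sup[OF compact_cball, of 0 s "\<lambda>x. cmod (F x)"] s0 by force
  define \<rho> where "\<rho> = cmod (F y)"
  have \<rho>: "0 \<le> \<rho>" "\<rho> < 1" using Fl[of y] y s by (auto simp: \<rho>_def)
  \<comment> \<open>Levels \<open>\<rho> < r < R < 1\<close>: \<open>F\<close> is at most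
    \<open>\<rho>\<close> on the disk and above \<open>R\<close> on the circle, and the gap between
    \<open>r\<close> and \<open>R\<close> is left for the tail.\<close>
  define R r where "R = (1 + \<rho>) / 2" and "r = (\<rho> + R) / 2"
  have R: "\<rho> < R" "R < 1" using \<rho> by (auto simp: R_def)
  then have Rr: "\<rho> < r" "r < R" "R < 1" "0 < R" "0 < r" using \<rho>(1) by (auto simp: r_def)
  define L where "L = {x \<in> cball 0 1. cmod (F x) \<le> R}"
  have "compact L"
  proof -
    have "closed (cball 0 1 \<inter> (\<lambda>x. cmod (F x)) -` {..R})"
      by (intro continuous_closed_preimage continuous_on_norm Fc) auto
    moreover have "L = cball 0 1 \<inter> (\<lambda>x. cmod (F x)) -` {..R}" by (auto simp: L_def)
    ultimately show ?thesis unfolding compact_eq_bounded_closed by (auto intro: bounded_subset[OF bounded_cball])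
  qed
  moreover have "y \<in> L" using y(1) s Rr by (auto simp: L_def \<rho>_def)
  ultimately obtain u where u: "u \<in> L" "\<And>x. x \<in> L \<Longrightarrow> cmod x \<le> cmod u"
    using continuous_attains_sup[of L cmod] by (metis continuous_on_norm_id empty_iff)
  have u1: "cmod u < 1"
  proof (rule ccontr)
    assume "\<not> cmod u < 1"
    then have "cmod u = 1" using u(1) by (simp add: L_def)
    from F1[OF this] u(1) Rr show False by (simp add: L_def)
  qed
  \<comment> \<open>All points where \<open>F\<close> has modulus at most \<open>R\<close> lie
    within radius \<open>cmod u < 1\<close>, so a circle of larger radius avoids them.\<close>
  define t where "t = max s ((1 + cmod u) / 2)"
  have t: "t < 1" "s \<le> t" "cmod u < t" using s u1 by (auto simp: t_def less_max_iff_disj)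
  have Ft: "cmod (F x) > R" if "cmod x = t" for x
  proof (rule ccontr)
    assume "\<not> cmod (F x) > R"
    then have "x \<in> L" using that t by (simp add: L_def)
    from u(2)[OF this] that t show False by simp
  qed
  \<comment> \<open>The first bound forces the later zeros outside the circle, since each distance
    to the unit circle is at most the sum. The second keeps the tail at least \<open>r / R\<close>
    in modulus on the circle, so that the product is at least \<open>R * (r / R) = r\<close>
    there.\<close>
  define \<eta> where "\<eta> = min ((1 - t) / 2) ((1 - r / R) * (1 - t) / 2)"
  have "1 - r / R > 0" using Rr by simp
  then have \<eta>: "\<eta> > 0" "\<eta> < 1 - t" using t by (auto simp: \<eta>_def min_less_iff_disj)
  have "2 / (1 - t) * \<eta> \<le> 2 / (1 - t) * ((1 - r / R) * (1 - t) / 2)"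
    unfolding \<eta>_def using t by (intro mult_left_mono min.cobounded2) auto
  also have "\<dots> = 1 - r / R" using t by simp
  finally have \<eta>3: "2 / (1 - t) * \<eta> \<le> 1 - r / R" .
  have "separated_at b N" if b: "\<forall>k\<le>N. b k = a k" "blaschke_zeros b" "(\<Sum>k. 1 - cmod (b (k + Suc N))) \<le> \<eta>" for b
  proof -
    interpret b: blaschke_zeros b by fact
    interpret T: blaschke_zeros "\<lambda>k. b (k + Suc N)" by (rule b.shifted)
    have split: "blaschke_product b x = F x * blaschke_product (\<lambda>k. b (k + Suc N)) x" if "cmod x < 1" for x
      unfolding b.blaschke_product_split[OF that, of "Suc N"] F_def using b(1) by (auto intro!: prod.cong)
    have "t < cmod (b k)" if k: "k > N" for k
    proof -
      have "(\<Sum>i\<in>{k - Suc N}. 1 - cmod (b (i + Suc N))) \<le> (\<Sum>i. 1 - cmod (b (i + Suc N)))"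
        by (rule sum_le_suminf[OF T.w_summable]) (auto intro: less_imp_le b.w_less)
      then have "1 - cmod (b k) \<le> \<eta>" using b(3) k by simp
      then show ?thesis using \<eta> by simp
    qed
    moreover have "cmod (blaschke_product b x) < r" if "cmod x < s" for x
    proof -
      have x: "cmod x < 1" using that s by simp
      have "cmod (blaschke_product b x) \<le> cmod (F x) * 1"
        unfolding split[OF x] norm_mult by (intro mult_left_mono T.blaschke_product_le x) auto
      also have "\<dots> \<le> \<rho>" using y(2)[of x] that by (simp add: \<rho>_def)
      finally show ?thesis using Rr by simp
    qed
    moreover have "r \<le> cmod (blaschke_product b x)" if "cmod x = t" for x
    proof -
      let ?T = "blaschke_product (\<lambda>k. b (k + Suc N)) x"
      have x: "cmod x < 1" using that t by simp
      have "cmod (1 - ?T) \<le> 2 / (1 - t) * (\<Sum>k. 1 - cmod (b (k + Suc N)))"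
        using T.one_minus_blaschke_product[OF x] that by simp
      also have "\<dots> \<le> 2 / (1 - t) * \<eta>" using b(3) t by (intro mult_left_mono) auto
      also have "\<dots> \<le> 1 - r / R" by (rule \<eta>3)
      finally have T: "cmod ?T \<ge> r / R" using norm_triangle_ineq2[of 1 "1 - ?T"] by simp
      have "r = R * (r / R)" using Rr by simp
      also have "\<dots> \<le> cmod (F x) * cmod ?T" using Ft[OF that] T Rr by (intro mult_mono) auto
      finally show ?thesis unfolding split[OF x] norm_mult .
    qed
    moreover have "cmod (b k) < s" if "k \<le> N" for k using b(1) mk[OF that] s that by auto
    ultimately have "s < 1 \<and> t < 1 \<and> s \<le> t \<and> (\<forall>k\<le>N. cmod (b k) < s) \<and> (\<forall>k>N. t < cmod (b k)) \<and>
      (\<forall>x. cmod x < s \<longrightarrow> cmod (blaschke_product b x) < r) \<and>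
      (\<forall>x. cmod x = t \<longrightarrow> r \<le> cmod (blaschke_product b x))"
      using s t by simp
    then show ?thesis unfolding separated_at_def by blast
  qed
  then show ?thesis unfolding separating_tail_def using \<eta> by blast
qed

lemma separating_tail_cong:
  assumes "\<And>k. k \<le> N \<Longrightarrow> a k = a' k"
  shows "separating_tail a N = separating_tail a' N"
  using assms by (intro ext) (simp add: separating_tail_def)

text \<open>Every new point is taken so close to the unit circle that it respects the tolerances of
  all earlier stages, and these depend only on points already chosen.\<close>

lemma sparse_subsequence:
  fixes z :: "nat \<Rightarrow> complex"
  assumes z: "\<And>n. cmod (z n) < 1" and lim: "(\<lambda>n. cmod (z n)) \<longlonglongrightarrow> 1"
  obtains r :: "nat \<Rightarrow> nat" where "strict_mono r" "inj (z \<circ> r)" "blaschke_zeros (z \<circ> r)" "\<And>N. separated_at (z \<circ> r) N"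
proof -
  define tail where "tail f N = (SOME \<eta>. separating_tail (\<lambda>k. z (f k)) N \<eta>)" for f :: "nat \<Rightarrow> nat" and N
  \<comment> \<open>Stage \<open>N\<close> distributes its tolerance geometrically: the point of
    index \<open>n\<close> uses at most the fraction \<open>(1 / 2) ^ (n - N)\<close>, and these add
    up to 1. The bound \<open>(1 / 2) ^ n\<close> gives summability, increasing moduli give
    injectivity, and moduli above \<open>1 / 2\<close> avoid the origin.\<close>
  define Q where "Q f n m \<longleftrightarrow> (\<forall>k<n. f k < m \<and> cmod (z (f k)) < cmod (z m)) \<and> 1 / 2 < cmod (z m) \<and>
    1 - cmod (z m) \<le> (1 / 2) ^ n \<and> (\<forall>N<n. 1 - cmod (z m) \<le> (1 / 2) ^ (n - N) * tail f N)" for f :: "nat \<Rightarrow> nat" and n m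
  have tail_cong: "tail f N = tail g N" if "\<And>k. k \<le> N \<Longrightarrow> f k = g k" for f g N
    unfolding tail_def using separating_tail_cong[of N "\<lambda>k. z (f k)" "\<lambda>k. z (g k)"] that by simp
  have tail: "separating_tail (\<lambda>k. z (f k)) N (tail f N)" if "\<And>k. k \<le> N \<Longrightarrow> 1 / 2 < cmod (z (f k))" for f N
    unfolding tail_def
  proof (rule someI_ex, rule separating_tail_exists)
    fix k assume "k \<le> N"
    then show "z (f k) \<noteq> 0 \<and> cmod (z (f k)) < 1" using that[of k] z by auto
  qed
  \<comment> \<open>Course-of-values recursion: \<open>Q f n\<close> looks at \<open>f\<close> below
    \<open>n\<close> only, because \<open>tail f N\<close> does not depend on the values beyond
    index \<open>N\<close>.\<close>
  have "\<exists>f. \<forall>n. Q f n (f n)"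
  proof (rule dependent_wf_choice[OF wf_less_than])
    fix f g :: "nat \<Rightarrow> nat" and n m
    assume fg: "\<And>k. (k, n) \<in> less_than \<Longrightarrow> f k = g k"
    then have "tail f N = tail g N" if "N < n" for N using that by (intro tail_cong) auto
    with fg show "Q f n m = Q g n m" unfolding Q_def by auto
  next
    fix n f
    assume "\<And>k. (k, n) \<in> less_than \<Longrightarrow> Q f k (f k)"
    then have half: "1 / 2 < cmod (z (f k))" if "k < n" for k using that by (auto simp: Q_def)
    have tpos: "tail f N > 0" if "N < n" for N
      using tail[of N f] half that by (auto simp: separating_tail_def)
    have ev: "\<forall>\<^sub>F m in sequentially. 1 - cmod (z m) \<le> e" if "e > 0" for e
      using order_tendstoD(1)[OF lim, of "1 - e"] that by (auto elim!: eventually_mono)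
    have "\<forall>\<^sub>F m in sequentially. (\<forall>k\<in>{..<n}. f k < m \<and> cmod (z (f k)) < cmod (z m)) \<and> 1 / 2 < cmod (z m) \<and>
      1 - cmod (z m) \<le> (1 / 2) ^ n \<and> (\<forall>N\<in>{..<n}. 1 - cmod (z m) \<le> (1 / 2) ^ (n - N) * tail f N)"
      using tpos by (intro eventually_conj eventually_ball_finite ballI eventually_gt_at_top
        order_tendstoD(1)[OF lim] z ev) auto
    then obtain m where "(\<forall>k\<in>{..<n}. f k < m \<and> cmod (z (f k)) < cmod (z m)) \<and> 1 / 2 < cmod (z m) \<and>
      1 - cmod (z m) \<le> (1 / 2) ^ n \<and> (\<forall>N\<in>{..<n}. 1 - cmod (z m) \<le> (1 / 2) ^ (n - N) * tail f N)"
      using eventually_happens'[OF sequentially_bot] by blast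
    then show "\<exists>m. Q f n m" unfolding Q_def by (intro exI[of _ m]) simp
  qed
  then obtain f where f: "\<And>n. Q f n (f n)" by blast
  have half: "1 / 2 < cmod (z (f k))" for k using f[of k] by (simp add: Q_def)
  have mono: "strict_mono f" by (rule strict_monoI) (use f in \<open>auto simp: Q_def\<close>)
  have inc: "cmod (z (f k)) < cmod (z (f n))" if "k < n" for k n using f[of n] that by (simp add: Q_def)
  have inj: "inj (z \<circ> f)"
  proof (rule injI)
    fix k n assume "(z \<circ> f) k = (z \<circ> f) n"
    then show "k = n" using inc[of k n] inc[of n k] by (cases k n rule: linorder_cases) auto
  qed
  have bz: "blaschke_zeros (z \<circ> f)"
  proof
    show "(z \<circ> f) k \<noteq> 0" "cmod ((z \<circ> f) k) < 1" for k using half[of k] z by auto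
    show "summable (\<lambda>k. 1 - cmod ((z \<circ> f) k))"
    proof (rule summable_comparison_test'[where N = 0])
      show "summable (\<lambda>k. (1 / 2 :: real) ^ k)" by (rule summable_geometric) simp
      show "norm (1 - cmod ((z \<circ> f) k)) \<le> (1 / 2) ^ k" for k
        using f[of k] z[of "f k"] by (simp add: Q_def)
    qed
  qed
  have "separated_at (z \<circ> f) N" for N
  proof -
    have st: "separating_tail (\<lambda>k. z (f k)) N (tail f N)" by (rule tail) (rule half)
    have le: "1 - cmod ((z \<circ> f) (k + Suc N)) \<le> tail f N * (1 / 2) ^ Suc k" for k
    proof -
      have "N < k + Suc N \<longrightarrow> 1 - cmod (z (f (k + Suc N))) \<le> (1 / 2) ^ (k + Suc N - N) * tail f N"
        using f[of "k + Suc N"] unfolding Q_def by blast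
      then show ?thesis by (simp add: mult.commute)
    qed
    have S: "(\<lambda>k. tail f N * (1 / 2) ^ Suc k) sums (tail f N * 1)"
      by (intro sums_mult power_half_series)
    have "(\<Sum>k. 1 - cmod ((z \<circ> f) (k + Suc N))) \<le> (\<Sum>k. tail f N * (1 / 2) ^ Suc k)"
      by (rule suminf_le[OF le blaschke_zeros.w_summable[OF blaschke_zeros.shifted[OF bz]] sums_summable[OF S]])
    also have "\<dots> = tail f N * 1" by (rule sums_unique[OF S, symmetric])
    finally have "(\<Sum>k. 1 - cmod ((z \<circ> f) (k + Suc N))) \<le> tail f N" by simp
    then show ?thesis using st bz unfolding separating_tail_def by simp
  qed
  with mono inj bz show thesis by (rule that)
qed

section \<open>From separated zeros to the absence of reducing subspaces\<close>

lemma blaschke_sparse_symbol: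
  assumes bz: "blaschke_zeros w" and inj: "inj w" and sep: "\<And>N. separated_at w N"
  shows "\<exists>C W s t r. sparse_symbol (\<lambda>x. if x \<in> unit_disk then blaschke_product w x else 0) w C W s t r"
proof -
  interpret blaschke_zeros w by fact
  define B where "B x = (if x \<in> unit_disk then blaschke_product w x else 0)" for x
  \<comment> \<open>The Blaschke factor divided by \<open>x - w k\<close>, a function without zeros
    in the disk.\<close>
  define v where "v k x = - of_real (cmod (w k)) / (w k * (1 - cnj (w k) * x))" for k x
  define T where "T N x = blaschke_product (\<lambda>k. w (k + N)) x" for N x
  define C where "C N x = (\<Prod>k<N. v k x) * T N x" for N x
  \<comment> \<open>On the disk this is the reciprocal of the product of the \<open>v k\<close> with
    \<open>k < N\<close>. It is a polynomial, hence bounded there, and turns \<open>C N\<close> into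
    the tail \<open>T N\<close>.\<close>
  define W where "W N x = (\<Prod>k<N. - (w k * (1 - cnj (w k) * x)) / of_real (cmod (w k)))" for N x
  have den: "1 - cnj (w k) * x \<noteq> 0" if "cmod x < 1" for k x
    using one_minus_blaschke_denominator(1)[OF w_less] that by simp
  have v0: "v k x \<noteq> 0" if "cmod x < 1" for k x using den[OF that] w_nonzero by (simp add: v_def)
  have fac: "blaschke_factor (w k) x = (x - w k) * v k x" if "cmod x < 1" for k x
    using den[OF that] w_nonzero by (simp add: blaschke_factor_def v_def field_simps)
  have CW: "C N x * W N x = T N x" if "cmod x < 1" for N x
  proof -
    have "(\<Prod>k<N. v k x) * W N x = (\<Prod>k<N. v k x * (- (w k * (1 - cnj (w k) * x)) / of_real (cmod (w k))))"
      unfolding W_def by (rule prod.distrib[symmetric])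
    also have "\<dots> = 1" using den[OF that] w_nonzero by (intro prod.neutral) (simp add: v_def)
    finally show ?thesis by (simp add: C_def mult_ac)
  qed
  have factor: "B x = (\<Prod>k<N. x - w k) * C N x" if "cmod x < 1" for N x
    using that by (simp add: B_def blaschke_product_split[OF that, of N] C_def T_def fac prod.distrib)
  have Thol: "T N holomorphic_on unit_disk" for N
    unfolding T_def using blaschke_zeros.blaschke_product_holomorphic[OF shifted] by (simp add: eta_contract_eq)
  have Tle: "cmod (T N x) \<le> 1" if "cmod x < 1" for N x
    unfolding T_def using blaschke_zeros.blaschke_product_le[OF shifted that] .
  have Chol: "C N holomorphic_on unit_disk" for N
    unfolding C_def v_def using den w_nonzero by (intro holomorphic_intros Thol) auto
  have Bhol: "B holomorphic_on unit_disk"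
    by (rule holomorphic_transform[OF blaschke_product_holomorphic]) (simp add: B_def)
  have B1: "cmod (B x) \<le> 1" for x using blaschke_product_le by (simp add: B_def)
  have Bb: "B \<in> bergman_space" by (rule bergman_bounded(1)[OF Bhol B1]) (simp add: B_def)
  have simple: "deriv B (w k) \<noteq> 0" for k
  proof -
    define g where "g x = (\<Prod>i<k. x - w i) * C (Suc k) x" for x
    have wk: "w k \<in> unit_disk" using w_less by simp
    have "g holomorphic_on unit_disk" unfolding g_def by (intro holomorphic_intros Chol)
    then have "(g has_field_derivative deriv g (w k)) (at (w k))" by (rule holomorphic_derivI[OF _ open_ball wk])
    moreover have "((\<lambda>x. x - w k) has_field_derivative 1) (at (w k))" by (auto intro!: derivative_eq_intros)
    ultimately have "((\<lambda>x. (x - w k) * g x) has_field_derivative 1 * g (w k) + deriv g (w k) * (w k - w k)) (at (w k))"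
      by (intro DERIV_mult)
    then have d: "((\<lambda>x. (x - w k) * g x) has_field_derivative g (w k)) (at (w k))" by simp
    have "(B has_field_derivative g (w k)) (at (w k))"
      by (rule has_field_derivative_transform_within_open[OF d open_ball wk]) (simp add: g_def factor[of _ "Suc k"])
    then have "deriv B (w k) = g (w k)" by (rule DERIV_imp_deriv)
    \<comment> \<open>As the zeros are distinct, no later factor vanishes at
      \<open>w k\<close>.\<close>
    moreover have "T (Suc k) (w k) \<noteq> 0"
    proof -
      have "w k \<notin> range (\<lambda>i. w (i + Suc k))" using injD[OF inj, of k] by fastforce
      then show ?thesis unfolding T_def using blaschke_zeros.blaschke_product_eq_0[OF shifted w_less] by blast
    qed
    moreover have "(\<Prod>i<k. w k - w i) \<noteq> 0" using inj by (auto simp: inj_def)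
    ultimately show ?thesis using v0[OF w_less] by (simp add: g_def C_def)
  qed
  have "\<forall>N. \<exists>p. fst p < 1 \<and> fst (snd p) < 1 \<and> fst p \<le> fst (snd p) \<and> (\<forall>k\<le>N. cmod (w k) < fst p) \<and> (\<forall>k>N. fst (snd p) < cmod (w k)) \<and>
     (\<forall>x. cmod x < fst p \<longrightarrow> cmod (blaschke_product w x) < snd (snd p)) \<and>
     (\<forall>x. cmod x = fst (snd p) \<longrightarrow> snd (snd p) \<le> cmod (blaschke_product w x))"
    using sep unfolding separated_at_def by simp
  from choice[OF this] obtain p where p: "\<forall>N. fst (p N) < 1 \<and> fst (snd (p N)) < 1 \<and> fst (p N) \<le> fst (snd (p N)) \<and>
     (\<forall>k\<le>N. cmod (w k) < fst (p N)) \<and> (\<forall>k>N. fst (snd (p N)) < cmod (w k)) \<and>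
     (\<forall>x. cmod x < fst (p N) \<longrightarrow> cmod (blaschke_product w x) < snd (snd (p N))) \<and>
     (\<forall>x. cmod x = fst (snd (p N)) \<longrightarrow> snd (snd (p N)) \<le> cmod (blaschke_product w x))"
    by (elim exE) (rule that)
  have "sparse_symbol B w C W (\<lambda>N. fst (p N)) (\<lambda>N. fst (snd (p N))) (\<lambda>N. snd (snd (p N)))"
  proof
    show "B \<in> bergman_space" by (rule Bb)
    show "cmod (B x) \<le> 1" for x by (rule B1)
    show "w k \<in> unit_disk" for k using w_less by simp
    show "inj w" by (rule inj)
    show "B x = 0 \<longleftrightarrow> x \<in> range w" if "x \<in> unit_disk" for x
      using that blaschke_product_eq_0[of x] by (simp add: B_def)
    show "deriv B (w k) \<noteq> 0" for k by (rule simple)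
    show "fst (p N) < 1" "fst (snd (p N)) < 1" "fst (p N) \<le> fst (snd (p N))" for N using p by auto
    show "cmod (w k) < fst (p N)" if "k \<le> N" for k N using p that by auto
    show "fst (snd (p N)) < cmod (w k)" if "k > N" for k N using p that by auto
    show "cmod (B x) < snd (snd (p N))" if "cmod x < fst (p N)" for x N
    proof -
      have "fst (p N) < 1" using p by blast
      then have "cmod x < 1" using that by linarith
      then show ?thesis using p that by (simp add: B_def)
    qed
    show "snd (snd (p N)) \<le> cmod (B x)" if "cmod x = fst (snd (p N))" for x N
    proof -
      have "cmod x < 1" using p that by simp
      then show ?thesis using p that by (simp add: B_def)
    qed
    show "C N holomorphic_on unit_disk" for N by (rule Chol)
    show "W N holomorphic_on unit_disk" for N unfolding W_def using w_nonzero by (intro holomorphic_intros) auto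
    show "\<exists>K. \<forall>x\<in>unit_disk. cmod (W N x) \<le> K" for N
    proof -
      have "continuous_on (cball 0 1) (W N)" unfolding W_def using w_nonzero by (intro continuous_intros) auto
      then have "compact (W N ` cball 0 1)" by (intro compact_continuous_image compact_cball)
      from compact_imp_bounded[OF this, unfolded bounded_iff] obtain K where "\<forall>y\<in>W N ` cball 0 1. cmod y \<le> K"
        by (elim exE) (rule that)
      then show ?thesis by (intro exI[of _ K]) auto
    qed
    show "B x = (\<Prod>k<N. x - w k) * C N x" if "x \<in> unit_disk" for x N using factor that by simp
    show "cmod (C N x * W N x) \<le> 1" if "x \<in> unit_disk" for x N using CW Tle that by simp
    show "(\<lambda>N. C N x * W N x) \<longlonglongrightarrow> 1" if "x \<in> unit_disk" for x
      using CW that blaschke_tail_tendsto[of x] by (simp add: T_def)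
  qed
  then show ?thesis unfolding B_def[abs_def] by blast
qed

theorem theorem5p3:
  fixes z :: "nat \<Rightarrow> complex"
  assumes "\<And>n. z n \<in> unit_disk"
    and "(\<lambda>n. cmod (z n)) \<longlonglongrightarrow> 1"
  shows "\<exists>r :: nat \<Rightarrow> nat. strict_mono r \<and> blaschke_sequence (z \<circ> r) \<and>
    \<not> (\<exists>M. reducing_subspace (mult_op (blaschke_product (z \<circ> r))) M \<and> nontrivial_subspace M)"
proof -
  have "cmod (z n) < 1" for n using assms(1)[of n] by simp
  from sparse_subsequence[OF this assms(2)] obtain r where r: "strict_mono r" "inj (z \<circ> r)" "blaschke_zeros (z \<circ> r)"
    and sep: "\<And>N. separated_at (z \<circ> r) N" by metis
  \<comment> \<open>Cut off outside the disk to be a Bergman function; inside it agrees with the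
    symbol of the operator in the statement.\<close>
  define B where "B x = (if x \<in> unit_disk then blaschke_product (z \<circ> r) x else 0)" for x
  obtain C W s t \<rho> where sp: "sparse_symbol B (z \<circ> r) C W s t \<rho>"
    using blaschke_sparse_symbol[OF r(3,2) sep] unfolding B_def[abs_def, symmetric] by blast
  interpret S: sparse_symbol B "z \<circ> r" C W s t \<rho> by (rule sp)
  have "blaschke_sequence (z \<circ> r)"
    using assms(1) blaschke_zeros.w_summable[OF r(3)] by (auto simp: blaschke_sequence_def)
  moreover have False if M: "reducing_subspace (mult_op (blaschke_product (z \<circ> r))) M" "nontrivial_subspace M" for M
  proof -
    have cs: "closed_subspace M" using M by (simp add: reducing_subspace_def)
    obtain P where P: "commuting_projection B P" "\<And>f. f \<in> bergman_space \<Longrightarrow> P f \<in> M" "\<And>f. f \<in> M \<Longrightarrow> P f = f"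
      using reducing_subspace_projection[OF M(1) S.B_bergman S.B_le] by (metis B_def)
    interpret sparse_projection B "z \<circ> r" C W s t \<rho> P
      by (intro sparse_projection.intro sp P(1))
    from sparse_projection_trivial show False
    proof
      assume 0: "\<forall>f\<in>bergman_space. P f = (\<lambda>_. 0)"
      have "f = (\<lambda>_. 0)" if "f \<in> M" for f
        using 0 P(3)[OF that] closed_subspace_subset[OF cs] that by auto
      then have "M = {\<lambda>_. 0}" using cs by (auto simp: closed_subspace_def)
      with M(2) show False by (simp add: nontrivial_subspace_def)
    next
      assume 1: "\<forall>f\<in>bergman_space. P f = f"
      have "bergman_space \<subseteq> M" using 1 P(2) by (metis subsetI)
      with closed_subspace_subset[OF cs] M(2) show False by (auto simp: nontrivial_subspace_def)
    qed
  qed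
  ultimately show ?thesis using r(1) by blast
qed

end
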